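(* Let $(X,d)$ be a metric space with diameter at most $2$ equipped with a Radon probability measure $\nu$, and let $\rho\colon\Gamma\curvearrowright X$ be a continuous measure-class-preserving action of a countable discrete group $\Gamma$. The following are equivalent: (1) $\rho$ is asymptotically expanding; (2) the Druţu--Nowak projection $\mathfrak{G}\in\mathfrak{B}(L^2(\mathcal{O}_\Gamma X,\nu\times\lambda))$ is quasi-local; (3) the Druţu--Nowak projection $\mathfrak{G}$ is an operator-norm limit of operators with finite propagation.
   Context: Measures on metric spaces are defined on the Borel $\sigma$-algebra. $\Gamma$ is equipped with a fixed proper length function $\ell\colon\Gamma\to\{0,1,2,\dots\}$: $\ell(\gamma)=0$ iff $\gamma=1$, $\ell(\gamma)=\ell(\gamma^{-1})$, $\ell(\gamma_1\gamma_2)\le\ell(\gamma_1)+\ell(\gamma_2)$, and all balls $B_k:=\{\gamma:\ell(\gamma)\le k\}$ are finite. For $K\subseteq\Gamma$, $A\subseteq X$, $K\cdot A:=\bigcup_{\gamma\in K}\gamma\cdot A$. An action is measure-class-preserving if it sends null sets to null sets. The action is asymptotically expanding (in measure) if for every $\alpha\in(0,\frac12]$ there are $c(\alpha)>0$ and $k(\alpha)\in\mathbb{N}$ with $\nu(B_{k(\alpha)}\cdot A)>(1+c(\alpha))\nu(A)$ for every measurable $A\subseteq X$ with $\alpha\le\nu(A)\le\frac12$. Unified warped cone: for $t\ge1$ let $d^t_\Gamma$ be the largest metric on $X$ with $d^t_\Gamma\le t\,d$ and $d^t_\Gamma(x,\gamma\cdot x)\le\ell(\gamma)$ for all $x\in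 X,\gamma\in\Gamma$. The unified warped cone $\mathcal{O}_\Gamma X$ is the set $X\times[1,\infty)$ with metric $d_\Gamma((x_1,t_1),(x_2,t_2)):=d_\Gamma^{\min\{t_1,t_2\}}(x_1,x_2)+|t_1-t_2|$, equipped with the measure $\nu\times\lambda$, $\lambda$ the Lebesgue measure on $[1,\infty)$. $P_X\in\mathfrak{B}(L^2(X,\nu))$ is the orthogonal projection onto the constant functions, and the Druţu--Nowak projection is $\mathfrak{G}:=P_X\otimes\mathrm{Id}_{L^2([1,\infty))}$. An operator $T\in\mathfrak{B}(L^2(\mathcal{O}_\Gamma X,\nu\times\lambda))$ is quasi-local if for every $\epsilon>0$ there is $R>0$ such that $\|\chi_AT\chi_C\|<\epsilon$ for all measurable $A,C\subseteq\mathcal{O}_\Gamma X$ with $d_\Gamma(A,C)>R$; it has finite propagation if there is $R>0$ such that $\chi_AT\chi_C=0$ for all measurable $A,C\subseteq\mathcal{O}_\Gamma X$ with $d_\Gamma(A,C)>R$. (Here $d_\Gamma(A,C)$ is the infimum of distances, and $\chi_A$ acts by multiplication.) *)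

theory Defs
  imports "HOL-Probability.Probability" "HOL-Algebra.Group_Action"
begin

section \<open>Radon measures\<close>

definition radon_measure :: "'a::topological_space measure \<Rightarrow> bool" where
  "radon_measure M \<longleftrightarrow>
     sets M = sets borel \<and>
     (\<forall>x. \<exists>U. open U \<and> x \<in> U \<and> emeasure M U < \<infinity>) \<and>
     (\<forall>A\<in>sets M. emeasure M A = (SUP K\<in>{K. compact K \<and> K \<subseteq> A}. emeasure M K))"

section \<open>Length functions and actions\<close>

definition length_ball :: "('g, 'm) monoid_scheme \<Rightarrow> ('g \<Rightarrow> nat) \<Rightarrow> nat \<Rightarrow> 'g set" where
  "length_ball G l k = {g \<in> carrier G. l g \<le> k}"

definition proper_length_function :: "('g, 'm) monoid_scheme \<Rightarrow> ('g \<Rightarrow> nat) \<Rightarrow> bool" where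
  "proper_length_function G l \<longleftrightarrow>
     (\<forall>g\<in>carrier G. l g = 0 \<longleftrightarrow> g = \<one>\<^bsub>G\<^esub>) \<and>
     (\<forall>g\<in>carrier G. l g = l (inv\<^bsub>G\<^esub> g)) \<and>
     (\<forall>g\<in>carrier G. \<forall>h\<in>carrier G. l (g \<otimes>\<^bsub>G\<^esub> h) \<le> l g + l h) \<and>
     (\<forall>k. finite (length_ball G l k))"

definition act_on_set :: "('g \<Rightarrow> 'x \<Rightarrow> 'x) \<Rightarrow> 'g set \<Rightarrow> 'x set \<Rightarrow> 'x set" where
  "act_on_set \<rho> K A = (\<Union>g\<in>K. \<rho> g ` A)"

definition continuous_action ::
  "('g, 'm) monoid_scheme \<Rightarrow> ('g \<Rightarrow> 'x::topological_space \<Rightarrow> 'x) \<Rightarrow> bool" where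
  "continuous_action G \<rho> \<longleftrightarrow>
     group_action G UNIV \<rho> \<and> (\<forall>g\<in>carrier G. continuous_on UNIV (\<rho> g))"

definition measure_class_preserving ::
  "('g, 'm) monoid_scheme \<Rightarrow> 'x measure \<Rightarrow> ('g \<Rightarrow> 'x \<Rightarrow> 'x) \<Rightarrow> bool" where
  "measure_class_preserving G \<nu> \<rho> \<longleftrightarrow>
     (\<forall>g\<in>carrier G. \<forall>N\<in>null_sets \<nu>. \<rho> g ` N \<in> null_sets \<nu>)"

definition asymptotically_expanding ::
  "('g, 'm) monoid_scheme \<Rightarrow> ('g \<Rightarrow> nat) \<Rightarrow> 'x measure \<Rightarrow> ('g \<Rightarrow> 'x \<Rightarrow> 'x) \<Rightarrow> bool" where
  "asymptotically_expanding G l \<nu> \<rho> \<longleftrightarrow>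
     (\<forall>\<alpha>::real. 0 < \<alpha> \<and> \<alpha> \<le> 1/2 \<longrightarrow>
       (\<exists>c>0. \<exists>k. \<forall>A\<in>sets \<nu>. \<alpha> \<le> measure \<nu> A \<and> measure \<nu> A \<le> 1/2 \<longrightarrow>
          measure \<nu> (act_on_set \<rho> (length_ball G l k) A) > (1 + c) * measure \<nu> A))"

section \<open>The unified warped cone\<close>

text \<open>\<open>GREATEST\<close> refers to the pointwise order on functions. The greatest metric exists
  when the space has diameter at most 2, the length function is proper and \<open>t \<ge> 1\<close>.\<close>

definition warped_metric ::
  "('g, 'm) monoid_scheme \<Rightarrow> ('g \<Rightarrow> nat) \<Rightarrow> ('g \<Rightarrow> 'x::metric_space \<Rightarrow> 'x) \<Rightarrow> real
    \<Rightarrow> 'x \<Rightarrow> 'x \<Rightarrow> real" where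
  "warped_metric G l \<rho> t =
     (GREATEST \<delta>. Metric_space UNIV \<delta> \<and>
        (\<forall>x y. \<delta> x y \<le> t * dist x y) \<and>
        (\<forall>x. \<forall>g\<in>carrier G. \<delta> x (\<rho> g x) \<le> real (l g)))"

text \<open>The underlying set of the cone is \<open>UNIV \<times> {1..}\<close>, which is the space of
  \<open>cone_measure \<nu>\<close>. As \<open>[1,\<infinity>)\<close> is second countable, the product \<open>\<sigma>\<close>-algebra
  is the Borel \<open>\<sigma>\<close>-algebra of the cone.\<close>

definition cone_metric ::
  "('g, 'm) monoid_scheme \<Rightarrow> ('g \<Rightarrow> nat) \<Rightarrow> ('g \<Rightarrow> 'x::metric_space \<Rightarrow> 'x)
    \<Rightarrow> 'x \<times> real \<Rightarrow> 'x \<times> real \<Rightarrow> real" where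
  "cone_metric G l \<rho> = (\<lambda>(x1, t1) (x2, t2).
     warped_metric G l \<rho> (min t1 t2) x1 x2 + \<bar>t1 - t2\<bar>)"

definition ray_measure :: "real measure" where
  "ray_measure = restrict_space lborel {1..}"

definition cone_measure :: "'x measure \<Rightarrow> ('x \<times> real) measure" where
  "cone_measure \<nu> = \<nu> \<Otimes>\<^sub>M ray_measure"

section \<open>Bounded operators on \<open>L\<^sup>2\<close>\<close>

text \<open>Elements of \<open>L\<^sup>2\<close> are handled through representatives: functions are identified when
  they agree almost everywhere, and operators act on representatives compatibly with this
  identification.\<close>

definition L2 :: "'a measure \<Rightarrow> ('a \<Rightarrow> complex) set" where
  "L2 M = {f \<in> borel_measurable M. integrable M (\<lambda>x. (cmod (f x))\<^sup>2)}"

definition L2_norm :: "'a measure \<Rightarrow> ('a \<Rightarrow> complex) \<Rightarrow> real" where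
  "L2_norm M f = sqrt (LINT x|M. (cmod (f x))\<^sup>2)"

definition L2_inner :: "'a measure \<Rightarrow> ('a \<Rightarrow> complex) \<Rightarrow> ('a \<Rightarrow> complex) \<Rightarrow> complex" where
  "L2_inner M f g = (LINT x|M. f x * cnj (g x))"

definition L2_bounded_ops :: "'a measure \<Rightarrow> (('a \<Rightarrow> complex) \<Rightarrow> ('a \<Rightarrow> complex)) set" where
  "L2_bounded_ops M = {T.
     (\<forall>f\<in>L2 M. T f \<in> L2 M) \<and>
     (\<forall>f\<in>L2 M. \<forall>g\<in>L2 M. (AE x in M. f x = g x) \<longrightarrow> (AE x in M. T f x = T g x)) \<and>
     (\<forall>f\<in>L2 M. \<forall>g\<in>L2 M. AE x in M. T (\<lambda>y. f y + g y) x = T f x + T g x) \<and>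
     (\<forall>c. \<forall>f\<in>L2 M. AE x in M. T (\<lambda>y. c * f y) x = c * T f x) \<and>
     (\<exists>C. \<forall>f\<in>L2 M. L2_norm M (T f) \<le> C * L2_norm M f)}"

definition L2_opnorm :: "'a measure \<Rightarrow> (('a \<Rightarrow> complex) \<Rightarrow> ('a \<Rightarrow> complex)) \<Rightarrow> real" where
  "L2_opnorm M T = (SUP f\<in>{f \<in> L2 M. L2_norm M f \<le> 1}. L2_norm M (T f))"

definition mult_indicator :: "'a set \<Rightarrow> ('a \<Rightarrow> complex) \<Rightarrow> 'a \<Rightarrow> complex" where
  "mult_indicator A f = (\<lambda>x. indicator A x * f x)"

definition cut_op ::
  "'a set \<Rightarrow> (('a \<Rightarrow> complex) \<Rightarrow> ('a \<Rightarrow> complex)) \<Rightarrow> 'a set \<Rightarrow> ('a \<Rightarrow> complex) \<Rightarrow> 'a \<Rightarrow> complex" where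
  "cut_op A T C = (\<lambda>f. mult_indicator A (T (mult_indicator C f)))"

definition set_distance :: "('a \<Rightarrow> 'a \<Rightarrow> real) \<Rightarrow> 'a set \<Rightarrow> 'a set \<Rightarrow> ereal" where
  "set_distance d A C = (INF a\<in>A. INF c\<in>C. ereal (d a c))"

definition quasi_local ::
  "'a measure \<Rightarrow> ('a \<Rightarrow> 'a \<Rightarrow> real) \<Rightarrow> (('a \<Rightarrow> complex) \<Rightarrow> ('a \<Rightarrow> complex)) \<Rightarrow> bool" where
  "quasi_local M d T \<longleftrightarrow>
     (\<forall>\<epsilon>::real. \<epsilon> > 0 \<longrightarrow> (\<exists>R::real. R > 0 \<and>
        (\<forall>A\<in>sets M. \<forall>C\<in>sets M. set_distance d A C > ereal R \<longrightarrow>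
           L2_opnorm M (cut_op A T C) < \<epsilon>)))"

definition finite_propagation ::
  "'a measure \<Rightarrow> ('a \<Rightarrow> 'a \<Rightarrow> real) \<Rightarrow> (('a \<Rightarrow> complex) \<Rightarrow> ('a \<Rightarrow> complex)) \<Rightarrow> bool" where
  "finite_propagation M d T \<longleftrightarrow>
     (\<exists>R::real. R > 0 \<and>
        (\<forall>A\<in>sets M. \<forall>C\<in>sets M. set_distance d A C > ereal R \<longrightarrow>
           (\<forall>f\<in>L2 M. AE x in M. cut_op A T C f x = 0)))"

definition opnorm_limit_of_finite_propagation ::
  "'a measure \<Rightarrow> ('a \<Rightarrow> 'a \<Rightarrow> real) \<Rightarrow> (('a \<Rightarrow> complex) \<Rightarrow> ('a \<Rightarrow> complex)) \<Rightarrow> bool" where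
  "opnorm_limit_of_finite_propagation M d T \<longleftrightarrow>
     (\<exists>S :: nat \<Rightarrow> ('a \<Rightarrow> complex) \<Rightarrow> ('a \<Rightarrow> complex).
        (\<forall>n. S n \<in> L2_bounded_ops M \<and> finite_propagation M d (S n)) \<and>
        (\<lambda>n. L2_opnorm M (\<lambda>f x. S n f x - T f x)) \<longlonglongrightarrow> 0)"

section \<open>The Drutu--Nowak projection\<close>

definition L2_proj ::
  "'a measure \<Rightarrow> ('a \<Rightarrow> complex) set \<Rightarrow> ('a \<Rightarrow> complex) \<Rightarrow> ('a \<Rightarrow> complex)" where
  "L2_proj M V f = (SOME g. g \<in> V \<and> (\<forall>h\<in>V. L2_inner M (\<lambda>x. f x - g x) h = 0))"

definition constant_functions :: "('a \<Rightarrow> complex) set" where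
  "constant_functions = range (\<lambda>c x. c)"

text \<open>For \<open>\<sigma>\<close>-finite measures, \<open>S \<otimes> T\<close> is the bounded operator on \<open>L\<^sup>2\<close> of the product that
  sends every elementary tensor \<open>f \<otimes> g\<close> to \<open>S f \<otimes> T g\<close>. By density of the span of elementary
  tensors it is determined up to almost-everywhere equality of its values.\<close>

definition L2_tensor ::
  "'a measure \<Rightarrow> 'b measure \<Rightarrow> (('a \<Rightarrow> complex) \<Rightarrow> ('a \<Rightarrow> complex)) \<Rightarrow>
    (('b \<Rightarrow> complex) \<Rightarrow> ('b \<Rightarrow> complex)) \<Rightarrow> ('a \<times> 'b \<Rightarrow> complex) \<Rightarrow> 'a \<times> 'b \<Rightarrow> complex" where
  "L2_tensor M N S T = (SOME U. U \<in> L2_bounded_ops (M \<Otimes>\<^sub>M N) \<and>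
     (\<forall>f\<in>L2 M. \<forall>g\<in>L2 N. AE z in M \<Otimes>\<^sub>M N.
        U (\<lambda>(x, y). f x * g y) z = (case z of (x, y) \<Rightarrow> S f x * T g y)))"

definition drutu_nowak_projection ::
  "'x measure \<Rightarrow> ('x \<times> real \<Rightarrow> complex) \<Rightarrow> 'x \<times> real \<Rightarrow> complex" where
  "drutu_nowak_projection \<nu> =
     L2_tensor \<nu> ray_measure (L2_proj \<nu> constant_functions) (\<lambda>f. f)"

end

theory Submission
  imports Defs
begin

text \<open>
  An operator of finite propagation has no corner between two sets that are far apart, so a norm limit
  of such operators is quasi-local. If the projection is quasi-local, the action expands: otherwise
  there are sets \<open>A\<close> of definite measure for which \<open>B\<^sub>n \<cdot> A\<close> leaves out a set of definite measure, and
  inner regularity gives compact sets \<open>K\<close> and \<open>L\<close> inside these two. Far out in the cone, \<open>K\<close> and \<open>L\<close> are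
  at distance at least \<open>n\<close> (\<open>warped_metric_separates\<close>), but the corner of the projection between
  \<open>K \<times> I\<close> and \<open>L \<times> I\<close>, for an interval \<open>I\<close> of length \<open>1\<close>, has norm at least \<open>\<nu>(L) \<surd>\<nu>(K)\<close>
  (\<open>expanding_if_quasi_local\<close>).

  The substance is the passage from expansion to operators of finite propagation. On every slice
  \<open>X \<times> {t}\<close> the projection takes the mean (\<open>drutu_nowak_projection\<close>), and a finite sum of weighted
  translations \<open>f \<mapsto> a (f \<circ> g)\<close> has finite propagation in the cone, uniformly in \<open>t\<close>. Hence it suffices
  to approximate the mean on \<open>L\<^sup>2(X, \<nu>)\<close> in norm by such sums (\<open>mean_approximation\<close>).

  Join \<open>x\<close> to \<open>g x\<close>, for \<open>g\<close> in a ball, by an edge of weight \<open>min 1 (J x)\<close>, where \<open>J\<close> is the Jacobian of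
  \<open>g\<close>. This edge measure on \<open>X \<times> X\<close> is symmetric, has bounded marginals although Jacobians may be
  unbounded, and still shows the expansion of the sets of measure between \<open>\<alpha>\<close> and \<open>1/2\<close>, at a rate that
  depends on \<open>\<alpha>\<close> (\<open>edge_expansion\<close>). The obstruction to a spectral gap is that small sets need not
  expand. A maximal set with small boundary and measure at most \<open>1/2\<close> has measure below \<open>\<alpha>\<close>, and on its
  complement \<open>Y\<close> all sets expand at a common rate (\<open>domain_of_expansion\<close>). By Cheeger's inequality
  (\<open>cheeger\<close>) the random walk on \<open>Y\<close> then has a spectral gap (\<open>walk_contracts\<close>). Its powers are sums of
  weighted translations and converge in norm to the mean over \<open>Y\<close>, which is close to the mean over
  \<open>X\<close> because \<open>\<nu>(Y) \<ge> 1 - \<alpha>\<close> (\<open>mean_on_subset_close\<close>).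
\<close>

section \<open>The warped metric through path costs\<close>

text \<open>The chains of steps that bound the warped metric from above: moving costs the scaled distance,
  acting by a group element costs its length.\<close>

inductive warped_path ::
  "('g, 'm) monoid_scheme \<Rightarrow> ('g \<Rightarrow> nat) \<Rightarrow> ('g \<Rightarrow> 'x::metric_space \<Rightarrow> 'x) \<Rightarrow> real
    \<Rightarrow> 'x \<Rightarrow> 'x \<Rightarrow> real \<Rightarrow> bool" for G l \<rho> t x where
  start: "warped_path G l \<rho> t x x 0"
| move: "warped_path G l \<rho> t x y c \<Longrightarrow> warped_path G l \<rho> t x z (c + t * dist y z)"
| act: "warped_path G l \<rho> t x y c \<Longrightarrow> g \<in> carrier G \<Longrightarrow>
    warped_path G l \<rho> t x (\<rho> g y) (c + real (l g))"

definition path_cost ::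
  "('g, 'm) monoid_scheme \<Rightarrow> ('g \<Rightarrow> nat) \<Rightarrow> ('g \<Rightarrow> 'x::metric_space \<Rightarrow> 'x) \<Rightarrow> real
    \<Rightarrow> 'x \<Rightarrow> 'x \<Rightarrow> real" where
  "path_cost G l \<rho> t x y = Inf {c. warped_path G l \<rho> t x y c}"

locale length_action = group_action G "UNIV :: 'x::metric_space set" \<rho>
  for G :: "('g, 'm) monoid_scheme" (structure) and \<rho> +
  fixes l :: "'g \<Rightarrow> nat"
  assumes length: "proper_length_function G l"
    and continuous: "g \<in> carrier G \<Longrightarrow> continuous_on UNIV (\<rho> g)"
begin

sublocale group G
  using group_hom by (rule group_hom.axioms(1))

lemma act_one [simp]: "\<rho> \<one> x = x"
  by (metis id_eq_one UNIV_I restrict_apply)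

lemma act_mult: "g \<in> carrier G \<Longrightarrow> h \<in> carrier G \<Longrightarrow> \<rho> (g \<otimes> h) x = \<rho> g (\<rho> h x)"
  by (simp add: composition_rule)

lemma act_inv [simp]: "g \<in> carrier G \<Longrightarrow> \<rho> (inv g) (\<rho> g x) = x"
  by (metis act_mult act_one inv_closed l_inv)

lemma act_inv' [simp]: "g \<in> carrier G \<Longrightarrow> \<rho> g (\<rho> (inv g) x) = x"
  by (metis act_mult act_one inv_closed r_inv)

lemma length_inv [simp]: "g \<in> carrier G \<Longrightarrow> l (inv g) = l g"
  using length unfolding proper_length_function_def by metis

lemma length_mult: "g \<in> carrier G \<Longrightarrow> h \<in> carrier G \<Longrightarrow> l (g \<otimes> h) \<le> l g + l h"
  using length unfolding proper_length_function_def by metis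

lemma length_zero_iff: "g \<in> carrier G \<Longrightarrow> l g = 0 \<longleftrightarrow> g = \<one>"
  using length unfolding proper_length_function_def by metis

lemma length_one [simp]: "l \<one> = 0"
  by (simp add: length_zero_iff)

lemma finite_ball [simp]: "finite (length_ball G l k)"
  using length unfolding proper_length_function_def by metis

lemma one_in_ball: "\<one> \<in> length_ball G l k"
  by (simp add: length_ball_def)

lemma ball_carrier: "g \<in> length_ball G l k \<Longrightarrow> g \<in> carrier G"
  by (simp add: length_ball_def)

lemma warped_path_nonneg: "warped_path G l \<rho> t x y c \<Longrightarrow> 0 \<le> t \<Longrightarrow> 0 \<le> c"
  by (induction rule: warped_path.induct) auto

lemma warped_path_move: "warped_path G l \<rho> t x y (t * dist x y)"
  using warped_path.move[OF warped_path.start] by fastforce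

lemma warped_path_act: "g \<in> carrier G \<Longrightarrow> warped_path G l \<rho> t x (\<rho> g x) (real (l g))"
  using warped_path.act[OF warped_path.start] by fastforce

lemma warped_path_trans:
  assumes "warped_path G l \<rho> t y z c'" "warped_path G l \<rho> t x y c"
  shows "warped_path G l \<rho> t x z (c + c')"
  using assms
proof (induction rule: warped_path.induct)
  case (move y' c' z')
  then show ?case using warped_path.move by (metis add.assoc)
next
  case (act y' c' g)
  then show ?case using warped_path.act by (metis add.assoc)
qed simp

lemma warped_path_sym: "warped_path G l \<rho> t x y c \<Longrightarrow> warped_path G l \<rho> t y x c"
proof (induction rule: warped_path.induct)
  case start
  show ?case by (rule warped_path.start)
next
  case (move y c z)
  then show ?case
    using warped_path_trans[OF move.IH warped_path_move[of t z y]]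
    by (simp add: dist_commute add.commute)
next
  case (act y c g)
  have "warped_path G l \<rho> t (\<rho> g y) y (real (l g))"
    using warped_path_act[of "inv g" t "\<rho> g y"] act by simp
  from warped_path_trans[OF act.IH this] show ?case by (simp add: add.commute)
qed

text \<open>A path that uses a nontrivial group element costs at least \<open>1\<close>, and any other path costs at
  least the scaled distance; this is what makes the cost definite.\<close>

lemma warped_path_lower:
  "warped_path G l \<rho> t x y c \<Longrightarrow> 0 \<le> t \<Longrightarrow> min 1 (t * dist x y) \<le> c"
proof (induction rule: warped_path.induct)
  case (move y c z)
  have "t * dist x z \<le> t * dist x y + t * dist y z"
    using mult_left_mono[OF dist_triangle[of x z y] move.prems] by (simp add: distrib_left)
  moreover have "0 \<le> t * dist y z" using move.prems by simp
  ultimately show ?case using move.IH[OF move.prems] unfolding min_le_iff_disj by linarith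
next
  case (act y c g)
  show ?case
  proof (cases "l g = 0")
    case True
    then show ?thesis using act length_zero_iff by auto
  next
    case False
    then have "1 \<le> real (l g)" by simp
    moreover have "0 \<le> c" using act warped_path_nonneg by blast
    ultimately show ?thesis by auto
  qed
qed auto

lemma path_cost_le: "warped_path G l \<rho> t x y c \<Longrightarrow> 0 \<le> t \<Longrightarrow> path_cost G l \<rho> t x y \<le> c"
  unfolding path_cost_def
  by (rule cInf_lower) (auto intro!: bdd_belowI[of _ 0] dest: warped_path_nonneg)

lemma le_path_cost:
  "(\<And>c. warped_path G l \<rho> t x y c \<Longrightarrow> b \<le> c) \<Longrightarrow> b \<le> path_cost G l \<rho> t x y"
  unfolding path_cost_def using warped_path_move[of t x y] by (intro cInf_greatest) blast+

lemma path_cost_metric: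
  assumes "0 < t"
  shows "Metric_space UNIV (path_cost G l \<rho> t)"
proof
  have t: "0 \<le> t" using assms by simp
  show nn: "0 \<le> path_cost G l \<rho> t x y" for x y
    by (rule le_path_cost) (rule warped_path_nonneg[OF _ t])
  show "path_cost G l \<rho> t x y = path_cost G l \<rho> t y x" for x y
    by (rule antisym; rule le_path_cost; rule path_cost_le[OF _ t]; rule warped_path_sym)
  show "path_cost G l \<rho> t x y = 0 \<longleftrightarrow> x = y" for x y
  proof
    assume eq: "path_cost G l \<rho> t x y = 0"
    have "min 1 (t * dist x y) \<le> path_cost G l \<rho> t x y"
      by (rule le_path_cost) (rule warped_path_lower[OF _ t])
    then show "x = y" using eq assms by (auto simp: min_def mult_le_0_iff split: if_splits)
  next
    assume "x = y"
    then have "path_cost G l \<rho> t x y \<le> 0"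
      using path_cost_le[OF warped_path.start t] by simp
    then show "path_cost G l \<rho> t x y = 0" using nn by (metis antisym)
  qed
  show "path_cost G l \<rho> t x z \<le> path_cost G l \<rho> t x y + path_cost G l \<rho> t y z" for x y z
  proof -
    have *: "path_cost G l \<rho> t x z - c \<le> path_cost G l \<rho> t y z"
      if "warped_path G l \<rho> t x y c" for c
    proof (rule le_path_cost)
      fix c' assume "warped_path G l \<rho> t y z c'"
      from path_cost_le[OF warped_path_trans[OF this that] t]
      show "path_cost G l \<rho> t x z - c \<le> c'" by simp
    qed
    have "path_cost G l \<rho> t x z - path_cost G l \<rho> t y z \<le> path_cost G l \<rho> t x y"
      by (rule le_path_cost) (use * in force)
    then show ?thesis by simp
  qed
qed

text \<open>The path cost belongs to the family of which the warped metric is the greatest element, and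
  every member of that family is bounded along a path by its cost.\<close>

lemma warped_metric_eq_path_cost:
  assumes "0 < t"
  shows "warped_metric G l \<rho> t = path_cost G l \<rho> t"
  unfolding warped_metric_def
proof (rule Greatest_equality)
  have t: "0 \<le> t" using assms by simp
  show "Metric_space UNIV (path_cost G l \<rho> t) \<and>
    (\<forall>x y. path_cost G l \<rho> t x y \<le> t * dist x y) \<and>
    (\<forall>x. \<forall>g\<in>carrier G. path_cost G l \<rho> t x (\<rho> g x) \<le> real (l g))"
    using path_cost_metric[OF assms] path_cost_le[OF warped_path_move t]
      path_cost_le[OF warped_path_act t] by auto
next
  fix \<delta>
  assume \<delta>: "Metric_space UNIV \<delta> \<and> (\<forall>x y. \<delta> x y \<le> t * dist x y) \<and>
    (\<forall>x. \<forall>g\<in>carrier G. \<delta> x (\<rho> g x) \<le> real (l g))"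
  then interpret \<delta>: Metric_space UNIV \<delta> by simp
  have "\<delta> x y \<le> c" if "warped_path G l \<rho> t x y c" for x y c
    using that
  proof (induction rule: warped_path.induct)
    case (move y c z)
    have "\<delta> y z \<le> t * dist y z" using \<delta> by simp
    with move \<delta>.triangle[of x y z] show ?case by simp
  next
    case (act y c g)
    then have "\<delta> y (\<rho> g y) \<le> real (l g)" using \<delta> by simp
    with act \<delta>.triangle[of x y "\<rho> g y"] show ?case by simp
  qed simp
  then show "\<delta> \<le> path_cost G l \<rho> t" by (auto simp: le_fun_def intro: le_path_cost)
qed

lemma warped_metric_act_le:
  assumes "0 < t" "g \<in> carrier G"
  shows "warped_metric G l \<rho> t x (\<rho> g x) \<le> real (l g)"
  using assms path_cost_le[OF warped_path_act] by (simp add: warped_metric_eq_path_cost)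

text \<open>Uniform continuity at the points of a compact set, with comparison points from the whole space:
  the paths that start in a compact set may leave it.\<close>

lemma continuous_near_compact:
  fixes f :: "'x \<Rightarrow> 'x"
  assumes "compact K" "continuous_on UNIV f" "0 < e"
  shows "\<exists>d>0. \<forall>z\<in>K. \<forall>y. dist y z < d \<longrightarrow> dist (f y) (f z) < e"
proof -
  define \<U> where "\<U> = range (\<lambda>w. f -` ball w (e / 2))"
  have "K \<subseteq> \<Union>\<U>" 
  proof
    fix z
    have "z \<in> f -` ball (f z) (e / 2)" using assms(3) by simp
    then show "z \<in> \<Union>\<U>" unfolding \<U>_def by blast
  qed
  moreover have "open b" if "b \<in> \<U>" for b
    using that assms(2) by (auto simp: \<U>_def intro!: open_vimage)
  ultimately obtain d where d: "d > 0" "\<And>x. x \<in> K \<Longrightarrow> \<exists>b\<in>\<U>. ball x d \<subseteq> b"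
    using Heine_Borel_lemma[OF assms(1)] by metis
  have "dist (f y) (f z) < e" if z: "z \<in> K" and yz: "dist y z < d" for y z
  proof -
    obtain w where w: "ball z d \<subseteq> f -` ball w (e / 2)" using d(2)[OF z] by (auto simp: \<U>_def)
    have "z \<in> ball z d" "y \<in> ball z d" using z yz d(1) by (auto simp: dist_commute)
    then have "z \<in> f -` ball w (e / 2)" "y \<in> f -` ball w (e / 2)" using w by blast+
    then have "dist w (f z) < e / 2" "dist w (f y) < e / 2" by simp_all
    then show ?thesis using dist_triangle_half_r[of w "f y" e "f z"] by simp
  qed
  with d(1) show ?thesis by blast
qed

lemma compact_ball_orbit:
  assumes "compact K"
  shows "compact (act_on_set \<rho> (length_ball G l n) K)"
  unfolding act_on_set_def
  using assms continuous
  by (auto intro!: compact_UN compact_continuous_image intro: continuous_on_subset dest: ball_carrier)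

text \<open>For compact \<open>K\<close>, a path of cost below \<open>n\<close> that starts in \<open>K\<close> contains fewer than \<open>n\<close>
  nontrivial group steps, of total length below \<open>n\<close>, and for large \<open>t\<close> its metric steps are too short
  to matter: the path ends near a point of \<open>B\<^sub>n \<cdot> K\<close>. The tolerances \<open>d i\<close> control how the
  error left by the metric steps grows under the remaining \<open>i\<close> units of group length.\<close>

lemma warped_metric_separates:
  assumes K: "compact K" and L: "compact L"
    and disj: "L \<inter> act_on_set \<rho> (length_ball G l n) K = {}"
  shows "\<exists>T\<ge>1. \<forall>t\<ge>T. \<forall>x\<in>K. \<forall>y\<in>L. real n \<le> warped_metric G l \<rho> t x y"
proof -
  let ?B = "length_ball G l n"
  define K' where "K' = act_on_set \<rho> ?B K"
  have cK': "compact K'" using compact_ball_orbit[OF K] by (simp add: K'_def)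
  obtain \<epsilon> where "\<epsilon> > 0" and \<epsilon>': "\<And>y. y \<in> L \<Longrightarrow> \<exists>U\<in>{- K'}. ball y \<epsilon> \<subseteq> U"
    using Heine_Borel_lemma[OF L, of "{- K'}"] disj compact_imp_closed[OF cK']
    by (auto simp: K'_def disjoint_eq_subset_Compl)
  then have \<epsilon>: "\<epsilon> > 0" "\<And>y z. y \<in> L \<Longrightarrow> z \<in> K' \<Longrightarrow> \<epsilon> \<le> dist y z"
    by (auto simp: subset_eq not_less[symmetric])
  have step: "\<exists>e'. 0 < e' \<and> e' \<le> e \<and>
      (\<forall>g\<in>?B. \<forall>z\<in>K'. \<forall>y. dist y z < 2 * e' \<longrightarrow> dist (\<rho> g y) (\<rho> g z) < e)" if "0 < e" for e :: real
  proof -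
    have "\<forall>g\<in>?B. \<exists>d>0. \<forall>z\<in>K'. \<forall>y. dist y z < d \<longrightarrow> dist (\<rho> g y) (\<rho> g z) < e"
      using continuous_near_compact[OF cK' continuous that] ball_carrier by blast
    then obtain d where d: "\<And>g. g \<in> ?B \<Longrightarrow> 0 < d g"
      "\<And>g z y. g \<in> ?B \<Longrightarrow> z \<in> K' \<Longrightarrow> dist y z < d g \<Longrightarrow> dist (\<rho> g y) (\<rho> g z) < e"
      by metis
    define e' where "e' = min e (Min (d ` ?B) / 2)"
    have ne: "?B \<noteq> {}" using one_in_ball by blast
    have "0 < e'" using that d(1) ne by (auto simp: e'_def)
    moreover have "2 * e' \<le> d g" if "g \<in> ?B" for g
    proof -
      have "Min (d ` ?B) \<le> d g" using that by simp
      then show ?thesis by (auto simp: e'_def min_def)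
    qed
    moreover have "e' \<le> e" by (simp add: e'_def)
    ultimately show ?thesis using d(2) by (intro exI[of _ e']) (meson less_le_trans)
  qed
  have "\<exists>d. \<forall>i. (0 < d i \<and> (i = 0 \<longrightarrow> d i = \<epsilon> / 2)) \<and> (d (Suc i) \<le> d i \<and>
      (\<forall>g\<in>?B. \<forall>z\<in>K'. \<forall>y. dist y z < 2 * d (Suc i) \<longrightarrow> dist (\<rho> g y) (\<rho> g z) < d i))"
  proof (rule dependent_nat_choice)
    show "\<exists>x. 0 < x \<and> (0 = (0::nat) \<longrightarrow> x = \<epsilon> / 2)" using \<epsilon>(1) by (intro exI[of _ "\<epsilon> / 2"]) simp
    fix x :: real and i :: nat
    assume "0 < x \<and> (i = 0 \<longrightarrow> x = \<epsilon> / 2)"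
    then show "\<exists>y. (0 < y \<and> (Suc i = 0 \<longrightarrow> y = \<epsilon> / 2)) \<and> y \<le> x \<and>
        (\<forall>g\<in>?B. \<forall>z\<in>K'. \<forall>w. dist w z < 2 * y \<longrightarrow> dist (\<rho> g w) (\<rho> g z) < x)"
      using step[of x] by simp
  qed
  then obtain d :: "nat \<Rightarrow> real" where d_all: "\<forall>i. (0 < d i \<and> (i = 0 \<longrightarrow> d i = \<epsilon> / 2)) \<and> (d (Suc i) \<le> d i \<and>
      (\<forall>g\<in>?B. \<forall>z\<in>K'. \<forall>y. dist y z < 2 * d (Suc i) \<longrightarrow> dist (\<rho> g y) (\<rho> g z) < d i))" ..
  then have d: "\<And>i. 0 < d i" "d 0 = \<epsilon> / 2" "\<And>i. d (Suc i) \<le> d i"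
    "\<And>i g z y. g \<in> ?B \<Longrightarrow> z \<in> K' \<Longrightarrow> dist y z < 2 * d (Suc i) \<Longrightarrow> dist (\<rho> g y) (\<rho> g z) < d i"
    by simp_all
  have dmono: "d j \<le> d i" if "i \<le> j" for i j
    using lift_Suc_antimono_le[of d, OF d(3) that] .
  define T where "T = max 1 (real n / d n)"
  have "real n \<le> warped_metric G l \<rho> t x y" if t: "t \<ge> T" and x: "x \<in> K" and y: "y \<in> L" for t x y
  proof -
    have t0: "0 < t" using t by (auto simp: T_def)
    have "real n / d n \<le> t" using t by (simp add: T_def)
    then have nt: "real n / t \<le> d n" using d(1)[of n] t0 by (simp add: field_simps)
    (* j is the group length spent so far; each metric step of cost s contributes s / t to the error *)
    have near: "\<exists>j \<gamma>. \<gamma> \<in> length_ball G l j \<and> j \<le> n \<and> real j \<le> c \<and>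
        dist y (\<rho> \<gamma> x) < d (n - j) + (c - real j) / t"
      if "warped_path G l \<rho> t x y c" "c < real n" for y c
      using that
    proof (induction rule: warped_path.induct)
      case start
      show ?case using d(1)[of n] one_in_ball[of 0] by (intro exI[of _ 0] exI[of _ "\<one>"]) simp
    next
      case (move y c z)
      have "0 \<le> t * dist y z" using t0 by simp
      with move obtain j \<gamma> where j: "\<gamma> \<in> length_ball G l j" "j \<le> n" "real j \<le> c"
        "dist y (\<rho> \<gamma> x) < d (n - j) + (c - real j) / t" by force
      have "dist z (\<rho> \<gamma> x) \<le> dist y z + dist y (\<rho> \<gamma> x)" by (metis dist_commute dist_triangle)
      also have "\<dots> < d (n - j) + (c + t * dist y z - real j) / t"
        using j(4) t0 by (simp add: field_simps)
      finally show ?case using j \<open>0 \<le> t * dist y z\<close> by (intro exI[of _ j] exI[of _ \<gamma>]) auto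
    next
      case (act y c g)
      then obtain j \<gamma> where j: "\<gamma> \<in> length_ball G l j" "j \<le> n" "real j \<le> c"
        "dist y (\<rho> \<gamma> x) < d (n - j) + (c - real j) / t" by force
      show ?case
      proof (cases "l g = 0")
        case True
        then have "g = \<one>" using act length_zero_iff by blast
        then show ?thesis using j by (intro exI[of _ j] exI[of _ \<gamma>]) auto
      next
        case False
        have jn: "j + l g \<le> n" using j(3) act.prems by linarith
        have g: "g \<in> ?B" using act jn by (simp add: length_ball_def)
        have \<gamma>: "\<gamma> \<in> carrier G" using j(1) ball_carrier by blast
        have z: "\<rho> \<gamma> x \<in> K'" using j x by (auto simp: K'_def act_on_set_def length_ball_def)
        have "(c - real j) / t \<le> real n / t"
          using j act.prems t0 by (intro divide_right_mono) auto
        then have "(c - real j) / t \<le> d (n - j)" using nt dmono[of "n - j" n] by simp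
        then have "dist y (\<rho> \<gamma> x) < 2 * d (n - j)" using j(4) by simp
        moreover have "n - j = Suc (n - j - 1)" using jn False by simp
        ultimately have "dist (\<rho> g y) (\<rho> g (\<rho> \<gamma> x)) < d (n - j - 1)"
          using d(4)[OF g z] by metis
        also have "\<dots> \<le> d (n - (j + l g))" using False by (intro dmono) simp
        finally have "dist (\<rho> g y) (\<rho> (g \<otimes> \<gamma>) x) < d (n - (j + l g))"
          using act \<gamma> by (simp add: act_mult)
        moreover have "0 \<le> (c + real (l g) - real (j + l g)) / t" using j t0 by simp
        moreover have "g \<otimes> \<gamma> \<in> length_ball G l (j + l g)"
          using length_mult[of g \<gamma>] act \<gamma> j(1) by (simp add: length_ball_def)
        ultimately show ?thesis using jn j(3)
          by (intro exI[of _ "j + l g"] exI[of _ "g \<otimes> \<gamma>"]) auto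
      qed
    qed
    have "real n \<le> c" if path: "warped_path G l \<rho> t x y c" for c
    proof (rule ccontr)
      assume "\<not> real n \<le> c"
      then obtain j \<gamma> where j: "\<gamma> \<in> length_ball G l j" "j \<le> n" "real j \<le> c"
        "dist y (\<rho> \<gamma> x) < d (n - j) + (c - real j) / t" "c < real n"
        using near[OF path] by fastforce
      have "\<rho> \<gamma> x \<in> K'" using j x by (auto simp: K'_def act_on_set_def length_ball_def)
      then have "\<epsilon> \<le> dist y (\<rho> \<gamma> x)" using \<epsilon>(2) y by blast
      moreover have "(c - real j) / t \<le> real n / t"
        using j t0 by (intro divide_right_mono) auto
      ultimately show False
        using j(4) nt dmono[of "n - j" n] dmono[of 0 "n - j"] dmono[of 0 n] d(2) by simp
    qed
    then show ?thesis using t0 by (simp add: warped_metric_eq_path_cost le_path_cost)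
  qed
  then show ?thesis by (intro exI[of _ T]) (auto simp: T_def)
qed

end

section \<open>Square-integrable functions and bounded operators\<close>

definition sq_integral :: "'a measure \<Rightarrow> ('a \<Rightarrow> 'b::real_normed_vector) \<Rightarrow> ennreal" where
  "sq_integral M f = (\<integral>\<^sup>+x. ennreal ((norm (f x))\<^sup>2) \<partial>M)"

lemma L2_iff_sq_integral: "f \<in> L2 M \<longleftrightarrow> f \<in> borel_measurable M \<and> sq_integral M f < \<infinity>"
  unfolding L2_def sq_integral_def integrable_iff_bounded by auto

lemma L2D: assumes "f \<in> L2 M" shows "f \<in> borel_measurable M" "sq_integral M f < \<infinity>"
  using assms by (auto simp: L2_iff_sq_integral)

lemma L2_norm_nonneg [simp]: "0 \<le> L2_norm M f"
  by (simp add: L2_norm_def)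

lemma sq_integral_eq_L2_norm:
  assumes "f \<in> L2 M"
  shows "sq_integral M f = ennreal ((L2_norm M f)\<^sup>2)"
  using assms unfolding L2_def sq_integral_def L2_norm_def
  by (subst nn_integral_eq_integral) auto

lemma L2_norm_le_iff:
  assumes "f \<in> L2 M" "0 \<le> c"
  shows "L2_norm M f \<le> c \<longleftrightarrow> sq_integral M f \<le> ennreal (c\<^sup>2)"
  using assms by (simp add: sq_integral_eq_L2_norm abs_le_square_iff[symmetric])

lemma sq_integral_mono:
  "(\<And>x. x \<in> space M \<Longrightarrow> norm (f x) \<le> norm (g x)) \<Longrightarrow> sq_integral M f \<le> sq_integral M g"
  unfolding sq_integral_def by (intro nn_integral_mono ennreal_leI power_mono) auto

lemma sq_integral_cong_AE:
  "AE x in M. f x = g x \<Longrightarrow> sq_integral M f = sq_integral M g"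
  unfolding sq_integral_def by (rule nn_integral_cong_AE) auto

lemma norm_add_sq_le:
  fixes a b :: "'a::real_normed_vector"
  shows "(norm (a + b))\<^sup>2 \<le> 2 * (norm a)\<^sup>2 + 2 * (norm b)\<^sup>2"
proof -
  have "(norm (a + b))\<^sup>2 \<le> (norm a + norm b)\<^sup>2"
    by (intro power_mono norm_triangle_ineq) simp
  also have "\<dots> \<le> 2 * (norm a)\<^sup>2 + 2 * (norm b)\<^sup>2"
    using sum_squares_bound[of "norm a" "norm b"] by (simp add: power2_sum)
  finally show ?thesis .
qed

lemma sq_integral_add_le:
  fixes f g :: "'a \<Rightarrow> 'b::{second_countable_topology, real_normed_vector}"
  assumes [measurable]: "f \<in> borel_measurable M" "g \<in> borel_measurable M"
  shows "sq_integral M (\<lambda>x. f x + g x) \<le> 2 * sq_integral M f + 2 * sq_integral M g"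
proof -
  have "sq_integral M (\<lambda>x. f x + g x)
      \<le> (\<integral>\<^sup>+x. 2 * ennreal ((norm (f x))\<^sup>2) + 2 * ennreal ((norm (g x))\<^sup>2) \<partial>M)"
    unfolding sq_integral_def
  proof (rule nn_integral_mono)
    fix x
    have "ennreal ((norm (f x + g x))\<^sup>2) \<le> ennreal (2 * (norm (f x))\<^sup>2 + 2 * (norm (g x))\<^sup>2)"
      by (intro ennreal_leI norm_add_sq_le)
    then show "ennreal ((norm (f x + g x))\<^sup>2)
        \<le> 2 * ennreal ((norm (f x))\<^sup>2) + 2 * ennreal ((norm (g x))\<^sup>2)"
      by (simp add: ennreal_plus ennreal_mult)
  qed
  also have "\<dots> = 2 * sq_integral M f + 2 * sq_integral M g"
    unfolding sq_integral_def by (subst nn_integral_add) (auto simp: nn_integral_cmult)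
  finally show ?thesis .
qed

lemma sq_integral_scale:
  fixes f :: "'a \<Rightarrow> 'b::{second_countable_topology, real_normed_div_algebra}"
  assumes [measurable]: "f \<in> borel_measurable M"
  shows "sq_integral M (\<lambda>x. c * f x) = ennreal ((norm c)\<^sup>2) * sq_integral M f"
  unfolding sq_integral_def
  by (subst nn_integral_cmult[symmetric]) (auto simp: norm_mult power_mult_distrib ennreal_mult)

lemma sq_integral_eq_0D:
  fixes f :: "'a \<Rightarrow> 'b::{second_countable_topology, real_normed_vector}"
  assumes [measurable]: "f \<in> borel_measurable M" and "sq_integral M f = 0"
  shows "AE x in M. f x = 0"
  using assms(2) unfolding sq_integral_def
  by (subst (asm) nn_integral_0_iff_AE) (auto simp: ennreal_eq_0_iff)

lemma L2_add:
  assumes "f \<in> L2 M" "g \<in> L2 M"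
  shows "(\<lambda>x. f x + g x) \<in> L2 M"
proof -
  have "sq_integral M (\<lambda>x. f x + g x) \<le> 2 * sq_integral M f + 2 * sq_integral M g"
    using assms by (intro sq_integral_add_le) (auto dest: L2D)
  also have "\<dots> < \<infinity>" using L2D(2)[OF assms(1)] L2D(2)[OF assms(2)]
    by (simp add: ennreal_mult_less_top)
  finally show ?thesis using assms by (auto simp: L2_iff_sq_integral)
qed

lemma L2_scale:
  assumes "f \<in> L2 M"
  shows "(\<lambda>x. c * f x) \<in> L2 M"
  using L2D[OF assms] by (simp add: L2_iff_sq_integral sq_integral_scale ennreal_mult_less_top)

lemma L2_diff:
  assumes "f \<in> L2 M" "g \<in> L2 M"
  shows "(\<lambda>x. f x - g x) \<in> L2 M"
  using L2_add[OF assms(1) L2_scale[OF assms(2), of "-1"]] by simp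

lemma L2_zero: "(\<lambda>x. 0) \<in> L2 M"
  by (simp add: L2_iff_sq_integral sq_integral_def)

lemma L2_mult_indicator:
  assumes "f \<in> L2 M" "A \<in> sets M"
  shows "mult_indicator A f \<in> L2 M" "sq_integral M (mult_indicator A f) \<le> sq_integral M f"
proof -
  show *: "sq_integral M (mult_indicator A f) \<le> sq_integral M f"
    by (rule sq_integral_mono) (auto simp: mult_indicator_def indicator_def)
  have [measurable]: "f \<in> borel_measurable M" "A \<in> sets M" using assms by (auto dest: L2D)
  have "mult_indicator A f \<in> borel_measurable M"
    unfolding mult_indicator_def by measurable
  with * L2D(2)[OF assms(1)] show "mult_indicator A f \<in> L2 M"
    by (auto simp: L2_iff_sq_integral intro: order.strict_trans1)
qed

lemma L2_bounded_opsD: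
  assumes "T \<in> L2_bounded_ops M"
  shows "\<And>f. f \<in> L2 M \<Longrightarrow> T f \<in> L2 M"
    and "\<And>f g. f \<in> L2 M \<Longrightarrow> g \<in> L2 M \<Longrightarrow> AE x in M. f x = g x \<Longrightarrow> AE x in M. T f x = T g x"
    and "\<And>f g. f \<in> L2 M \<Longrightarrow> g \<in> L2 M \<Longrightarrow> AE x in M. T (\<lambda>y. f y + g y) x = T f x + T g x"
    and "\<And>c f. f \<in> L2 M \<Longrightarrow> AE x in M. T (\<lambda>y. c * f y) x = c * T f x"
  using assms unfolding L2_bounded_ops_def by auto

lemma L2_bounded_ops_bound:
  assumes "T \<in> L2_bounded_ops M"
  obtains K where "0 \<le> K" "\<And>f. f \<in> L2 M \<Longrightarrow> sq_integral M (T f) \<le> ennreal K * sq_integral M f"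
proof -
  obtain C where C: "\<And>f. f \<in> L2 M \<Longrightarrow> L2_norm M (T f) \<le> C * L2_norm M f"
    using assms unfolding L2_bounded_ops_def by blast
  have "sq_integral M (T f) \<le> ennreal (C\<^sup>2) * sq_integral M f" if f: "f \<in> L2 M" for f
  proof -
    have "(L2_norm M (T f))\<^sup>2 \<le> (C * L2_norm M f)\<^sup>2"
      by (intro power_mono C f) simp
    then show ?thesis
      using f L2_bounded_opsD(1)[OF assms f]
      by (simp add: sq_integral_eq_L2_norm ennreal_mult[symmetric] power_mult_distrib)
  qed
  then show ?thesis using that[of "C\<^sup>2"] by simp
qed

text \<open>Compatibility with almost-everywhere equality is a consequence of the other clauses: apply the
  bound to the difference of two representatives.\<close>

lemma L2_bounded_opsI:
  assumes meas: "\<And>f. f \<in> L2 M \<Longrightarrow> T f \<in> borel_measurable M"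
    and bound: "\<And>f. f \<in> L2 M \<Longrightarrow> sq_integral M (T f) \<le> ennreal K * sq_integral M f"
    and add: "\<And>f g. f \<in> L2 M \<Longrightarrow> g \<in> L2 M \<Longrightarrow> AE x in M. T (\<lambda>y. f y + g y) x = T f x + T g x"
    and scale: "\<And>c f. f \<in> L2 M \<Longrightarrow> AE x in M. T (\<lambda>y. c * f y) x = c * T f x"
  shows "T \<in> L2_bounded_ops M"
proof -
  have T: "T f \<in> L2 M" if "f \<in> L2 M" for f
  proof -
    have "ennreal K * sq_integral M f < \<infinity>" using L2D(2)[OF that] by (simp add: ennreal_mult_less_top)
    with bound[OF that] meas[OF that] show ?thesis by (auto simp: L2_iff_sq_integral)
  qed
  have eq: "AE x in M. T f x = T g x"
    if f: "f \<in> L2 M" and g: "g \<in> L2 M" and fg: "AE x in M. f x = g x" for f g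
  proof -
    let ?d = "\<lambda>x. f x + (-1) * g x"
    have mg: "(\<lambda>x. (-1) * g x) \<in> L2 M" by (rule L2_scale[OF g])
    have d: "?d \<in> L2 M" by (rule L2_add[OF f mg])
    have "sq_integral M ?d = sq_integral M (\<lambda>x. 0::complex)"
      using fg by (intro sq_integral_cong_AE) auto
    then have "sq_integral M (T ?d) = 0"
      using bound[OF d] by (simp add: sq_integral_def)
    then have "AE x in M. T ?d x = 0" using meas[OF d] by (rule sq_integral_eq_0D[rotated])
    with add[OF f mg] scale[OF g, of "-1"] show ?thesis by eventually_elim auto
  qed
  have "L2_norm M (T f) \<le> sqrt (max K 0) * L2_norm M f" if f: "f \<in> L2 M" for f
  proof -
    have "sq_integral M (T f) \<le> ennreal (max K 0) * sq_integral M f"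
      using bound[OF f] by (rule order_trans) (intro mult_right_mono ennreal_leI, auto)
    also have "\<dots> = ennreal (max K 0 * (L2_norm M f)\<^sup>2)"
      using f by (simp only: sq_integral_eq_L2_norm ennreal_mult max.cobounded2 zero_le_power2)
    also have "\<dots> = ennreal ((sqrt (max K 0) * L2_norm M f)\<^sup>2)"
      by (simp add: power_mult_distrib)
    finally show ?thesis using f T[OF f] by (subst L2_norm_le_iff) auto
  qed
  then show ?thesis
    unfolding L2_bounded_ops_def using T eq add scale by blast
qed

lemma L2_opnorm_le:
  assumes "\<And>f. f \<in> L2 M \<Longrightarrow> L2_norm M f \<le> 1 \<Longrightarrow> L2_norm M (T f) \<le> b"
  shows "L2_opnorm M T \<le> b"
  unfolding L2_opnorm_def
proof (rule cSUP_least)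
  have "L2_norm M (\<lambda>x. 0) \<le> 1" by (simp add: L2_norm_def)
  then show "{f \<in> L2 M. L2_norm M f \<le> 1} \<noteq> {}" using L2_zero by blast
qed (use assms in auto)

text \<open>The bound \<open>b\<close> makes the supremum that defines the operator norm meaningful.\<close>

lemma le_L2_opnorm:
  assumes "\<And>f. f \<in> L2 M \<Longrightarrow> L2_norm M f \<le> 1 \<Longrightarrow> L2_norm M (T f) \<le> b"
    and "f \<in> L2 M" "L2_norm M f \<le> 1"
  shows "L2_norm M (T f) \<le> L2_opnorm M T"
  unfolding L2_opnorm_def by (rule cSUP_upper) (use assms in \<open>auto intro!: bdd_aboveI[of _ b]\<close>)

lemma L2_opnorm_nonneg:
  assumes "\<And>f. f \<in> L2 M \<Longrightarrow> L2_norm M f \<le> 1 \<Longrightarrow> L2_norm M (T f) \<le> b"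
  shows "0 \<le> L2_opnorm M T"
  using le_L2_opnorm[where f = "\<lambda>x. 0" and T = T, OF assms L2_zero]
  by (simp add: L2_norm_def order_trans[rotated])

lemma L2_bounded_ops_diff:
  assumes S: "S \<in> L2_bounded_ops M" and T: "T \<in> L2_bounded_ops M"
  shows "(\<lambda>f x. S f x - T f x) \<in> L2_bounded_ops M"
proof -
  obtain K K' where K: "0 \<le> K" "\<And>f. f \<in> L2 M \<Longrightarrow> sq_integral M (S f) \<le> ennreal K * sq_integral M f"
    and K': "0 \<le> K'" "\<And>f. f \<in> L2 M \<Longrightarrow> sq_integral M (T f) \<le> ennreal K' * sq_integral M f"
    using L2_bounded_ops_bound[OF S] L2_bounded_ops_bound[OF T] by metis
  show ?thesis
  proof (rule L2_bounded_opsI[where K = "2 * K + 2 * K'"])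
    fix f assume f: "f \<in> L2 M"
    note Sf = L2_bounded_opsD(1)[OF S f] and Tf = L2_bounded_opsD(1)[OF T f]
    show "(\<lambda>x. S f x - T f x) \<in> borel_measurable M" using L2_diff[OF Sf Tf] by (rule L2D)
    have "sq_integral M (\<lambda>x. S f x + (-1) * T f x)
        \<le> 2 * sq_integral M (S f) + 2 * sq_integral M (\<lambda>x. (-1) * T f x)"
      by (intro sq_integral_add_le L2D(1)[OF Sf] L2D(1)[OF L2_scale[OF Tf]])
    also have "sq_integral M (\<lambda>x. (-1) * T f x) = sq_integral M (T f)"
      by (simp add: sq_integral_def)
    also have "2 * sq_integral M (S f) + 2 * sq_integral M (T f)
        \<le> 2 * (ennreal K * sq_integral M f) + 2 * (ennreal K' * sq_integral M f)"
      by (intro add_mono mult_left_mono K(2) K'(2) f) auto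
    also have "\<dots> = ennreal (2 * K + 2 * K') * sq_integral M f"
      using K(1) K'(1) by (simp add: ennreal_plus ennreal_mult distrib_right mult.assoc)
    finally show "sq_integral M (\<lambda>x. S f x - T f x) \<le> ennreal (2 * K + 2 * K') * sq_integral M f"
      by simp
    show "AE x in M. S (\<lambda>y. c * f y) x - T (\<lambda>y. c * f y) x = c * (S f x - T f x)" for c
      using L2_bounded_opsD(4)[OF S f, of c] L2_bounded_opsD(4)[OF T f, of c]
      by eventually_elim (simp add: algebra_simps)
    fix g assume g: "g \<in> L2 M"
    show "AE x in M. S (\<lambda>y. f y + g y) x - T (\<lambda>y. f y + g y) x = S f x - T f x + (S g x - T g x)"
      using L2_bounded_opsD(3)[OF S f g] L2_bounded_opsD(3)[OF T f g] by eventually_elim simp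
  qed
qed

section \<open>Operators that vanish on elementary tensors\<close>

text \<open>The kernel of a bounded operator is closed, in particular under dominated limits.\<close>

lemma L2_kernel_limit:
  fixes T :: "('a \<Rightarrow> complex) \<Rightarrow> 'a \<Rightarrow> complex"
  assumes T: "T \<in> L2_bounded_ops M"
    and fn: "\<And>n. fn n \<in> borel_measurable M" "\<And>n. AE x in M. T (fn n) x = 0"
    and f: "f \<in> borel_measurable M"
    and lim: "\<And>x. x \<in> space M \<Longrightarrow> (\<lambda>n. fn n x) \<longlonglongrightarrow> f x"
    and dom: "\<And>n x. x \<in> space M \<Longrightarrow> cmod (fn n x) \<le> cmod (w x)" "w \<in> L2 M"
  shows "AE x in M. T f x = 0"
proof -
  note [measurable] = fn(1) f
  have [measurable]: "w \<in> borel_measurable M" using dom(2) by (rule L2D)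
  have fw: "cmod (f x) \<le> cmod (w x)" if "x \<in> space M" for x
    by (rule LIMSEQ_le_const2[OF tendsto_norm[OF lim[OF that]]]) (use dom(1)[OF that] in auto)
  have L2I: "h \<in> L2 M" if "h \<in> borel_measurable M" "\<And>x. x \<in> space M \<Longrightarrow> cmod (h x) \<le> cmod (w x)" for h
    using that sq_integral_mono[of M h w] L2D(2)[OF dom(2)]
    by (auto simp: L2_iff_sq_integral intro: order.strict_trans1)
  have fL: "f \<in> L2 M" by (rule L2I[OF f fw])
  have fnL: "fn n \<in> L2 M" for n by (rule L2I[OF fn(1) dom(1)])
  obtain K where K: "\<And>f. f \<in> L2 M \<Longrightarrow> sq_integral M (T f) \<le> ennreal K * sq_integral M f"
    using L2_bounded_ops_bound[OF T] by metis
  let ?d = "\<lambda>n x. f x + (-1) * fn n x"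
  have mL: "(\<lambda>x. (-1) * fn n x) \<in> L2 M" for n by (rule L2_scale[OF fnL])
  have dL: "?d n \<in> L2 M" for n by (rule L2_add[OF fL mL])
  have le: "sq_integral M (T f) \<le> ennreal K * sq_integral M (?d n)" for n
  proof -
    have "AE x in M. T f x = T (?d n) x"
      using L2_bounded_opsD(3)[OF T fL mL[of n]] L2_bounded_opsD(4)[OF T fnL, of "-1" n] fn(2)[of n]
      by eventually_elim (simp only:, simp)
    then have "sq_integral M (T f) = sq_integral M (T (?d n))" by (rule sq_integral_cong_AE)
    then show ?thesis using K[OF dL] by simp
  qed
  have "(\<lambda>n. sq_integral M (?d n)) \<longlonglongrightarrow> (\<integral>\<^sup>+x. 0 \<partial>M)"
    unfolding sq_integral_def
  proof (rule nn_integral_dominated_convergence)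
    show "AE x in M. ennreal ((cmod (?d j x))\<^sup>2) \<le> ennreal (4 * (cmod (w x))\<^sup>2)" for j
    proof (rule AE_I2)
      fix x assume x: "x \<in> space M"
      have "cmod (?d j x) \<le> 2 * cmod (w x)"
        using norm_triangle_ineq4[of "f x" "fn j x"] fw[OF x] dom(1)[OF x, of j] by simp
      then have "(cmod (?d j x))\<^sup>2 \<le> (2 * cmod (w x))\<^sup>2" by (intro power_mono) auto
      then show "ennreal ((cmod (?d j x))\<^sup>2) \<le> ennreal (4 * (cmod (w x))\<^sup>2)"
        by (intro ennreal_leI) (simp add: power_mult_distrib)
    qed
    have "(\<integral>\<^sup>+ x. ennreal (4 * (cmod (w x))\<^sup>2) \<partial>M) = 4 * sq_integral M w"
      unfolding sq_integral_def by (subst nn_integral_cmult[symmetric]) (auto simp: ennreal_mult)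
    also have "\<dots> < \<infinity>" using L2D(2)[OF dom(2)] by (simp add: ennreal_mult_less_top)
    finally show "(\<integral>\<^sup>+ x. ennreal (4 * (cmod (w x))\<^sup>2) \<partial>M) < \<infinity>" .
    show "AE x in M. (\<lambda>n. ennreal ((cmod (?d n x))\<^sup>2)) \<longlonglongrightarrow> 0"
    proof (rule AE_I2)
      fix x assume x: "x \<in> space M"
      have "(\<lambda>n. (cmod (?d n x))\<^sup>2) \<longlonglongrightarrow> (cmod (f x + (-1) * f x))\<^sup>2"
        by (intro tendsto_intros lim x)
      then show "(\<lambda>n. ennreal ((cmod (?d n x))\<^sup>2)) \<longlonglongrightarrow> 0"
        using tendsto_ennrealI by fastforce
    qed
  qed measurable
  then have lim0: "(\<lambda>n. sq_integral M (?d n)) \<longlonglongrightarrow> 0" by simp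
  have "(\<lambda>n. ennreal K * sq_integral M (?d n)) \<longlonglongrightarrow> ennreal K * 0"
    by (intro ennreal_tendsto_cmult lim0) simp
  then have "sq_integral M (T f) \<le> 0"
    by (intro LIMSEQ_le_const[of _ 0]) (use le in auto)
  then show ?thesis
    using L2D(1)[OF L2_bounded_opsD(1)[OF T fL]] by (intro sq_integral_eq_0D) auto
qed

lemma L2_kernel_sum:
  assumes T: "T \<in> L2_bounded_ops M" and "finite I"
    and f: "\<And>i. i \<in> I \<Longrightarrow> f i \<in> L2 M" "\<And>i. i \<in> I \<Longrightarrow> AE x in M. T (f i) x = 0"
  shows "(\<lambda>x. \<Sum>i\<in>I. f i x) \<in> L2 M \<and> (AE x in M. T (\<lambda>x. \<Sum>i\<in>I. f i x) x = 0)"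
  using \<open>finite I\<close> f
proof (induction I rule: finite_induct)
  case empty
  show ?case using L2_zero L2_bounded_opsD(4)[OF T L2_zero, of 0] by auto
next
  case (insert i I)
  then have i: "f i \<in> L2 M" "AE x in M. T (f i) x = 0"
    and I: "(\<lambda>x. \<Sum>i\<in>I. f i x) \<in> L2 M" "AE x in M. T (\<lambda>x. \<Sum>i\<in>I. f i x) x = 0" by auto
  have "AE x in M. T (\<lambda>x. f i x + (\<Sum>i\<in>I. f i x)) x = 0"
    using L2_bounded_opsD(3)[OF T i(1) I(1)] i(2) I(2) by eventually_elim simp
  then show ?case using insert.hyps L2_add[OF i(1) I(1)] by simp
qed

lemma L2_indicator:
  assumes "A \<in> sets M" "emeasure M A < \<infinity>"
  shows "(indicator A :: _ \<Rightarrow> complex) \<in> L2 M"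
proof -
  have "sq_integral M (indicator A :: _ \<Rightarrow> complex) = (\<integral>\<^sup>+x. indicator A x \<partial>M)"
    unfolding sq_integral_def by (intro nn_integral_cong) (auto simp: indicator_def)
  then show ?thesis using assms by (simp add: L2_iff_sq_integral)
qed

text \<open>Indicators of sets of finite measure span a dense subspace: every square-integrable function is
  a limit of simple functions dominated by twice its modulus.\<close>

lemma L2_kernel_of_indicators:
  assumes T: "T \<in> L2_bounded_ops M"
    and ind: "\<And>A. A \<in> sets M \<Longrightarrow> emeasure M A < \<infinity> \<Longrightarrow> AE x in M. T (indicator A) x = 0"
    and f: "f \<in> L2 M"
  shows "AE x in M. T f x = 0"
proof -
  have [measurable]: "f \<in> borel_measurable M" using f by (rule L2D)
  obtain s where s: "\<And>i. simple_function M (s i)" "\<And>x. x \<in> space M \<Longrightarrow> (\<lambda>i. s i x) \<longlonglongrightarrow> f x"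
    "\<And>i x. x \<in> space M \<Longrightarrow> cmod (s i x) \<le> 2 * cmod (f x)"
    using borel_measurable_implies_sequence_metric[of f M 0] by simp metis
  have [measurable]: "s i \<in> borel_measurable M" for i by (rule borel_measurable_simple_function[OF s(1)])
  have w: "(\<lambda>x. 2 * f x) \<in> L2 M" by (rule L2_scale[OF f])
  have sL: "s i \<in> L2 M" for i
    using s(3) sq_integral_mono[of M "s i" "\<lambda>x. 2 * f x"] L2D(2)[OF w]
    by (auto simp: L2_iff_sq_integral norm_mult intro: order.strict_trans1)
  have "AE x in M. T (s i) x = 0" for i
  proof -
    let ?A = "\<lambda>y. s i -` {y} \<inter> space M"
    let ?h = "\<lambda>y x. y * indicator (?A y) x :: complex"
    have A: "?A y \<in> sets M" for y by measurable
    have fin: "emeasure M (?A y) < \<infinity>" if "y \<noteq> 0" for y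
    proof -
      have "emeasure M (?A y) = (\<integral>\<^sup>+x. indicator (?A y) x \<partial>M)" using A by simp
      also have "\<dots> \<le> (\<integral>\<^sup>+x. ennreal (1 / (cmod y)\<^sup>2) * ennreal ((cmod (s i x))\<^sup>2) \<partial>M)"
        using that by (intro nn_integral_mono) (auto simp: indicator_def ennreal_mult[symmetric])
      also have "\<dots> = ennreal (1 / (cmod y)\<^sup>2) * sq_integral M (s i)"
        unfolding sq_integral_def by (rule nn_integral_cmult) measurable
      also have "\<dots> < \<infinity>" using L2D(2)[OF sL] by (simp add: ennreal_mult_less_top)
      finally show ?thesis .
    qed
    have h: "?h y \<in> L2 M \<and> (AE x in M. T (?h y) x = 0)" for y
    proof (cases "y = 0")
      case True
      then show ?thesis using L2_kernel_sum[OF T, of "{}"] by simp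
    next
      case False
      note A_L2 = L2_indicator[OF A fin[OF False]]
      have "AE x in M. T (?h y) x = 0"
        using L2_bounded_opsD(4)[OF T A_L2, of y] ind[OF A fin[OF False]] by eventually_elim simp
      then show ?thesis using L2_scale[OF A_L2] by blast
    qed
    have sum: "(\<lambda>x. \<Sum>y\<in>s i ` space M. ?h y x) \<in> L2 M \<and>
      (AE x in M. T (\<lambda>x. \<Sum>y\<in>s i ` space M. ?h y x) x = 0)"
      by (rule L2_kernel_sum[where f = ?h, OF T simple_functionD(1)[OF s(1)]]) (use h in blast)+
    have eq: "s i x = (\<Sum>y\<in>s i ` space M. ?h y x)" if "x \<in> space M" for x
    proof -
      have "(\<Sum>y\<in>s i ` space M. ?h y x) = (\<Sum>y\<in>s i ` space M. if y = s i x then y else 0)"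
        using that by (intro sum.cong) (auto simp: indicator_def)
      then show ?thesis using that simple_functionD(1)[OF s(1)] by (simp add: sum.delta')
    qed
    then have ae: "AE x in M. s i x = (\<Sum>y\<in>s i ` space M. ?h y x)" by (rule AE_I2)
    from L2_bounded_opsD(2)[OF T sL _ ae] sum
    show ?thesis by (auto elim: eventually_elim2)
  qed
  then show ?thesis
  proof (rule L2_kernel_limit[OF T, where fn = s and w = "\<lambda>x. 2 * f x", rotated])
    show "(\<lambda>x. 2 * f x) \<in> L2 M" by (rule w)
    show "cmod (s n x) \<le> cmod (2 * f x)" if "x \<in> space M" for n x
      using s(3)[OF that] by (simp add: norm_mult)
  qed (simp_all add: s)
qed

context pair_sigma_finite
begin

text \<open>Indicators of rectangles are elementary tensors, and rectangles generate the product
  \<open>\<sigma>\<close>-algebra. Cutting with rectangles \<open>F i\<close> of finite measure keeps all indicators in the induction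
  over the \<open>\<sigma>\<close>-algebra square-integrable.\<close>

lemma L2_kernel_of_tensors:
  assumes T: "T \<in> L2_bounded_ops (M1 \<Otimes>\<^sub>M M2)"
    and tensor: "\<And>f g. f \<in> L2 M1 \<Longrightarrow> g \<in> L2 M2 \<Longrightarrow>
      AE z in M1 \<Otimes>\<^sub>M M2. T (\<lambda>(x, y). f x * g y) z = 0"
    and f: "f \<in> L2 (M1 \<Otimes>\<^sub>M M2)"
  shows "AE z in M1 \<Otimes>\<^sub>M M2. T f z = 0"
proof (rule L2_kernel_of_indicators[OF T _ f])
  let ?P = "M1 \<Otimes>\<^sub>M M2"
  obtain A where A: "range A \<subseteq> sets M1" "(\<Union>i. A i) = space M1" "\<And>i. emeasure M1 (A i) \<noteq> \<infinity>" "incseq A"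
    using M1.sigma_finite_incseq by metis
  obtain B where B: "range B \<subseteq> sets M2" "(\<Union>i. B i) = space M2" "\<And>i. emeasure M2 (B i) \<noteq> \<infinity>" "incseq B"
    using M2.sigma_finite_incseq by metis
  define F where "F i = A i \<times> B i" for i
  have [measurable]: "A i \<in> sets M1" "B i \<in> sets M2" for i using A B by auto
  have [measurable]: "F i \<in> sets ?P" for i by (simp add: F_def)
  have Ffin: "emeasure ?P (F i) < \<infinity>" for i
    using A(3)[of i] B(3)[of i]
    by (simp add: F_def M2.emeasure_pair_measure_Times ennreal_mult_less_top less_top)
  have FL: "(indicator (F i) :: _ \<Rightarrow> complex) \<in> L2 ?P" for i by (intro L2_indicator Ffin) simp
  define good :: "('a \<times> 'b) set \<Rightarrow> bool" where
    "good E \<longleftrightarrow> (AE z in ?P. T (indicator E) z = 0)" for E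
  have rect: "good (a \<times> b)" if "a \<in> sets M1" "b \<in> sets M2" "emeasure M1 a < \<infinity>" "emeasure M2 b < \<infinity>" for a b
  proof -
    have "indicator (a \<times> b) = (\<lambda>(x, y). indicator a x * indicator b y :: complex)"
      by (auto simp: indicator_def)
    then show ?thesis using tensor[OF L2_indicator L2_indicator] that by (simp add: good_def)
  qed
  have cut: "(indicator (E \<inter> F i) :: _ \<Rightarrow> complex) \<in> L2 ?P" if "E \<in> sets ?P" for E i
  proof -
    have "emeasure ?P (E \<inter> F i) \<le> emeasure ?P (F i)" by (rule emeasure_mono) auto
    then show ?thesis using that Ffin[of i] by (intro L2_indicator) (auto intro: order.strict_trans1)
  qed
  have good_F: "good (E \<inter> F i)" if "E \<in> sets ?P" for E i
  proof -
    have "E \<in> sigma_sets (space M1 \<times> space M2) {a \<times> b | a b. a \<in> sets M1 \<and> b \<in> sets M2}"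
      using that by (simp add: sets_pair_measure)
    with Int_stable_pair_measure_generator pair_measure_closed show ?thesis
    proof (induction rule: sigma_sets_induct_disjoint)
      case (basic E)
      then obtain a b where ab: "E = a \<times> b" "a \<in> sets M1" "b \<in> sets M2" by auto
      have "emeasure M1 (a \<inter> A i) \<le> emeasure M1 (A i)" "emeasure M2 (b \<inter> B i) \<le> emeasure M2 (B i)"
        by (auto intro!: emeasure_mono)
      then have "good ((a \<inter> A i) \<times> (b \<inter> B i))"
        using ab A(3)[of i] B(3)[of i] by (intro rect) (auto simp: less_top[symmetric] top_unique)
      moreover have "E \<inter> F i = (a \<inter> A i) \<times> (b \<inter> B i)" by (auto simp: ab F_def)
      ultimately show ?case by simp
    next
      case empty
      have "good ({} \<times> {})" by (rule rect) auto
      then show ?case by simp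
    next
      case (compl E)
      have E: "E \<in> sets ?P" using compl by (simp add: sets_pair_measure)
      have "good (F i)"
        unfolding F_def using A(3)[of i] B(3)[of i] by (intro rect) (auto simp: less_top)
      then have "AE z in ?P. T (\<lambda>z. indicator (F i) z + (-1) * indicator (E \<inter> F i) z) z = 0"
        using L2_bounded_opsD(3)[OF T FL L2_scale[OF cut[OF E]], of i "-1" i]
          L2_bounded_opsD(4)[OF T cut[OF E], of "-1" i] compl(2)
        unfolding good_def by eventually_elim simp
      moreover have "(\<lambda>z. indicator (F i) z + (-1) * indicator (E \<inter> F i) z) =
          (indicator ((space M1 \<times> space M2 - E) \<inter> F i) :: _ \<Rightarrow> complex)"
        using sets.sets_into_space[of "F i" ?P] by (auto simp: indicator_def space_pair_measure fun_eq_iff)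
      ultimately show ?case by (simp add: good_def)
    next
      case (union E)
      have E [measurable]: "E n \<in> sets ?P" for n using union by (auto simp: sets_pair_measure)
      let ?s = "\<lambda>n z. \<Sum>k<n. indicator (E k \<inter> F i) z :: complex"
      have s: "?s n z = indicator (\<Union>k<n. E k \<inter> F i) z" for n z
      proof -
        have "disjoint_family_on (\<lambda>k. E k \<inter> F i) {..<n}"
          using union(1) unfolding disjoint_family_on_def by blast
        then show ?thesis
          by (rule indicator_UN_disjoint[symmetric, OF finite_lessThan])
      qed
      show ?case unfolding good_def
      proof (rule L2_kernel_limit[OF T, where fn = ?s and w = "indicator (F i)"])
        show "AE z in ?P. T (?s n) z = 0" for n
          by (rule conjunct2[OF L2_kernel_sum[OF T]])
            (use cut[OF E] union.IH in \<open>simp_all add: good_def\<close>)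
        show "(\<lambda>n. ?s n z) \<longlonglongrightarrow> indicator ((\<Union>k. E k) \<inter> F i) z" for z
          using LIMSEQ_indicator_UN[where A = "\<lambda>k. E k \<inter> F i" and x = z] by (simp add: s)
        show "cmod (?s n z) \<le> cmod (indicator (F i) z)" for n z
          unfolding s by (auto simp: indicator_def)
      qed (use FL in auto)
    qed
  qed
  fix E assume E [measurable]: "E \<in> sets ?P" and fin: "emeasure ?P E < \<infinity>"
  have "incseq F" using A(4) B(4) by (fastforce simp: F_def incseq_def)
  show "AE z in ?P. T (indicator E) z = 0"
  proof (rule L2_kernel_limit[OF T, where fn = "\<lambda>i. indicator (E \<inter> F i)" and w = "indicator E"])
    show "AE z in ?P. T (indicator (E \<inter> F i)) z = 0" for i
      using good_F[OF E] by (simp add: good_def)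
    show "(\<lambda>i. indicator (E \<inter> F i) z :: complex) \<longlonglongrightarrow> indicator E z" if zP: "z \<in> space ?P" for z
    proof -
      obtain x y where z: "z = (x, y)" "x \<in> space M1" "y \<in> space M2"
        using zP by (auto simp: space_pair_measure)
      obtain i j where "x \<in> A i" "y \<in> B j" using z A(2) B(2) by blast
      then have "x \<in> A (max i j)" "y \<in> B (max i j)"
        using incseqD[OF A(4), of i "max i j"] incseqD[OF B(4), of j "max i j"] by auto
      then have "z \<in> F k" if "k \<ge> max i j" for k
        using that incseqD[OF \<open>incseq F\<close>, of "max i j" k] z by (auto simp: F_def)
      then have "eventually (\<lambda>k. indicator (E \<inter> F k) z = (indicator E z :: complex)) sequentially"
        by (intro eventually_sequentiallyI[of "max i j"]) (simp add: indicator_def)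
      then show ?thesis by (rule tendsto_eventually)
    qed
    show "cmod (indicator (E \<inter> F n) z) \<le> cmod (indicator E z)" for n z by (simp add: indicator_def)
    show "(indicator E :: _ \<Rightarrow> complex) \<in> L2 ?P" by (rule L2_indicator[OF E fin])
  qed measurable
qed

end

section \<open>The projection acts slicewise as the mean\<close>

text \<open>The variance of \<open>norm \<circ> g\<close> is nonnegative; if \<open>g\<close> is not square-integrable, the right-hand side is
  infinite.\<close>

lemma (in prob_space) norm_integral_sq_le:
  fixes g :: "'a \<Rightarrow> 'b::{banach, second_countable_topology}"
  assumes [measurable]: "g \<in> borel_measurable M"
  shows "ennreal ((norm (LINT x|M. g x))\<^sup>2) \<le> sq_integral M g"
proof (cases "sq_integral M g < \<infinity>")
  case True
  then have sq: "integrable M (\<lambda>x. (norm (g x))\<^sup>2)"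
    unfolding sq_integral_def by (intro integrableI_bounded) simp_all
  then have int: "integrable M (\<lambda>x. norm (g x))"
    by (rule square_integrable_imp_integrable[rotated]) measurable
  have "norm (LINT x|M. g x) \<le> (LINT x|M. norm (g x))" by (rule integral_norm_bound)
  then have "(norm (LINT x|M. g x))\<^sup>2 \<le> (LINT x|M. norm (g x))\<^sup>2" by (intro power_mono) auto
  also have "\<dots> \<le> (LINT x|M. (norm (g x))\<^sup>2)"
    using variance_eq[OF int sq] variance_positive[of "\<lambda>x. norm (g x)"] by simp
  also have "ennreal \<dots> = sq_integral M g"
    unfolding sq_integral_def using sq by (intro nn_integral_eq_integral[symmetric]) auto
  finally show ?thesis by (simp add: ennreal_leI)
qed (simp add: less_top[symmetric])

lemma (in prob_space) L2_integrable:
  assumes "g \<in> L2 M" shows "integrable M g"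
proof (rule integrable_norm_cancel)
  show m: "g \<in> borel_measurable M" using assms by (rule L2D)
  show "integrable M (\<lambda>x. norm (g x))"
    by (rule square_integrable_imp_integrable) (use assms m in \<open>simp_all add: L2_def\<close>)
qed

lemma (in prob_space) L2_proj_constants:
  assumes f: "f \<in> L2 M"
  shows "L2_proj M constant_functions f = (\<lambda>x. LINT y|M. f y)"
  unfolding L2_proj_def
proof (rule some_equality)
  let ?P = "\<lambda>g. g \<in> constant_functions \<and> (\<forall>h\<in>constant_functions. L2_inner M (\<lambda>x. f x - g x) h = 0)"
  have inner: "L2_inner M (\<lambda>x. f x - c) (\<lambda>x. d) = ((LINT y|M. f y) - c) * cnj d" for c d
    using L2_integrable[OF f] by (simp add: L2_inner_def prob_space)
  then show "?P (\<lambda>x. LINT y|M. f y)" by (auto simp: constant_functions_def)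
  show "g = (\<lambda>x. LINT y|M. f y)" if g: "?P g" for g
  proof -
    obtain c where c: "g = (\<lambda>x. c)" using g by (auto simp: constant_functions_def)
    have "L2_inner M (\<lambda>x. f x - g x) (\<lambda>x. 1) = 0" using g by (auto simp: constant_functions_def)
    then show ?thesis using inner[of c 1] by (simp add: c)
  qed
qed

text \<open>The operator \<open>P\<^sub>X \<otimes> Id\<close>. For square-integrable \<open>f\<close> the slices that are not integrable, on which the
  integral has its default value \<open>0\<close>, make up a null set.\<close>

definition slice_mean :: "'a measure \<Rightarrow> ('a \<times> 'b \<Rightarrow> complex) \<Rightarrow> 'a \<times> 'b \<Rightarrow> complex" where
  "slice_mean M f = (\<lambda>z. LINT x|M. f (x, snd z))"

lemma slice_measurable:
  assumes "f \<in> borel_measurable (M \<Otimes>\<^sub>M N)" "t \<in> space N"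
  shows "(\<lambda>x. f (x, t)) \<in> borel_measurable M"
  using assms by (rule measurable_compose[OF measurable_Pair2', rotated])

context pair_sigma_finite
begin

lemma sq_integral_slices:
  fixes f :: "'a \<times> 'b \<Rightarrow> 'c::{second_countable_topology, real_normed_vector}"
  assumes [measurable]: "f \<in> borel_measurable (M1 \<Otimes>\<^sub>M M2)"
  shows "sq_integral (M1 \<Otimes>\<^sub>M M2) f = (\<integral>\<^sup>+t. sq_integral M1 (\<lambda>x. f (x, t)) \<partial>M2)"
  unfolding sq_integral_def by (rule nn_integral_snd[symmetric]) measurable

text \<open>Norm estimates on \<open>L\<^sup>2\<close> of the fibre transfer to the product with the same constant.\<close>

lemma sq_integral_slices_le:
  fixes f g :: "'a \<times> 'b \<Rightarrow> complex"
  assumes [measurable]: "f \<in> borel_measurable (M1 \<Otimes>\<^sub>M M2)" "g \<in> borel_measurable (M1 \<Otimes>\<^sub>M M2)"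
    and le: "\<And>t. t \<in> space M2 \<Longrightarrow>
      sq_integral M1 (\<lambda>x. f (x, t)) \<le> c * sq_integral M1 (\<lambda>x. g (x, t))"
  shows "sq_integral (M1 \<Otimes>\<^sub>M M2) f \<le> c * sq_integral (M1 \<Otimes>\<^sub>M M2) g"
proof -
  have [measurable]: "(\<lambda>t. sq_integral M1 (\<lambda>x. g (x, t))) \<in> borel_measurable M2"
    unfolding sq_integral_def by measurable
  have "sq_integral (M1 \<Otimes>\<^sub>M M2) f \<le> (\<integral>\<^sup>+t. c * sq_integral M1 (\<lambda>x. g (x, t)) \<partial>M2)"
    unfolding sq_integral_slices[OF assms(1)] by (intro nn_integral_mono le)
  also have "\<dots> = c * sq_integral (M1 \<Otimes>\<^sub>M M2) g"
    unfolding sq_integral_slices[OF assms(2)] by (rule nn_integral_cmult) measurable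
  finally show ?thesis .
qed

lemma AE_slice_L2:
  assumes f: "f \<in> L2 (M1 \<Otimes>\<^sub>M M2)"
  shows "AE z in M1 \<Otimes>\<^sub>M M2. (\<lambda>x. f (x, snd z)) \<in> L2 M1"
proof -
  have [measurable]: "f \<in> borel_measurable (M1 \<Otimes>\<^sub>M M2)" using f by (rule L2D)
  have m [measurable]: "(\<lambda>t. sq_integral M1 (\<lambda>x. f (x, t))) \<in> borel_measurable M2"
    unfolding sq_integral_def by measurable
  have "AE t in M2. sq_integral M1 (\<lambda>x. f (x, t)) \<noteq> \<infinity>"
    using L2D(2)[OF f] by (intro nn_integral_PInf_AE m) (simp add: sq_integral_slices)
  then obtain N where N: "N \<in> null_sets M2"
    "\<And>t. t \<in> space M2 \<Longrightarrow> t \<notin> N \<Longrightarrow> sq_integral M1 (\<lambda>x. f (x, t)) \<noteq> \<infinity>"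
    by (auto elim!: AE_E3)
  have "space M1 \<times> N \<in> null_sets (M1 \<Otimes>\<^sub>M M2)"
    using N(1) by (intro null_setsI) (auto simp: M2.emeasure_pair_measure_Times null_setsD1 null_setsD2)
  then have "AE z in M1 \<Otimes>\<^sub>M M2. sq_integral M1 (\<lambda>x. f (x, snd z)) \<noteq> \<infinity>"
    by (rule AE_I') (use N(2) in \<open>force simp: space_pair_measure\<close>)
  then show ?thesis
    using AE_space
    by eventually_elim (auto simp: L2_iff_sq_integral less_top space_pair_measure slice_measurable)
qed

end

locale slices = prob_space M + N: sigma_finite_measure N for M :: "'a measure" and N :: "'b measure"
begin

sublocale pair: pair_sigma_finite M N ..

lemma slice_mean_measurable:
  assumes [measurable]: "f \<in> borel_measurable (M \<Otimes>\<^sub>M N)"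
  shows "slice_mean M f \<in> borel_measurable (M \<Otimes>\<^sub>M N)"
  unfolding slice_mean_def by measurable

lemma slice_mean_bounded_op: "slice_mean M \<in> L2_bounded_ops (M \<Otimes>\<^sub>M N)"
proof (rule L2_bounded_opsI[where K = 1])
  fix f assume f: "f \<in> L2 (M \<Otimes>\<^sub>M N)"
  then have m [measurable]: "f \<in> borel_measurable (M \<Otimes>\<^sub>M N)" by (rule L2D)
  show "slice_mean M f \<in> borel_measurable (M \<Otimes>\<^sub>M N)" by (rule slice_mean_measurable[OF m])
  show "sq_integral (M \<Otimes>\<^sub>M N) (slice_mean M f) \<le> ennreal 1 * sq_integral (M \<Otimes>\<^sub>M N) f"
  proof (rule pair.sq_integral_slices_le[OF slice_mean_measurable[OF m] m])
    fix t assume "t \<in> space N"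
    then have "ennreal ((cmod (LINT x|M. f (x, t)))\<^sup>2) \<le> sq_integral M (\<lambda>x. f (x, t))"
      by (intro norm_integral_sq_le slice_measurable[OF m])
    then show "sq_integral M (\<lambda>x. slice_mean M f (x, t)) \<le> ennreal 1 * sq_integral M (\<lambda>x. f (x, t))"
      by (simp add: slice_mean_def sq_integral_def emeasure_space_1)
  qed
  show "AE z in M \<Otimes>\<^sub>M N. slice_mean M (\<lambda>y. c * f y) z = c * slice_mean M f z" for c
    by (simp add: slice_mean_def)
  fix g assume g: "g \<in> L2 (M \<Otimes>\<^sub>M N)"
  show "AE z in M \<Otimes>\<^sub>M N. slice_mean M (\<lambda>y. f y + g y) z = slice_mean M f z + slice_mean M g z"
    using pair.AE_slice_L2[OF f] pair.AE_slice_L2[OF g]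
    by eventually_elim (simp add: slice_mean_def L2_integrable)
qed

text \<open>The slicewise mean satisfies the property that specifies the tensor product, and any other bounded
  operator that does so differs from it by an operator that vanishes on elementary tensors.\<close>

lemma tensor_proj_constants:
  defines "T \<equiv> L2_tensor M N (L2_proj M constant_functions) (\<lambda>f. f)"
  shows "T \<in> L2_bounded_ops (M \<Otimes>\<^sub>M N)"
    and "f \<in> L2 (M \<Otimes>\<^sub>M N) \<Longrightarrow> AE z in M \<Otimes>\<^sub>M N. T f z = slice_mean M f z"
proof -
  let ?Q = "\<lambda>U. U \<in> L2_bounded_ops (M \<Otimes>\<^sub>M N) \<and>
     (\<forall>f\<in>L2 M. \<forall>g\<in>L2 N. AE z in M \<Otimes>\<^sub>M N.
        U (\<lambda>(x, y). f x * g y) z = (case z of (x, y) \<Rightarrow> L2_proj M constant_functions f x * g y))"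
  have mean: "?Q (slice_mean M)"
    using slice_mean_bounded_op by (auto simp: L2_proj_constants slice_mean_def)
  then have T: "?Q T" unfolding T_def L2_tensor_def by (rule someI[of ?Q])
  then show Tb: "T \<in> L2_bounded_ops (M \<Otimes>\<^sub>M N)" by blast
  assume f: "f \<in> L2 (M \<Otimes>\<^sub>M N)"
  have "AE z in M \<Otimes>\<^sub>M N. T f z - slice_mean M f z = 0"
  proof (rule pair.L2_kernel_of_tensors[OF L2_bounded_ops_diff[OF Tb slice_mean_bounded_op] _ f])
    fix f :: "'a \<Rightarrow> complex" and g :: "'b \<Rightarrow> complex" assume "f \<in> L2 M" "g \<in> L2 N"
    then have "AE z in M \<Otimes>\<^sub>M N. T (\<lambda>(x, y). f x * g y) z =
        (case z of (x, y) \<Rightarrow> L2_proj M constant_functions f x * g y)"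
      "AE z in M \<Otimes>\<^sub>M N. slice_mean M (\<lambda>(x, y). f x * g y) z =
        (case z of (x, y) \<Rightarrow> L2_proj M constant_functions f x * g y)"
      using T mean by blast+
    then show "AE z in M \<Otimes>\<^sub>M N. T (\<lambda>(x, y). f x * g y) z - slice_mean M (\<lambda>(x, y). f x * g y) z = 0"
      by eventually_elim simp
  qed
  then show "AE z in M \<Otimes>\<^sub>M N. T f z = slice_mean M f z" by simp
qed

end

lemma slices_ray: "prob_space \<nu> \<Longrightarrow> slices \<nu> ray_measure"
proof -
  assume "prob_space \<nu>"
  moreover have "sigma_finite_measure ray_measure"
    unfolding ray_measure_def by (rule sigma_finite_measure_restrict_space) (auto intro: sigma_finite_lborel)
  ultimately show ?thesis by (simp add: slices_def)
qed

lemma drutu_nowak_projection: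
  assumes "prob_space \<nu>"
  shows "drutu_nowak_projection \<nu> \<in> L2_bounded_ops (cone_measure \<nu>)"
    and "f \<in> L2 (cone_measure \<nu>) \<Longrightarrow>
      AE z in cone_measure \<nu>. drutu_nowak_projection \<nu> f z = slice_mean \<nu> f z"
proof -
  interpret slices \<nu> ray_measure using assms by (rule slices_ray)
  show "drutu_nowak_projection \<nu> \<in> L2_bounded_ops (cone_measure \<nu>)"
    and "f \<in> L2 (cone_measure \<nu>) \<Longrightarrow>
      AE z in cone_measure \<nu>. drutu_nowak_projection \<nu> f z = slice_mean \<nu> f z"
    unfolding drutu_nowak_projection_def cone_measure_def using tensor_proj_constants by auto
qed

section \<open>Norm limits of finite-propagation operators are quasi-local\<close>

lemma L2_norm_mono:
  assumes "f \<in> L2 M" "g \<in> L2 M" "sq_integral M f \<le> sq_integral M g"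
  shows "L2_norm M f \<le> L2_norm M g"
  using assms by (subst L2_norm_le_iff) (auto simp: sq_integral_eq_L2_norm)

lemma L2_bounded_ops_unit_ball:
  assumes "T \<in> L2_bounded_ops M"
  obtains b where "\<And>f. f \<in> L2 M \<Longrightarrow> L2_norm M f \<le> 1 \<Longrightarrow> L2_norm M (T f) \<le> b"
proof -
  obtain C where C: "\<And>f. f \<in> L2 M \<Longrightarrow> L2_norm M (T f) \<le> C * L2_norm M f"
    using assms unfolding L2_bounded_ops_def by blast
  have "L2_norm M (T f) \<le> \<bar>C\<bar>" if f: "f \<in> L2 M" and n: "L2_norm M f \<le> 1" for f
  proof -
    have "C * L2_norm M f \<le> \<bar>C\<bar> * 1" using n by (intro mult_mono) auto
    then show ?thesis using C[OF f] by simp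
  qed
  then show ?thesis by (rule that)
qed

text \<open>Between sets that are far apart an approximant of finite propagation has no corner, so the corner
  of \<open>T\<close> is a corner of the error.\<close>

lemma quasi_local_of_finite_propagation_limit:
  assumes T: "T \<in> L2_bounded_ops M" and lim: "opnorm_limit_of_finite_propagation M d T"
  shows "quasi_local M d T"
  unfolding quasi_local_def
proof (intro allI impI)
  fix \<epsilon> :: real assume \<epsilon>: "0 < \<epsilon>"
  obtain S where S: "\<And>n. S n \<in> L2_bounded_ops M" "\<And>n. finite_propagation M d (S n)"
    "(\<lambda>n. L2_opnorm M (\<lambda>f x. S n f x - T f x)) \<longlonglongrightarrow> 0"
    using lim unfolding opnorm_limit_of_finite_propagation_def by blast
  obtain n where n: "L2_opnorm M (\<lambda>f x. S n f x - T f x) < \<epsilon> / 2"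
    using order_tendstoD(2)[OF S(3), of "\<epsilon> / 2"] \<epsilon> by (auto simp: eventually_sequentially)
  obtain R where R: "R > 0" "\<And>A C f. A \<in> sets M \<Longrightarrow> C \<in> sets M \<Longrightarrow> set_distance d A C > ereal R \<Longrightarrow>
      f \<in> L2 M \<Longrightarrow> AE x in M. cut_op A (S n) C f x = 0"
    using S(2)[of n] unfolding finite_propagation_def by blast
  obtain b where b: "\<And>f. f \<in> L2 M \<Longrightarrow> L2_norm M f \<le> 1 \<Longrightarrow> L2_norm M (\<lambda>x. S n f x - T f x) \<le> b"
    using L2_bounded_ops_unit_ball[OF L2_bounded_ops_diff[OF S(1) T], of n] by blast
  have "L2_opnorm M (cut_op A T C) < \<epsilon>"
    if A: "A \<in> sets M" and C: "C \<in> sets M" and AC: "set_distance d A C > ereal R" for A C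
  proof -
    have "L2_opnorm M (cut_op A T C) \<le> \<epsilon> / 2"
    proof (rule L2_opnorm_le)
      fix f assume f: "f \<in> L2 M" and f1: "L2_norm M f \<le> 1"
      let ?g = "mult_indicator C f" and ?D = "\<lambda>x. S n (mult_indicator C f) x - T (mult_indicator C f) x"
      have g: "?g \<in> L2 M" by (rule L2_mult_indicator(1)[OF f C])
      have g1: "L2_norm M ?g \<le> 1"
        using L2_norm_mono[OF g f L2_mult_indicator(2)[OF f C]] f1 by simp
      have D: "?D \<in> L2 M" 
        by (rule L2_diff[OF L2_bounded_opsD(1)[OF S(1) g] L2_bounded_opsD(1)[OF T g]])
      have cut: "cut_op A T C f \<in> L2 M"
        unfolding cut_op_def by (rule L2_mult_indicator(1)[OF L2_bounded_opsD(1)[OF T g] A])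
      have "AE x in M. cut_op A T C f x = - mult_indicator A ?D x"
        using R(2)[OF A C AC f] by eventually_elim (simp add: cut_op_def mult_indicator_def algebra_simps)
      then have "sq_integral M (cut_op A T C f) = sq_integral M (\<lambda>x. - mult_indicator A ?D x)"
        by (rule sq_integral_cong_AE)
      also have "\<dots> = sq_integral M (mult_indicator A ?D)" by (simp add: sq_integral_def)
      also have "\<dots> \<le> sq_integral M ?D" by (rule L2_mult_indicator(2)[OF D A])
      finally have "L2_norm M (cut_op A T C f) \<le> L2_norm M ?D" by (rule L2_norm_mono[OF cut D])
      also have "\<dots> \<le> L2_opnorm M (\<lambda>f x. S n f x - T f x)"
        by (rule le_L2_opnorm[where T = "\<lambda>f x. S n f x - T f x", OF b g g1])
      finally show "L2_norm M (cut_op A T C f) \<le> \<epsilon> / 2" using n by simp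
    qed
    then show ?thesis using \<epsilon> by simp
  qed
  then show "\<exists>R>0. \<forall>A\<in>sets M. \<forall>C\<in>sets M. set_distance d A C > ereal R \<longrightarrow>
      L2_opnorm M (cut_op A T C) < \<epsilon>"
    using R(1) by blast
qed

section \<open>Quasi-locality forces expansion\<close>

locale measured_action = length_action G \<rho> l + prob_space \<nu>
  for G :: "('g, 'm) monoid_scheme" (structure) and \<rho> :: "'g \<Rightarrow> 'x::metric_space \<Rightarrow> 'x"
    and l :: "'g \<Rightarrow> nat" and \<nu> :: "'x measure" +
  assumes sets_nu: "sets \<nu> = sets borel"
    and nonsingular: "measure_class_preserving G \<nu> \<rho>"
begin

lemma space_nu [simp]: "space \<nu> = UNIV"
  using sets_eq_imp_space_eq[OF sets_nu] by simp

lemma act_measurable [measurable]: "g \<in> carrier G \<Longrightarrow> \<rho> g \<in> measurable \<nu> \<nu>"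
  unfolding measurable_cong_sets[OF sets_nu sets_nu]
  by (rule borel_measurable_continuous_onI[OF continuous])

lemma act_image_eq: "g \<in> carrier G \<Longrightarrow> \<rho> g ` A = \<rho> (inv g) -` A"
  by (force simp: image_iff)

lemma act_image_measurable [measurable]:
  assumes "g \<in> carrier G" "A \<in> sets \<nu>" shows "\<rho> g ` A \<in> sets \<nu>"
  using measurable_sets[OF act_measurable[OF inv_closed[OF assms(1)]] assms(2)] assms(1)
  by (simp add: act_image_eq)

lemma act_on_ball_measurable [measurable]:
  "A \<in> sets \<nu> \<Longrightarrow> act_on_set \<rho> (length_ball G l k) A \<in> sets \<nu>"
  unfolding act_on_set_def by (intro sets.finite_UN) (auto dest: ball_carrier)

lemma compact_measurable: "compact K \<Longrightarrow> K \<in> sets \<nu>"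
  by (simp add: sets_nu borel_compact)

lemma compact_inner:
  assumes "radon_measure \<nu>" "A \<in> sets \<nu>" "b < measure \<nu> A"
  obtains K where "compact K" "K \<subseteq> A" "b < measure \<nu> K"
proof (cases "b < 0")
  case True
  then show ?thesis using that[of "{}"] by simp
next
  case False
  have "ennreal b < emeasure \<nu> A" using assms(3) False by (simp add: emeasure_eq_measure ennreal_lessI)
  also have "emeasure \<nu> A = (SUP K\<in>{K. compact K \<and> K \<subseteq> A}. emeasure \<nu> K)"
    using assms unfolding radon_measure_def by blast
  finally obtain K where K: "compact K" "K \<subseteq> A" "ennreal b < emeasure \<nu> K"
    by (auto simp: less_SUP_iff)
  then show ?thesis using that False by (auto simp: emeasure_eq_measure ennreal_less_iff)
qed

text \<open>If \<open>B\<^sub>n \<cdot> A\<close> leaves out a set of measure at least \<open>1/4\<close>, inner regularity gives compact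
  \<open>K \<subseteq> A\<close> and \<open>L\<close> in the left-out set. Far out in the cone, \<open>K\<close> and \<open>L\<close> are at distance at
  least \<open>n\<close>, while the corner of the projection between their thickenings does not shrink.\<close>

lemma expanding_if_quasi_local:
  assumes radon: "radon_measure \<nu>"
    and ql: "quasi_local (cone_measure \<nu>) (cone_metric G l \<rho>) (drutu_nowak_projection \<nu>)"
  shows "asymptotically_expanding G l \<nu> \<rho>"
  unfolding asymptotically_expanding_def
proof (intro allI impI)
  fix \<alpha> :: real assume \<alpha>: "0 < \<alpha> \<and> \<alpha> \<le> 1/2"
  let ?M = "cone_measure \<nu>" and ?T = "drutu_nowak_projection \<nu>" and ?d = "cone_metric G l \<rho>"
  (* compact sets L and K with more than half of the measures 1/4 and \<alpha> give a corner of norm at least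
     measure L * sqrt (measure K) *)
  define \<epsilon> where "\<epsilon> = 1/8 * sqrt (\<alpha> / 2)"
  have "0 < \<epsilon>" using \<alpha> by (simp add: \<epsilon>_def)
  with ql have "\<exists>R>0. \<forall>A\<in>sets ?M. \<forall>C\<in>sets ?M. set_distance ?d A C > ereal R \<longrightarrow>
      L2_opnorm ?M (cut_op A ?T C) < \<epsilon>"
    unfolding quasi_local_def by (elim allE impE)
  then obtain R where R: "0 < R" "\<forall>A\<in>sets ?M. \<forall>C\<in>sets ?M. set_distance ?d A C > ereal R \<longrightarrow>
      L2_opnorm ?M (cut_op A ?T C) < \<epsilon>"
    by (elim exE conjE)
  define n where "n = nat \<lceil>R\<rceil> + 1"
  have n: "R < real n" unfolding n_def by linarith
  let ?B = "act_on_set \<rho> (length_ball G l n)"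
  have "(1 + 1/2) * measure \<nu> A < measure \<nu> (?B A)"
    if A [measurable]: "A \<in> sets \<nu>" and \<alpha>A: "\<alpha> \<le> measure \<nu> A" and A2: "measure \<nu> A \<le> 1/2" for A
  proof (rule ccontr)
    assume "\<not> ?thesis"
    then have "measure \<nu> (?B A) \<le> 3/4" using A2 by simp
    then have "1/8 < measure \<nu> (- ?B A)" using prob_compl[of "?B A"] by (simp add: Compl_eq_Diff_UNIV)
    moreover have "- ?B A \<in> sets \<nu>" using sets.compl_sets[of "?B A" \<nu>] by (simp add: Compl_eq_Diff_UNIV)
    ultimately obtain L where L: "compact L" "L \<subseteq> - ?B A" "1/8 < measure \<nu> L"
      using compact_inner[OF radon] by blast
    have "\<alpha> / 2 < measure \<nu> A" using \<alpha> \<alpha>A by simp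
    then obtain K where K: "compact K" "K \<subseteq> A" "\<alpha> / 2 < measure \<nu> K"
      using compact_inner[OF radon A] by blast
    have "L \<inter> ?B K = {}" using L(2) K(2) unfolding act_on_set_def by blast
    from warped_metric_separates[OF K(1) L(1) this]
    obtain T where T: "T \<ge> 1" "\<forall>t\<ge>T. \<forall>x\<in>K. \<forall>y\<in>L. real n \<le> warped_metric G l \<rho> t x y"
      by (elim exE conjE)
    let ?I = "{T..T+1}"
    have I [measurable]: "?I \<in> sets ray_measure"
      using T(1) by (auto simp: ray_measure_def sets_restrict_space image_iff intro!: bexI[of _ ?I])
    have eI: "emeasure ray_measure ?I = 1"
      using T(1) by (subst ray_measure_def, subst emeasure_restrict_space) auto
    have [measurable]: "K \<in> sets \<nu>" "L \<in> sets \<nu>" using K(1) L(1) compact_measurable by auto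
    have KI [measurable]: "K \<times> ?I \<in> sets ?M" and LI [measurable]: "L \<times> ?I \<in> sets ?M"
      by (auto simp: cone_measure_def)
    interpret sl: slices \<nu> ray_measure by (rule slices_ray) unfold_locales
    have eprod: "emeasure ?M (C \<times> ?I) = ennreal (measure \<nu> C)" if "C \<in> sets \<nu>" for C
      using that eI by (simp add: cone_measure_def sl.N.emeasure_pair_measure_Times emeasure_eq_measure)
    have "ereal (real n) \<le> set_distance ?d (K \<times> ?I) (L \<times> ?I)"
      unfolding set_distance_def
    proof (intro INF_greatest)
      fix a c assume "a \<in> K \<times> ?I" "c \<in> L \<times> ?I"
      then have "real n \<le> warped_metric G l \<rho> (min (snd a) (snd c)) (fst a) (fst c)"
        by (intro T(2)[rule_format]) auto
      then show "ereal (real n) \<le> ereal (?d a c)"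
        by (cases a; cases c) (simp add: cone_metric_def)
    qed
    then have far: "set_distance ?d (K \<times> ?I) (L \<times> ?I) > ereal R"
      using n by (metis less_ereal.simps(1) order.strict_trans2)
    let ?f = "indicator (L \<times> ?I) :: 'x \<times> real \<Rightarrow> complex"
    have f: "?f \<in> L2 ?M" using eprod[of L] by (intro L2_indicator) auto
    have sq_ind: "sq_integral ?M (\<lambda>z. c * indicator (C \<times> ?I) z) = ennreal ((cmod c)\<^sup>2 * measure \<nu> C)"
      if [measurable]: "C \<in> sets \<nu>" for c :: complex and C
    proof -
      have CI: "C \<times> ?I \<in> sets ?M" by (simp add: cone_measure_def)
      have "sq_integral ?M (\<lambda>z. c * indicator (C \<times> ?I) z)
          = (\<integral>\<^sup>+z. ennreal ((cmod c)\<^sup>2) * indicator (C \<times> ?I) z \<partial>?M)"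
        unfolding sq_integral_def by (intro nn_integral_cong) (auto simp: indicator_def)
      also have "\<dots> = ennreal ((cmod c)\<^sup>2) * emeasure ?M (C \<times> ?I)" by (rule nn_integral_cmult_indicator[OF CI])
      also have "\<dots> = ennreal ((cmod c)\<^sup>2 * measure \<nu> C)" by (simp add: eprod ennreal_mult)
      finally show ?thesis .
    qed
    have "L2_norm ?M ?f \<le> 1"
      using sq_ind[of L 1] by (subst L2_norm_le_iff[OF f]) (auto simp: ennreal_le_1)
    obtain b where b: "\<And>f. f \<in> L2 ?M \<Longrightarrow> L2_norm ?M f \<le> 1 \<Longrightarrow> L2_norm ?M (?T f) \<le> b"
      using L2_bounded_ops_unit_ball[OF drutu_nowak_projection(1)] prob_space_axioms by blast
    have Tb: "?T \<in> L2_bounded_ops ?M" by (rule drutu_nowak_projection(1)) unfold_locales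
    have cut: "cut_op (K \<times> ?I) ?T (L \<times> ?I) f \<in> L2 ?M \<and>
        L2_norm ?M (cut_op (K \<times> ?I) ?T (L \<times> ?I) f) \<le> b" if f: "f \<in> L2 ?M" "L2_norm ?M f \<le> 1" for f
    proof -
      let ?g = "mult_indicator (L \<times> ?I) f"
      have g: "?g \<in> L2 ?M" by (rule L2_mult_indicator(1)[OF f(1) LI])
      have "L2_norm ?M ?g \<le> L2_norm ?M f" by (rule L2_norm_mono[OF g f(1) L2_mult_indicator(2)[OF f(1) LI]])
      then have "L2_norm ?M (?T ?g) \<le> b" using f(2) by (intro b g) simp
      moreover have Tg: "?T ?g \<in> L2 ?M" by (rule L2_bounded_opsD(1)[OF Tb g])
      moreover note L2_norm_mono[OF L2_mult_indicator(1)[OF Tg KI] Tg L2_mult_indicator(2)[OF Tg KI]]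
      ultimately show ?thesis using L2_mult_indicator(1)[OF Tg KI] by (simp add: cut_op_def)
    qed
    have fL: "mult_indicator (L \<times> ?I) ?f = ?f" by (auto simp: mult_indicator_def indicator_def)
    have cutf: "cut_op (K \<times> ?I) ?T (L \<times> ?I) ?f = mult_indicator (K \<times> ?I) (?T ?f)"
      by (simp only: cut_op_def fL)
    have mean: "slice_mean \<nu> ?f z = of_real (measure \<nu> L)" if z: "z \<in> K \<times> ?I" for z
    proof -
      have "slice_mean \<nu> ?f z = (LINT x|\<nu>. complex_of_real (indicator L x))"
        unfolding slice_mean_def using z by (intro Bochner_Integration.integral_cong) (auto simp: indicator_def)
      then show ?thesis by simp
    qed
    have "AE z in ?M. cut_op (K \<times> ?I) ?T (L \<times> ?I) ?f z = of_real (measure \<nu> L) * indicator (K \<times> ?I) z"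
      using drutu_nowak_projection(2)[OF prob_space_axioms f]
      by eventually_elim (use mean in \<open>simp add: cutf mult_indicator_def split: split_indicator\<close>)
    then have "sq_integral ?M (cut_op (K \<times> ?I) ?T (L \<times> ?I) ?f) = ennreal ((measure \<nu> L)\<^sup>2 * measure \<nu> K)"
      using sq_ind[of K "of_real (measure \<nu> L)"] by (simp add: sq_integral_cong_AE)
    then have eq: "(L2_norm ?M (cut_op (K \<times> ?I) ?T (L \<times> ?I) ?f))\<^sup>2 = (measure \<nu> L)\<^sup>2 * measure \<nu> K"
      using cut[OF f \<open>L2_norm ?M ?f \<le> 1\<close>] by (simp add: sq_integral_eq_L2_norm)
    have "L2_norm ?M (cut_op (K \<times> ?I) ?T (L \<times> ?I) ?f) \<le> L2_opnorm ?M (cut_op (K \<times> ?I) ?T (L \<times> ?I))"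
      by (rule le_L2_opnorm[OF _ f \<open>L2_norm ?M ?f \<le> 1\<close>]) (use cut in blast)
    also have "\<dots> < \<epsilon>" by (rule R(2)[rule_format, OF KI LI far])
    finally have "(measure \<nu> L)\<^sup>2 * measure \<nu> K < \<epsilon>\<^sup>2"
      unfolding eq[symmetric] by (intro power_strict_mono) auto
    moreover have "(1/8)\<^sup>2 * (\<alpha> / 2) \<le> (measure \<nu> L)\<^sup>2 * measure \<nu> K"
      using L(3) K(3) \<alpha> by (intro mult_mono power_mono) auto
    moreover have "\<epsilon>\<^sup>2 = (1/8)\<^sup>2 * (\<alpha> / 2)"
      unfolding \<epsilon>_def power_mult_distrib using \<alpha> by (subst real_sqrt_pow2) auto
    ultimately show False by linarith
  qed
  then show "\<exists>c>0. \<exists>k. \<forall>A\<in>sets \<nu>. \<alpha> \<le> measure \<nu> A \<and> measure \<nu> A \<le> 1/2 \<longrightarrow>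
      measure \<nu> (act_on_set \<rho> (length_ball G l k) A) > (1 + c) * measure \<nu> A"
    by (intro exI[of _ "1/2"] conjI exI[of _ n]) auto
qed

end

section \<open>Symmetric edge measures and Cheeger's inequality\<close>

text \<open>Integrating the measures of the level sets recovers the integral. Applied to edges, with \<open>a\<close> and
  \<open>b\<close> the values of a function at the two ends, this is the coarea formula: the measure of the edges
  that leave a superlevel set, integrated over the levels, is the total increase along edges.\<close>

lemma (in sigma_finite_measure) layer_cake:
  fixes a b :: "'a \<Rightarrow> real"
  assumes [measurable]: "a \<in> borel_measurable M" "b \<in> borel_measurable M"
  shows "(\<integral>\<^sup>+s. emeasure M {z\<in>space M. b z \<le> s \<and> s < a z} \<partial>lborel) = (\<integral>\<^sup>+z. ennreal (a z - b z) \<partial>M)"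
proof -
  interpret pair_sigma_finite M lborel ..
  let ?g = "\<lambda>w. if b (fst w) \<le> snd w \<and> snd w < a (fst w) then 1 else 0 :: ennreal"
  have g: "?g \<in> borel_measurable (M \<Otimes>\<^sub>M lborel)" by measurable
  have "(\<integral>\<^sup>+s. emeasure M {z\<in>space M. b z \<le> s \<and> s < a z} \<partial>lborel) = (\<integral>\<^sup>+s. (\<integral>\<^sup>+z. ?g (z, s) \<partial>M) \<partial>lborel)"
  proof (rule nn_integral_cong)
    fix s :: real
    have "emeasure M {z\<in>space M. b z \<le> s \<and> s < a z} = (\<integral>\<^sup>+z. indicator {z\<in>space M. b z \<le> s \<and> s < a z} z \<partial>M)"
      by simp
    also have "\<dots> = (\<integral>\<^sup>+z. ?g (z, s) \<partial>M)" by (intro nn_integral_cong) (auto simp: indicator_def)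
    finally show "emeasure M {z\<in>space M. b z \<le> s \<and> s < a z} = (\<integral>\<^sup>+z. ?g (z, s) \<partial>M)" .
  qed
  also have "\<dots> = (\<integral>\<^sup>+z. (\<integral>\<^sup>+s. ?g (z, s) \<partial>lborel) \<partial>M)" by (rule Fubini[OF g])
  also have "\<dots> = (\<integral>\<^sup>+z. ennreal (a z - b z) \<partial>M)"
  proof (rule nn_integral_cong)
    fix z
    have "(\<integral>\<^sup>+s. ?g (z, s) \<partial>lborel) = (\<integral>\<^sup>+s. indicator {b z..<a z} s \<partial>lborel)"
      by (intro nn_integral_cong) (auto simp: indicator_def)
    also have "\<dots> = ennreal (a z - b z)" by (cases "b z \<le> a z") (auto simp: ennreal_neg)
    finally show "(\<integral>\<^sup>+s. ?g (z, s) \<partial>lborel) = ennreal (a z - b z)" .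
  qed
  finally show ?thesis .
qed

text \<open>The number \<open>c\<close> is a lower bound for the Cheeger constant of \<open>Y\<close>, computed with the edges that stay
  inside \<open>Y\<close>.\<close>

definition expansion_domain :: "'a measure \<Rightarrow> ('a \<times> 'a) measure \<Rightarrow> 'a set \<Rightarrow> real \<Rightarrow> bool" where
  "expansion_domain N m Y c \<longleftrightarrow> Y \<in> sets N \<and> 0 < c \<and>
     (\<forall>A\<in>sets N. A \<subseteq> Y \<longrightarrow> 2 * measure N A \<le> measure N Y \<longrightarrow>
        c * measure N A \<le> measure m (A \<times> (Y - A)))"

text \<open>A measure on pairs is read as the edge measure of a weighted graph on the space; the constant \<open>C\<close>
  bounds the degrees.\<close>

locale symmetric_edges = finite_measure N for N :: "'a measure" +
  fixes m :: "('a \<times> 'a) measure" and C :: real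
  assumes sets_m: "sets m = sets (N \<Otimes>\<^sub>M N)"
    and swap: "\<And>h. h \<in> borel_measurable (N \<Otimes>\<^sub>M N) \<Longrightarrow>
      (\<integral>\<^sup>+(x, y). h (x, y) \<partial>m) = (\<integral>\<^sup>+(x, y). h (y, x) \<partial>m)"
    and marginal: "\<And>h. h \<in> borel_measurable N \<Longrightarrow> (\<integral>\<^sup>+(x, y). h x \<partial>m) \<le> ennreal C * (\<integral>\<^sup>+x. h x \<partial>N)"
    and C_pos: "0 < C"
begin

lemmas [measurable_cong] = sets_m

lemma measurable_m: "borel_measurable m = borel_measurable (N \<Otimes>\<^sub>M N)"
  by (rule measurable_cong_sets[OF sets_m refl])

lemma space_m [simp]: "space m = space N \<times> space N"
  using sets_eq_imp_space_eq[OF sets_m] by (simp add: space_pair_measure)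

lemma Times_in_sets_m: "A \<in> sets N \<Longrightarrow> B \<in> sets N \<Longrightarrow> A \<times> B \<in> sets m"
  by (simp add: sets_m)

lemma emeasure_m_le:
  assumes "A \<in> sets N" "B \<in> sets N"
  shows "emeasure m (A \<times> B) \<le> ennreal C * emeasure N A"
proof -
  have "emeasure m (A \<times> B) = (\<integral>\<^sup>+z. indicator (A \<times> B) z \<partial>m)"
    using Times_in_sets_m[OF assms] by simp
  also have "\<dots> \<le> (\<integral>\<^sup>+(x, y). indicator A x \<partial>m)"
    by (intro nn_integral_mono) (auto simp: indicator_def)
  also have "\<dots> \<le> ennreal C * (\<integral>\<^sup>+x. indicator A x \<partial>N)"
    using assms by (intro marginal) simp
  finally show ?thesis using assms by simp
qed

lemma emeasure_m_swap:
  assumes "A \<in> sets N" "B \<in> sets N"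
  shows "emeasure m (A \<times> B) = emeasure m (B \<times> A)"
proof -
  have "emeasure m (A \<times> B) = (\<integral>\<^sup>+(x, y). indicator (A \<times> B) (x, y) \<partial>m)"
    using Times_in_sets_m[OF assms] by (simp add: case_prod_unfold)
  also have "\<dots> = (\<integral>\<^sup>+(x, y). indicator (A \<times> B) (y, x) \<partial>m)"
    using assms by (intro swap) simp
  also have "\<dots> = (\<integral>\<^sup>+z. indicator (B \<times> A) z \<partial>m)"
    by (intro nn_integral_cong) (auto simp: indicator_def)
  also have "\<dots> = emeasure m (B \<times> A)" using Times_in_sets_m[OF assms(2,1)] by simp
  finally show ?thesis .
qed

lemma marginal2:
  assumes "h \<in> borel_measurable N"
  shows "(\<integral>\<^sup>+(x, y). h y \<partial>m) \<le> ennreal C * (\<integral>\<^sup>+x. h x \<partial>N)"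
proof -
  have "(\<integral>\<^sup>+(x, y). h y \<partial>m) = (\<integral>\<^sup>+(x, y). h x \<partial>m)"
    using swap[of "\<lambda>(x, y). h y"] assms by simp
  then show ?thesis using marginal[OF assms] by simp
qed

lemma finite_measure_m: "finite_measure m"
proof
  have "emeasure m (space m) \<le> ennreal C * emeasure N (space N)"
    unfolding space_m by (intro emeasure_m_le) auto
  then show "emeasure m (space m) \<noteq> \<infinity>"
    by (auto simp: emeasure_eq_measure ennreal_mult[symmetric] top_unique C_pos less_imp_le)
qed

sublocale m: finite_measure m by (rule finite_measure_m)

definition energy :: "('a \<Rightarrow> real) \<Rightarrow> ennreal" where
  "energy f = (\<integral>\<^sup>+(x, y). ennreal ((f x - f y)\<^sup>2) \<partial>m)"

text \<open>Cheeger's argument for a nonnegative function whose positivity set is small: apply the coarea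
  formula to \<open>f\<^sup>2\<close> and split \<open>f(x)\<^sup>2 - f(y)\<^sup>2 = (f x - f y) (f x + f y)\<close> by the weighted
  inequality between the means. The weight \<open>c / (4 C)\<close> makes the second term at most half of the
  left-hand side, which is finite, so that it can be subtracted.\<close>

lemma cheeger_nonneg:
  fixes f :: "'a \<Rightarrow> real"
  assumes [measurable]: "f \<in> borel_measurable N" and f0: "\<And>x. 0 \<le> f x"
    and fin: "sq_integral N f < \<infinity>"
    and small: "2 * measure N {x\<in>space N. 0 < f x} \<le> measure N (space N)"
    and dom: "expansion_domain N m (space N) c"
  shows "ennreal (c\<^sup>2 / (4 * C)) * sq_integral N f \<le> energy f"
proof -
  have c: "0 < c" and expand: "\<And>A. A \<in> sets N \<Longrightarrow> 2 * measure N A \<le> measure N (space N) \<Longrightarrow>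
      c * measure N A \<le> measure m (A \<times> (space N - A))"
    using dom sets.sets_into_space[of _ N] unfolding expansion_domain_def by blast+
  let ?\<delta> = "c / (4 * C)"
  have \<delta>: "0 < ?\<delta>" using c C_pos by simp
  have fxm: "(\<lambda>z. f (fst z)) \<in> borel_measurable m" and fym: "(\<lambda>z. f (snd z)) \<in> borel_measurable m"
    unfolding measurable_m by measurable
  have level: "ennreal c * emeasure N {x\<in>space N. 0 \<le> s \<and> s < (f x)\<^sup>2}
      \<le> emeasure m {z\<in>space m. (f (snd z))\<^sup>2 \<le> s \<and> s < (f (fst z))\<^sup>2}" for s :: real
  proof (cases "0 \<le> s")
    case True
    let ?A = "{x\<in>space N. s < (f x)\<^sup>2}"
    have A: "?A \<in> sets N" by measurable
    have "?A \<subseteq> {x\<in>space N. 0 < f x}"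
      using True f0 by (auto simp: less_le)
    then have "measure N ?A \<le> measure N {x\<in>space N. 0 < f x}"
      by (intro finite_measure_mono) measurable
    then have "c * measure N ?A \<le> measure m (?A \<times> (space N - ?A))"
      using small by (intro expand A) simp
    moreover have "?A \<times> (space N - ?A) = {z\<in>space m. (f (snd z))\<^sup>2 \<le> s \<and> s < (f (fst z))\<^sup>2}" by auto
    ultimately show ?thesis using True c
      by (simp add: emeasure_eq_measure m.emeasure_eq_measure ennreal_mult[symmetric] ennreal_leI)
  qed simp
  have "ennreal c * sq_integral N f
      = ennreal c * (\<integral>\<^sup>+s. emeasure N {x\<in>space N. 0 \<le> s \<and> s < (f x)\<^sup>2} \<partial>lborel)"
    using layer_cake[of "\<lambda>x. (f x)\<^sup>2" "\<lambda>x. 0"] by (simp add: sq_integral_def)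
  also have "\<dots> = (\<integral>\<^sup>+s. ennreal c * emeasure N {x\<in>space N. 0 \<le> s \<and> s < (f x)\<^sup>2} \<partial>lborel)"
    by (rule nn_integral_cmult[symmetric]) measurable
  also have "\<dots> \<le> (\<integral>\<^sup>+s. emeasure m {z\<in>space m. (f (snd z))\<^sup>2 \<le> s \<and> s < (f (fst z))\<^sup>2} \<partial>lborel)"
    by (intro nn_integral_mono level)
  also have "\<dots> = (\<integral>\<^sup>+z. ennreal ((f (fst z))\<^sup>2 - (f (snd z))\<^sup>2) \<partial>m)"
    using fxm fym by (intro m.layer_cake) measurable
  also have "\<dots> \<le> (\<integral>\<^sup>+z. ennreal (1 / (2 * ?\<delta>)) * ennreal ((f (fst z) - f (snd z))\<^sup>2) +
      (ennreal ?\<delta> * ennreal ((f (fst z))\<^sup>2) + ennreal ?\<delta> * ennreal ((f (snd z))\<^sup>2)) \<partial>m)"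
  proof (rule nn_integral_mono)
    fix z :: "'a \<times> 'a"
    let ?a = "f (fst z)" and ?b = "f (snd z)"
    have "0 \<le> ((?a - ?b) / ?\<delta> - (?a + ?b))\<^sup>2" by simp
    then have "0 \<le> ?\<delta> / 2 * ((?a - ?b) / ?\<delta> - (?a + ?b))\<^sup>2"
      using \<delta> by (intro mult_nonneg_nonneg) auto
    also have "\<dots> = 1 / (2 * ?\<delta>) * (?a - ?b)\<^sup>2 - (?a - ?b) * (?a + ?b) + ?\<delta> / 2 * (?a + ?b)\<^sup>2"
      using \<delta> c C_pos by (simp add: power2_eq_square field_simps)
    also have "(?a - ?b) * (?a + ?b) = ?a\<^sup>2 - ?b\<^sup>2" by (simp add: power2_eq_square algebra_simps)
    finally have "?a\<^sup>2 - ?b\<^sup>2 \<le> 1 / (2 * ?\<delta>) * (?a - ?b)\<^sup>2 + ?\<delta> / 2 * (?a + ?b)\<^sup>2" by simp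
    moreover have "?\<delta> / 2 * (?a + ?b)\<^sup>2 \<le> ?\<delta> / 2 * (2 * ?a\<^sup>2 + 2 * ?b\<^sup>2)"
      using norm_add_sq_le[of ?a ?b] \<delta> by (intro mult_left_mono) auto
    ultimately have "?a\<^sup>2 - ?b\<^sup>2 \<le> 1 / (2 * ?\<delta>) * (?a - ?b)\<^sup>2 + (?\<delta> * ?a\<^sup>2 + ?\<delta> * ?b\<^sup>2)"
      by (simp add: distrib_left)
    then have "ennreal (?a\<^sup>2 - ?b\<^sup>2) \<le> ennreal (1 / (2 * ?\<delta>) * (?a - ?b)\<^sup>2 + (?\<delta> * ?a\<^sup>2 + ?\<delta> * ?b\<^sup>2))"
      by (rule ennreal_leI)
    also have "\<dots> = ennreal (1 / (2 * ?\<delta>) * (?a - ?b)\<^sup>2) + (ennreal (?\<delta> * ?a\<^sup>2) + ennreal (?\<delta> * ?b\<^sup>2))"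
      using \<delta> c C_pos by (simp add: ennreal_plus del: times_divide_eq_left times_divide_eq_right)
    also have "\<dots> = ennreal (1 / (2 * ?\<delta>)) * ennreal ((?a - ?b)\<^sup>2) + (ennreal ?\<delta> * ennreal (?a\<^sup>2) + ennreal ?\<delta> * ennreal (?b\<^sup>2))"
      using \<delta> c C_pos by (subst (1 2 3) ennreal_mult) auto
    finally show "ennreal (?a\<^sup>2 - ?b\<^sup>2) \<le> ennreal (1 / (2 * ?\<delta>)) * ennreal ((?a - ?b)\<^sup>2) +
      (ennreal ?\<delta> * ennreal (?a\<^sup>2) + ennreal ?\<delta> * ennreal (?b\<^sup>2))" .
  qed
  also have "\<dots> = ennreal (1 / (2 * ?\<delta>)) * energy f +
      (ennreal ?\<delta> * (\<integral>\<^sup>+z. ennreal ((f (fst z))\<^sup>2) \<partial>m) + ennreal ?\<delta> * (\<integral>\<^sup>+z. ennreal ((f (snd z))\<^sup>2) \<partial>m))"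
    using fxm fym by (simp add: nn_integral_add nn_integral_cmult energy_def case_prod_unfold)
  also have "\<dots> \<le> ennreal (1 / (2 * ?\<delta>)) * energy f +
      (ennreal ?\<delta> * (ennreal C * sq_integral N f) + ennreal ?\<delta> * (ennreal C * sq_integral N f))"
    using marginal[of "\<lambda>x. ennreal ((f x)\<^sup>2)"] marginal2[of "\<lambda>x. ennreal ((f x)\<^sup>2)"]
    by (intro add_mono mult_left_mono) (auto simp: case_prod_unfold sq_integral_def)
  also have "ennreal ?\<delta> * (ennreal C * sq_integral N f) + ennreal ?\<delta> * (ennreal C * sq_integral N f)
      = ennreal (c / 2) * sq_integral N f"
    using \<delta> c C_pos
    by (simp add: mult.assoc[symmetric] ennreal_mult[symmetric] distrib_right[symmetric] ennreal_plus[symmetric]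
        del: ennreal_plus)
  finally have main: "ennreal c * sq_integral N f
      \<le> ennreal (1 / (2 * ?\<delta>)) * energy f + ennreal (c / 2) * sq_integral N f" .
  obtain s where s: "sq_integral N f = ennreal s" "0 \<le> s"
    using fin by (cases "sq_integral N f" rule: ennreal_cases) auto
  show ?thesis
  proof (cases "energy f" rule: ennreal_cases)
    case (real e)
    have "ennreal (c * s) \<le> ennreal (1 / (2 * ?\<delta>) * e + c / 2 * s)"
      using main c C_pos \<delta> s real by (simp add: ennreal_mult[symmetric] ennreal_plus[symmetric] del: ennreal_plus)
    then have "c * s \<le> 1 / (2 * ?\<delta>) * e + c / 2 * s"
      using s real \<delta> c C_pos by (subst (asm) ennreal_le_iff) auto
    then have "c\<^sup>2 / (4 * C) * s \<le> e" using c C_pos by (simp add: field_simps power2_eq_square)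
    then show ?thesis using s real c C_pos by (simp add: ennreal_mult[symmetric] ennreal_leI)
  qed simp
qed

end

text \<open>A median is the least point at which the distribution function reaches half of the total mass.\<close>

lemma (in finite_measure) median_exists:
  fixes g :: "'a \<Rightarrow> real"
  assumes [measurable]: "g \<in> borel_measurable M"
  obtains a where "2 * measure M {x\<in>space M. a < g x} \<le> measure M (space M)"
    and "2 * measure M {x\<in>space M. g x < a} \<le> measure M (space M)"
proof (cases "measure M (space M) = 0")
  case True
  then have "measure M A = 0" for A
    using bounded_measure[of A] by (simp add: measure_le_0_iff)
  then show ?thesis using that by simp
next
  case False
  define V where "V = measure M (space M)"
  have V: "0 < V" using False by (simp add: V_def zero_less_measure_iff less_le)
  let ?D = "distr M borel g"
  interpret D: finite_borel_measure ?D
    by (simp add: finite_borel_measure_def finite_borel_measure_axioms_def finite_measure_distr)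
  have D: "measure ?D B = measure M {x\<in>space M. g x \<in> B}" if "B \<in> sets borel" for B
    using that by (simp add: measure_distr vimage_def Int_def conj_commute)
  define a where "a = Inf {x. V / 2 \<le> cdf ?D x}"
  have mono: "cdf ?D x \<le> cdf ?D y" if "x \<le> y" for x y by (rule D.cdf_nondecreasing[OF that])
  have "measure ?D (space ?D) = V" using D[of UNIV] by (simp add: V_def)
  then have "eventually (\<lambda>x. V / 2 < cdf ?D x) at_top"
    using order_tendstoD(1)[OF D.cdf_lim_at_top, of "V / 2"] V by simp
  then obtain u where u: "V / 2 < cdf ?D u" by (auto simp: eventually_at_top_linorder)
  have "eventually (\<lambda>x. cdf ?D x < V / 2) at_bot"
    using order_tendstoD(2)[OF D.cdf_lim_at_bot, of "V / 2"] V by simp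
  then obtain v where v: "cdf ?D v < V / 2" by (auto simp: eventually_at_bot_linorder)
  have bdd: "bdd_below {x. V / 2 \<le> cdf ?D x}"
  proof (rule bdd_belowI[of _ v])
    fix x assume "x \<in> {x. V / 2 \<le> cdf ?D x}"
    then show "v \<le> x" using v mono[of x v] by (cases "x \<le> v") auto
  qed
  have above: "V / 2 \<le> cdf ?D x" if x: "a < x" for x
  proof -
    obtain y where "V / 2 \<le> cdf ?D y" "y < x"
      using x u bdd unfolding a_def by (subst (asm) cInf_less_iff) (auto intro: less_imp_le)
    then show ?thesis using mono[of y x] by simp
  qed
  have below: "cdf ?D x \<le> V / 2" if "x < a" for x
    using that bdd cInf_lower[of x "{x. V / 2 \<le> cdf ?D x}"] unfolding a_def by fastforce
  have "(cdf ?D \<longlongrightarrow> cdf ?D a) (at_right a)"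
    using D.cdf_is_right_cont by (simp add: continuous_within)
  then have "V / 2 \<le> cdf ?D a"
  proof (rule tendsto_lowerbound)
    show "eventually (\<lambda>x. V / 2 \<le> cdf ?D x) (at_right a)"
      unfolding eventually_at_filter by (intro always_eventually allI impI above) simp
  qed simp
  moreover have "measure ?D {..<a} \<le> V / 2"
  proof (rule tendsto_upperbound[OF D.cdf_at_left])
    show "eventually (\<lambda>x. cdf ?D x \<le> V / 2) (at_left a)"
      unfolding eventually_at_filter by (intro always_eventually allI impI below) simp
  qed simp
  moreover have "measure M {x\<in>space M. a < g x} = V - cdf ?D a"
    unfolding V_def cdf_def D[OF borel_closed[OF closed_atMost]]
    by (subst finite_measure_compl[symmetric]) (auto intro!: arg_cong[of _ _ "measure M"])
  ultimately show ?thesis using that[of a] D[of "{..<a}"] by (simp add: V_def)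
qed

context symmetric_edges
begin

text \<open>Around a median both the positive and the negative part are supported on at most half of the
  space, and their energies add up to at most the energy of the function.\<close>

lemma cheeger:
  fixes g :: "'a \<Rightarrow> real"
  assumes [measurable]: "g \<in> borel_measurable N" and fin: "sq_integral N g < \<infinity>"
    and mean: "(LINT x|N. g x) = 0"
    and dom: "expansion_domain N m (space N) c"
  shows "ennreal (c\<^sup>2 / (4 * C)) * sq_integral N g \<le> energy g"
proof -
  obtain a where a: "2 * measure N {x\<in>space N. a < g x} \<le> measure N (space N)"
    "2 * measure N {x\<in>space N. g x < a} \<le> measure N (space N)"
    using median_exists[of g] by auto
  let ?p = "\<lambda>x. max 0 (g x - a)" and ?n = "\<lambda>x. max 0 (a - g x)"
  have ga_le: "sq_integral N (\<lambda>x. g x - a) < \<infinity>"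
  proof -
    have "sq_integral N (\<lambda>x. g x + (- a)) \<le> 2 * sq_integral N g + 2 * sq_integral N (\<lambda>x. - a)"
      by (intro sq_integral_add_le) measurable
    also have "\<dots> < \<infinity>"
      using fin by (simp add: sq_integral_def[of _ "\<lambda>x. - a"] ennreal_mult_less_top emeasure_eq_measure)
    finally show ?thesis by simp
  qed
  have p: "sq_integral N ?p \<le> sq_integral N (\<lambda>x. g x - a)" and n: "sq_integral N ?n \<le> sq_integral N (\<lambda>x. g x - a)"
    by (intro sq_integral_mono; simp add: max_def)+
  have "ennreal (c\<^sup>2 / (4 * C)) * sq_integral N ?p \<le> energy ?p"
    using a(1) order.strict_trans1[OF p ga_le] by (intro cheeger_nonneg dom) (auto simp: less_max_iff_disj)
  moreover have "ennreal (c\<^sup>2 / (4 * C)) * sq_integral N ?n \<le> energy ?n"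
    using a(2) order.strict_trans1[OF n ga_le] by (intro cheeger_nonneg dom) (auto simp: less_max_iff_disj)
  moreover have "energy ?p + energy ?n \<le> energy g"
  proof -
    have m1: "(\<lambda>z. g (fst z)) \<in> borel_measurable m" and m2: "(\<lambda>z. g (snd z)) \<in> borel_measurable m"
      unfolding measurable_m by measurable
    have "energy ?p + energy ?n = (\<integral>\<^sup>+(x, y). ennreal ((?p x - ?p y)\<^sup>2) + ennreal ((?n x - ?n y)\<^sup>2) \<partial>m)"
      unfolding energy_def case_prod_unfold using m1 m2 by (intro nn_integral_add[symmetric]) measurable
    also have "\<dots> \<le> energy g"
      unfolding energy_def
    proof (rule nn_integral_mono)
      fix z :: "'a \<times> 'a"
      obtain x y where z: "z = (x, y)" by (cases z)
      have "ennreal ((?p x - ?p y)\<^sup>2 + (?n x - ?n y)\<^sup>2) \<le> ennreal ((g x - g y)\<^sup>2)"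
      proof (rule ennreal_leI)
        have "0 \<le> (?p x - ?p y) * (?n y - ?n x)"
          by (auto simp: max_def mult_le_0_iff zero_le_mult_iff)
        moreover have "(g x - g y)\<^sup>2 = ((?p x - ?p y) + (?n y - ?n x))\<^sup>2"
          by (auto simp: max_def power2_commute)
        moreover have "u\<^sup>2 + v\<^sup>2 \<le> (u + v)\<^sup>2" if "0 \<le> u * v" for u v :: real
          using that by (simp add: power2_sum)
        ultimately show "(?p x - ?p y)\<^sup>2 + (?n x - ?n y)\<^sup>2 \<le> (g x - g y)\<^sup>2"
          by (simp only: power2_commute[of "?n x"])
      qed
      then show "(case z of (x, y) \<Rightarrow> ennreal ((?p x - ?p y)\<^sup>2) + ennreal ((?n x - ?n y)\<^sup>2))
          \<le> (case z of (x, y) \<Rightarrow> ennreal ((g x - g y)\<^sup>2))"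
        by (simp add: z ennreal_plus)
    qed
    finally show ?thesis .
  qed
  moreover have "sq_integral N (\<lambda>x. g x - a) = sq_integral N ?p + sq_integral N ?n"
    unfolding sq_integral_def
    by (subst nn_integral_add[symmetric])
      (auto intro!: nn_integral_cong simp: max_def ennreal_plus[symmetric] power2_commute simp del: ennreal_plus)
  moreover have "sq_integral N g \<le> sq_integral N (\<lambda>x. g x - a)"
  proof -
    have sq: "integrable N (\<lambda>x. (g x)\<^sup>2)"
      using fin unfolding sq_integral_def by (intro integrableI_bounded) simp_all
    have int: "integrable N g"
      using sq by (rule square_integrable_imp_integrable[rotated]) measurable
    have "(LINT x|N. (g x - a)\<^sup>2) = (LINT x|N. (g x)\<^sup>2 - 2 * a * g x + a\<^sup>2)"
      by (intro Bochner_Integration.integral_cong) (auto simp: power2_diff)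
    also have "\<dots> = (LINT x|N. (g x)\<^sup>2) + a\<^sup>2 * measure N (space N)"
      using sq int mean by simp
    finally have "(LINT x|N. (g x)\<^sup>2) \<le> (LINT x|N. (g x - a)\<^sup>2)" by simp
    moreover have "integrable N (\<lambda>x. (g x - a)\<^sup>2)"
      using ga_le unfolding sq_integral_def by (intro integrableI_bounded) simp_all
    ultimately show ?thesis
      using sq unfolding sq_integral_def by (simp add: nn_integral_eq_integral ennreal_leI)
  qed
  ultimately show ?thesis
    by (smt (verit) add_mono distrib_left mult_left_mono order_trans zero_le)
qed

end

section \<open>Domains of expansion\<close>

text \<open>A measure-theoretic form of Zorn's lemma: adding at each step nearly as much measure as possible
  leaves nothing to add to the union.\<close>

lemma (in finite_measure) maximal_measurable_set:
  assumes sets: "\<B> \<subseteq> sets M" and ne: "{} \<in> \<B>"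
    and union: "\<And>F::nat \<Rightarrow> 'a set. range F \<subseteq> \<B> \<Longrightarrow> incseq F \<Longrightarrow> (\<Union>i. F i) \<in> \<B>"
  obtains F where "F \<in> \<B>" "\<And>H. H \<in> \<B> \<Longrightarrow> F \<subseteq> H \<Longrightarrow> measure M H = measure M F"
proof -
  have step: "\<exists>F'. F' \<in> \<B> \<and> F \<subseteq> F' \<and> (\<forall>H\<in>\<B>. F \<subseteq> H \<longrightarrow> measure M H \<le> measure M F' + 1 / real (Suc n))"
    if F: "F \<in> \<B>" for F and n :: nat
  proof -
    let ?S = "measure M ` {H\<in>\<B>. F \<subseteq> H}"
    have bdd: "bdd_above ?S" by (rule bdd_aboveI[of _ "measure M (space M)"]) (auto intro: bounded_measure)
    have ne: "?S \<noteq> {}" using F by auto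
    have "Sup ?S - 1 / real (Suc n) < Sup ?S" by simp
    then obtain y where y: "y \<in> ?S" "Sup ?S - 1 / real (Suc n) < y" using ne by (rule less_cSupE)
    then obtain F' where F': "F' \<in> \<B>" "F \<subseteq> F'" "y = measure M F'" by auto
    have "measure M H \<le> measure M F' + 1 / real (Suc n)" if "H \<in> \<B>" "F \<subseteq> H" for H
      using cSup_upper[OF _ bdd, of "measure M H"] that y F' by auto
    with F' show ?thesis by blast
  qed
  have "\<exists>F. \<forall>n::nat. F n \<in> \<B> \<and> (F n \<subseteq> F (Suc n) \<and>
      (\<forall>H\<in>\<B>. F n \<subseteq> H \<longrightarrow> measure M H \<le> measure M (F (Suc n)) + 1 / real (Suc n)))"
    by (rule dependent_nat_choice) (use ne step in blast)+
  then obtain F where F_all: "\<forall>n::nat. F n \<in> \<B> \<and> (F n \<subseteq> F (Suc n) \<and>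
      (\<forall>H\<in>\<B>. F n \<subseteq> H \<longrightarrow> measure M H \<le> measure M (F (Suc n)) + 1 / real (Suc n)))" ..
  have inc: "incseq F" by (rule incseq_SucI) (use F_all in blast)
  have U: "(\<Union>i. F i) \<in> \<B>" by (rule union[OF _ inc]) (use F_all in blast)
  have "measure M H = measure M (\<Union>i. F i)" if H: "H \<in> \<B>" "(\<Union>i. F i) \<subseteq> H" for H
  proof (rule antisym)
    show "measure M (\<Union>i. F i) \<le> measure M H"
      using H sets by (intro finite_measure_mono) auto
    have le: "measure M H \<le> measure M (\<Union>i. F i) + 1 / real (Suc n)" for n
    proof -
      have "F n \<subseteq> H" using H(2) by blast
      then have "measure M H \<le> measure M (F (Suc n)) + 1 / real (Suc n)" using F_all H(1) by blast
      moreover have "measure M (F (Suc n)) \<le> measure M (\<Union>i. F i)"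
        using U sets by (intro finite_measure_mono) auto
      ultimately show ?thesis by linarith
    qed
    have "(\<lambda>n. measure M (\<Union>i. F i) + 1 / real (Suc n)) \<longlonglongrightarrow> measure M (\<Union>i. F i) + 0"
      using LIMSEQ_inverse_real_of_nat by (intro tendsto_intros) (simp add: inverse_eq_divide)
    then show "measure M H \<le> measure M (\<Union>i. F i)"
      by (intro LIMSEQ_le_const[of _ "measure M (\<Union>i. F i)"]) (use le in auto)
  qed
  then show ?thesis using that U by blast
qed

text \<open>Call a set of measure at most \<open>1/2\<close> bad if few edges leave it compared with its measure. The
  expansion of sets of measure at least \<open>\<alpha>\<close> forces bad sets to be smaller than \<open>\<alpha>\<close>. Remove a maximal bad
  set \<open>F\<close>. A subset of the rest of measure below \<open>1/4\<close> without expansion could be added to \<open>F\<close>. A larger one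
  expands in the whole space, and it loses at most the edges that end in \<open>F\<close>: this loss is measured
  with \<open>m1\<close>, whose degree bound \<open>C1\<close> is fixed before \<open>\<alpha>\<close>, whereas \<open>m\<close> depends on \<open>\<alpha>\<close>.\<close>

lemma domain_of_expansion:
  assumes "prob_space \<nu>" and edges: "symmetric_edges \<nu> m C" "symmetric_edges \<nu> m1 C1"
    and m1_le: "\<And>E. E \<in> sets m \<Longrightarrow> measure m1 E \<le> measure m E"
    and \<alpha>: "0 < \<alpha>" "\<alpha> \<le> 1/8" "C1 * \<alpha> \<le> h1 / 2" and h: "0 < h" "0 < h1"
    and exp1: "\<And>A. A \<in> sets \<nu> \<Longrightarrow> 1/4 \<le> measure \<nu> A \<Longrightarrow> measure \<nu> A \<le> 1/2 \<Longrightarrow>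
      h1 \<le> measure m1 (A \<times> (space \<nu> - A))"
    and exp: "\<And>A. A \<in> sets \<nu> \<Longrightarrow> \<alpha> \<le> measure \<nu> A \<Longrightarrow> measure \<nu> A \<le> 1/2 \<Longrightarrow>
      h \<le> measure m (A \<times> (space \<nu> - A))"
  obtains Y c where "1 - \<alpha> \<le> measure \<nu> Y" "expansion_domain \<nu> m Y c"
proof -
  interpret prob_space \<nu> by fact
  interpret m: symmetric_edges \<nu> m C by fact
  interpret m1: symmetric_edges \<nu> m1 C1 by fact
  define c where "c = min h h1"
  have c: "0 < c" "c \<le> h" "c \<le> h1" using h by (auto simp: c_def)
  define \<B> where "\<B> = {F\<in>sets \<nu>. measure \<nu> F \<le> 1/2 \<and> measure m (F \<times> (space \<nu> - F)) \<le> c * measure \<nu> F}"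
  obtain F where F: "F \<in> \<B>" and maxF: "\<And>H. H \<in> \<B> \<Longrightarrow> F \<subseteq> H \<Longrightarrow> measure \<nu> H = measure \<nu> F"
  proof (rule maximal_measurable_set[of \<B>])
    show "\<B> \<subseteq> sets \<nu>" "{} \<in> \<B>" by (auto simp: \<B>_def)
    fix F :: "nat \<Rightarrow> _" assume FB: "range F \<subseteq> \<B>" and inc: "incseq F"
    have Fs: "F n \<in> sets \<nu>" "measure \<nu> (F n) \<le> 1/2"
      "measure m (F n \<times> (space \<nu> - F n)) \<le> c * measure \<nu> (F n)" for n
      using FB by (auto simp: \<B>_def)
    let ?U = "\<Union>i. F i"
    have U: "?U \<in> sets \<nu>" using Fs by blast
    have lim: "(\<lambda>n. measure \<nu> (F n)) \<longlonglongrightarrow> measure \<nu> ?U"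
      using Fs(1) inc by (intro finite_Lim_measure_incseq) auto
    have "measure \<nu> ?U \<le> 1/2" by (rule LIMSEQ_le_const2[OF lim]) (use Fs in auto)
    moreover have "measure m (?U \<times> (space \<nu> - ?U)) \<le> c * measure \<nu> ?U"
    proof -
      have "(\<lambda>n. measure m (F n \<times> (space \<nu> - ?U))) \<longlonglongrightarrow> measure m (\<Union>n. F n \<times> (space \<nu> - ?U))"
        using Fs(1) inc U
        by (intro m.m.finite_Lim_measure_incseq) (auto simp: incseq_def intro!: m.Times_in_sets_m)
      moreover have "(\<Union>n. F n \<times> (space \<nu> - ?U)) = ?U \<times> (space \<nu> - ?U)" by blast
      ultimately have lim': "(\<lambda>n. measure m (F n \<times> (space \<nu> - ?U))) \<longlonglongrightarrow> measure m (?U \<times> (space \<nu> - ?U))"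
        by simp
      have "measure m (F n \<times> (space \<nu> - ?U)) \<le> c * measure \<nu> (F n)" for n
      proof -
        have "measure m (F n \<times> (space \<nu> - ?U)) \<le> measure m (F n \<times> (space \<nu> - F n))"
          using Fs(1) by (intro m.m.finite_measure_mono m.Times_in_sets_m) auto
        then show ?thesis using Fs(3)[of n] by simp
      qed
      then show ?thesis
        by (intro LIMSEQ_le[OF lim' tendsto_mult_left[OF lim]]) auto
    qed
    ultimately show "?U \<in> \<B>" using U by (simp add: \<B>_def)
  qed blast
  have Fs [measurable]: "F \<in> sets \<nu>" and F2: "measure \<nu> F \<le> 1/2"
    and Fm: "measure m (F \<times> (space \<nu> - F)) \<le> c * measure \<nu> F"
    using F by (auto simp: \<B>_def)
  have F\<alpha>: "measure \<nu> F < \<alpha>"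
  proof (rule ccontr)
    assume "\<not> measure \<nu> F < \<alpha>"
    then have "h \<le> measure m (F \<times> (space \<nu> - F))" using F2 by (intro exp Fs) auto
    also have "\<dots> \<le> c * (1/2)" using Fm F2 c by (smt (verit) mult_left_mono)
    finally show False using c h by simp
  qed
  let ?Y = "space \<nu> - F"
  have "expansion_domain \<nu> m ?Y (c / 2)"
    unfolding expansion_domain_def
  proof (intro conjI ballI impI)
    show "?Y \<in> sets \<nu>" by measurable
    show "0 < c / 2" using c by simp
    fix A assume A [measurable]: "A \<in> sets \<nu>" and AY: "A \<subseteq> ?Y" and A2: "2 * measure \<nu> A \<le> measure \<nu> ?Y"
    have half: "measure \<nu> A \<le> 1/2" using A2 prob_le_1[of ?Y] by linarith
    show "c / 2 * measure \<nu> A \<le> measure m (A \<times> (?Y - A))"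
    proof (cases "1/4 \<le> measure \<nu> A")
      case True
      have split: "A \<times> (space \<nu> - A) = A \<times> (?Y - A) \<union> A \<times> F" using AY sets.sets_into_space[OF Fs] by blast
      have "h1 \<le> measure m1 (A \<times> (space \<nu> - A))" by (rule exp1[OF A True half])
      also have "\<dots> \<le> measure m1 (A \<times> (?Y - A)) + measure m1 (A \<times> F)"
        unfolding split by (intro measure_Un_le m1.Times_in_sets_m) measurable
      also have "measure m1 (A \<times> F) \<le> C1 * measure \<nu> F"
      proof -
        have "emeasure m1 (A \<times> F) \<le> ennreal C1 * emeasure \<nu> F"
          unfolding m1.emeasure_m_swap[OF A Fs] by (rule m1.emeasure_m_le[OF Fs A])
        then show ?thesis
          using m1.C_pos by (simp add: emeasure_eq_measure m1.m.emeasure_eq_measure ennreal_mult[symmetric])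
      qed
      also have "C1 * measure \<nu> F \<le> C1 * \<alpha>" using F\<alpha> m1.C_pos by (intro mult_left_mono) auto
      also have "measure m1 (A \<times> (?Y - A)) \<le> measure m (A \<times> (?Y - A))"
        by (intro m1_le m.Times_in_sets_m) measurable
      finally have "h1 / 2 \<le> measure m (A \<times> (?Y - A))" using \<alpha>(3) by linarith
      moreover have "c / 2 * measure \<nu> A \<le> h1 / 2 * 1"
        using c half by (intro mult_mono) auto
      ultimately show ?thesis by simp
    next
      case False
      show ?thesis
      proof (rule ccontr)
        assume bad: "\<not> c / 2 * measure \<nu> A \<le> measure m (A \<times> (?Y - A))"
        let ?H = "A \<union> F"
        have H: "measure \<nu> ?H = measure \<nu> A + measure \<nu> F"
          using AY by (intro finite_measure_Union) auto
        have "?H \<times> (space \<nu> - ?H) \<subseteq> A \<times> (?Y - A) \<union> F \<times> (space \<nu> - F)" by blast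
        then have "measure m (?H \<times> (space \<nu> - ?H)) \<le> measure m (A \<times> (?Y - A) \<union> F \<times> (space \<nu> - F))"
          by (intro m.m.finite_measure_mono sets.Un m.Times_in_sets_m) measurable
        also have "\<dots> \<le> measure m (A \<times> (?Y - A)) + measure m (F \<times> (space \<nu> - F))"
          by (intro measure_Un_le m.Times_in_sets_m) measurable
        also have "\<dots> \<le> c * measure \<nu> A + c * measure \<nu> F"
        proof -
          have "c / 2 * measure \<nu> A \<le> c * measure \<nu> A" using c by (intro mult_right_mono) auto
          then show ?thesis using bad Fm by linarith
        qed
        finally have "?H \<in> \<B>"
          using False F\<alpha> \<alpha>(2) H by (auto simp: \<B>_def distrib_left)
        then have "measure \<nu> A = 0" using maxF[of ?H] H by auto
        then show False using bad by simp
      qed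
    qed
  qed
  moreover have "1 - \<alpha> \<le> measure \<nu> ?Y" using F\<alpha> prob_compl[OF Fs] by simp
  ultimately show ?thesis by (rule that[rotated])
qed

section \<open>The edge measures of a nonsingular action\<close>

context measured_action
begin

text \<open>The measure \<open>A \<mapsto> \<nu>(g A)\<close>; its density is the Jacobian of \<open>g\<close>.\<close>

definition pulled :: "'g \<Rightarrow> 'x measure" where
  "pulled g = distr \<nu> \<nu> (\<rho> (inv g))"

definition jacobian :: "'g \<Rightarrow> 'x \<Rightarrow> ennreal" where
  "jacobian g = RN_deriv \<nu> (pulled g)"

lemma jacobian_measurable [measurable]: "jacobian g \<in> borel_measurable \<nu>"
  by (simp add: jacobian_def)

lemma pulled_absolutely_continuous:
  assumes g: "g \<in> carrier G"
  shows "absolutely_continuous \<nu> (pulled g)"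
  unfolding absolutely_continuous_def
proof
  fix N assume N: "N \<in> null_sets \<nu>"
  have "\<rho> g ` N \<in> null_sets \<nu>" using nonsingular g N by (simp add: measure_class_preserving_def)
  moreover have "\<rho> (inv g) -` N = \<rho> g ` N" using act_image_eq[OF g] by simp
  ultimately show "N \<in> null_sets (pulled g)"
    using g N by (intro null_setsI) (auto simp: pulled_def emeasure_distr null_setsD1 null_setsD2)
qed

lemma change_of_variables:
  assumes g: "g \<in> carrier G" and [measurable]: "h \<in> borel_measurable \<nu>"
  shows "(\<integral>\<^sup>+y. h y \<partial>\<nu>) = (\<integral>\<^sup>+x. jacobian g x * h (\<rho> g x) \<partial>\<nu>)"
proof -
  have [measurable]: "\<rho> g \<in> measurable \<nu> \<nu>" "\<rho> (inv g) \<in> measurable \<nu> \<nu>" using g by auto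
  have "(\<integral>\<^sup>+y. h y \<partial>\<nu>) = (\<integral>\<^sup>+y. h (\<rho> g (\<rho> (inv g) y)) \<partial>\<nu>)" using g by simp
  also have "\<dots> = (\<integral>\<^sup>+x. h (\<rho> g x) \<partial>pulled g)"
    unfolding pulled_def by (rule nn_integral_distr[symmetric]) measurable
  also have "\<dots> = (\<integral>\<^sup>+x. jacobian g x * h (\<rho> g x) \<partial>\<nu>)"
    unfolding jacobian_def using g
    by (intro RN_deriv_nn_integral pulled_absolutely_continuous) (auto simp: pulled_def)
  finally show ?thesis .
qed

lemma nn_integral_jacobian: "g \<in> carrier G \<Longrightarrow> (\<integral>\<^sup>+x. jacobian g x \<partial>\<nu>) = 1"
  using change_of_variables[of g "\<lambda>_. 1"] emeasure_space_1 by simp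

lemma emeasure_image_eq:
  assumes g: "g \<in> carrier G" and D [measurable]: "D \<in> sets \<nu>"
  shows "emeasure \<nu> (\<rho> g ` D) = (\<integral>\<^sup>+x. jacobian g x * indicator D x \<partial>\<nu>)"
proof -
  have gD [measurable]: "\<rho> g ` D \<in> sets \<nu>" using g by measurable
  have "emeasure \<nu> (\<rho> g ` D) = (\<integral>\<^sup>+y. indicator (\<rho> g ` D) y \<partial>\<nu>)" by simp
  also have "\<dots> = (\<integral>\<^sup>+x. jacobian g x * indicator (\<rho> g ` D) (\<rho> g x) \<partial>\<nu>)"
    by (rule change_of_variables[OF g]) measurable
  also have "\<dots> = (\<integral>\<^sup>+x. jacobian g x * indicator D x \<partial>\<nu>)"
    using g by (intro nn_integral_cong) (auto simp: act_image_eq indicator_def)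
  finally show ?thesis .
qed

text \<open>The chain rule for \<open>g\<close> followed by its inverse: change variables twice.\<close>

lemma jacobian_inverse:
  assumes g: "g \<in> carrier G"
  shows "AE x in \<nu>. jacobian g x * jacobian (inv g) (\<rho> g x) = 1"
proof (rule density_unique_finite_measure)
  have g': "inv g \<in> carrier G" using g by simp
  have [measurable]: "\<rho> g \<in> measurable \<nu> \<nu>" "\<rho> (inv g) \<in> measurable \<nu> \<nu>" using g by auto
  show "(\<lambda>x. jacobian g x * jacobian (inv g) (\<rho> g x)) \<in> borel_measurable \<nu>" by measurable
  fix A assume [measurable]: "A \<in> sets \<nu>"
  have "(\<integral>\<^sup>+x. jacobian g x * jacobian (inv g) (\<rho> g x) * indicator A x \<partial>\<nu>)
      = (\<integral>\<^sup>+x. jacobian g x * (jacobian (inv g) (\<rho> g x) * indicator A (\<rho> (inv g) (\<rho> g x))) \<partial>\<nu>)"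
    using g by (simp add: mult.assoc)
  also have "\<dots> = (\<integral>\<^sup>+y. jacobian (inv g) y * indicator A (\<rho> (inv g) y) \<partial>\<nu>)"
    by (rule change_of_variables[OF g, symmetric]) measurable
  also have "\<dots> = (\<integral>\<^sup>+x. indicator A x \<partial>\<nu>)"
    by (rule change_of_variables[OF g', symmetric]) measurable
  finally show "(\<integral>\<^sup>+x. jacobian g x * jacobian (inv g) (\<rho> g x) * indicator A x \<partial>\<nu>)
      = (\<integral>\<^sup>+x. 1 * indicator A x \<partial>\<nu>)" by simp
qed auto

text \<open>The Jacobian may be unbounded; cutting it off at \<open>1\<close> keeps the degrees of the graph below
  bounded and, by \<open>weight_symmetric\<close>, its edge measure symmetric.\<close>

definition weight :: "'g \<Rightarrow> 'x \<Rightarrow> real" where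
  "weight g x = enn2real (min 1 (jacobian g x))"

lemma weight_measurable [measurable]: "weight g \<in> borel_measurable \<nu>"
  unfolding weight_def[abs_def] by measurable

lemma ennreal_weight: "ennreal (weight g x) = min 1 (jacobian g x)"
  unfolding weight_def by (rule ennreal_enn2real) (simp add: min_less_iff_disj)

lemma weight_bounds: "0 \<le> weight g x" "weight g x \<le> 1"
proof -
  show "0 \<le> weight g x" by (simp add: weight_def)
  have "ennreal (weight g x) \<le> ennreal 1" by (simp add: ennreal_weight)
  then show "weight g x \<le> 1" by (simp add: ennreal_le_iff2)
qed

text \<open>The measure \<open>min(1, J\<^sub>g) \<nu>\<close> is the largest measure that is below both \<open>\<nu>\<close> and its
  pullback, so \<open>g\<close> carries it to the measure of the same kind for the inverse of \<open>g\<close>.\<close>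

lemma weight_symmetric:
  assumes g: "g \<in> carrier G" and [measurable]: "h \<in> borel_measurable \<nu>"
  shows "(\<integral>\<^sup>+x. ennreal (weight g x) * h x \<partial>\<nu>) =
    (\<integral>\<^sup>+y. ennreal (weight (inv g) y) * h (\<rho> (inv g) y) \<partial>\<nu>)"
proof -
  have [measurable]: "\<rho> g \<in> measurable \<nu> \<nu>" "\<rho> (inv g) \<in> measurable \<nu> \<nu>" using g by auto
  have min_mult: "a * min 1 b = min a (a * b)" for a b :: ennreal
    using mult_left_mono[of 1 b a] mult_left_mono[of b 1 a]
    by (cases "1 \<le> b") (auto simp: min_def intro: antisym)
  have "(\<integral>\<^sup>+y. ennreal (weight (inv g) y) * h (\<rho> (inv g) y) \<partial>\<nu>)
      = (\<integral>\<^sup>+x. jacobian g x * (ennreal (weight (inv g) (\<rho> g x)) * h (\<rho> (inv g) (\<rho> g x))) \<partial>\<nu>)"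
    by (rule change_of_variables[OF g]) measurable
  also have "\<dots> = (\<integral>\<^sup>+x. ennreal (weight g x) * h x \<partial>\<nu>)"
  proof (rule nn_integral_cong_AE)
    show "AE x in \<nu>. jacobian g x * (ennreal (weight (inv g) (\<rho> g x)) * h (\<rho> (inv g) (\<rho> g x)))
        = ennreal (weight g x) * h x"
      using jacobian_inverse[OF g]
      by eventually_elim
        (use g in \<open>simp add: ennreal_weight min_mult mult.assoc[symmetric] min.commute\<close>)
  qed
  finally show ?thesis by simp
qed

text \<open>Every point is joined to its translates by the elements of the ball of radius \<open>k\<close>, one edge for
  each element.\<close>

definition edges :: "nat \<Rightarrow> ('x \<times> 'x) measure" where
  "edges k = distr (density (count_space (length_ball G l k) \<Otimes>\<^sub>M \<nu>) (\<lambda>(g, x). ennreal (weight g x)))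
     (\<nu> \<Otimes>\<^sub>M \<nu>) (\<lambda>(g, x). (x, \<rho> g x))"

lemma nn_integral_edges:
  assumes h [measurable]: "h \<in> borel_measurable (\<nu> \<Otimes>\<^sub>M \<nu>)"
  shows "(\<integral>\<^sup>+z. h z \<partial>edges k) =
    (\<Sum>g\<in>length_ball G l k. \<integral>\<^sup>+x. ennreal (weight g x) * h (x, \<rho> g x) \<partial>\<nu>)"
proof -
  let ?B = "length_ball G l k" and ?P = "count_space (length_ball G l k) \<Otimes>\<^sub>M \<nu>"
  have cB: "countable ?B" by (intro countable_finite finite_ball)
  have [measurable]: "(\<lambda>(g, x). ennreal (weight g x)) \<in> borel_measurable ?P"
    by (rule measurable_pair_measure_countable1[OF cB]) simp
  have [measurable]: "(\<lambda>(g, x). (x, \<rho> g x)) \<in> measurable ?P (\<nu> \<Otimes>\<^sub>M \<nu>)"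
    by (rule measurable_pair_measure_countable1[OF cB]) (auto dest!: ball_carrier intro: measurable_Pair)
  have "(\<integral>\<^sup>+z. h z \<partial>edges k) = (\<integral>\<^sup>+w. (case w of (g, x) \<Rightarrow> ennreal (weight g x)) *
      h (case w of (g, x) \<Rightarrow> (x, \<rho> g x)) \<partial>?P)"
    unfolding edges_def by (subst nn_integral_distr) (auto simp: nn_integral_density)
  also have "\<dots> = (\<integral>\<^sup>+g. (\<integral>\<^sup>+x. ennreal (weight g x) * h (x, \<rho> g x) \<partial>\<nu>) \<partial>count_space ?B)"
    by (subst nn_integral_fst[symmetric]) auto
  also have "\<dots> = (\<Sum>g\<in>?B. \<integral>\<^sup>+x. ennreal (weight g x) * h (x, \<rho> g x) \<partial>\<nu>)"
    by (simp add: nn_integral_count_space_finite)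
  finally show ?thesis .
qed

lemma ball_inv_bij: "bij_betw (\<lambda>g. inv g) (length_ball G l k) (length_ball G l k)"
  by (rule bij_betw_byWitness[where f' = "\<lambda>g. inv g"]) (auto simp: length_ball_def)

lemma card_ball_pos: "0 < card (length_ball G l k)"
  using one_in_ball[of k] by (auto simp: card_gt_0_iff)

lemma symmetric_edges_edges: "symmetric_edges \<nu> (edges k) (real (card (length_ball G l k)))"
proof
  let ?B = "length_ball G l k"
  show "sets (edges k) = sets (\<nu> \<Otimes>\<^sub>M \<nu>)" by (simp add: edges_def)
  show "0 < real (card ?B)" using card_ball_pos by simp
  fix h :: "'x \<times> 'x \<Rightarrow> ennreal" assume [measurable]: "h \<in> borel_measurable (\<nu> \<Otimes>\<^sub>M \<nu>)"
  have [measurable]: "\<rho> g \<in> measurable \<nu> \<nu>" if "g \<in> ?B" for g using that ball_carrier by auto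
  have "(\<integral>\<^sup>+(x, y). h (y, x) \<partial>edges k) = (\<Sum>g\<in>?B. \<integral>\<^sup>+x. ennreal (weight g x) * h (\<rho> g x, x) \<partial>\<nu>)"
    by (subst nn_integral_edges) auto
  also have "\<dots> = (\<Sum>g\<in>?B. \<integral>\<^sup>+y. ennreal (weight (inv g) y) * h (y, \<rho> (inv g) y) \<partial>\<nu>)"
  proof (rule sum.cong[OF refl])
    fix g assume g: "g \<in> ?B"
    have "(\<integral>\<^sup>+x. ennreal (weight g x) * h (\<rho> g x, x) \<partial>\<nu>)
        = (\<integral>\<^sup>+y. ennreal (weight (inv g) y) * h (\<rho> g (\<rho> (inv g) y), \<rho> (inv g) y) \<partial>\<nu>)"
      using g by (intro weight_symmetric[of g "\<lambda>x. h (\<rho> g x, x)"] ball_carrier) measurable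
    then show "(\<integral>\<^sup>+x. ennreal (weight g x) * h (\<rho> g x, x) \<partial>\<nu>)
        = (\<integral>\<^sup>+y. ennreal (weight (inv g) y) * h (y, \<rho> (inv g) y) \<partial>\<nu>)"
      using ball_carrier[OF g] by simp
  qed
  also have "\<dots> = (\<Sum>g\<in>?B. \<integral>\<^sup>+y. ennreal (weight g y) * h (y, \<rho> g y) \<partial>\<nu>)"
    by (rule sum.reindex_bij_betw[OF ball_inv_bij])
  also have "\<dots> = (\<integral>\<^sup>+(x, y). h (x, y) \<partial>edges k)"
    by (subst nn_integral_edges) auto
  finally show "(\<integral>\<^sup>+(x, y). h (x, y) \<partial>edges k) = (\<integral>\<^sup>+(x, y). h (y, x) \<partial>edges k)" by simp
next
  let ?B = "length_ball G l k"
  fix h :: "'x \<Rightarrow> ennreal" assume [measurable]: "h \<in> borel_measurable \<nu>"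
  have "(\<integral>\<^sup>+(x, y). h x \<partial>edges k) = (\<Sum>g\<in>?B. \<integral>\<^sup>+x. ennreal (weight g x) * h x \<partial>\<nu>)"
    by (subst nn_integral_edges) auto
  also have "\<dots> \<le> (\<Sum>g\<in>?B. \<integral>\<^sup>+x. h x \<partial>\<nu>)"
    using weight_bounds
    by (intro sum_mono nn_integral_mono) (metis ennreal_le_1 mult_right_mono mult_1 zero_le)
  also have "\<dots> = ennreal (real (card ?B)) * (\<integral>\<^sup>+x. h x \<partial>\<nu>)" by (simp add: ennreal_of_nat_eq_real_of_nat)
  finally show "(\<integral>\<^sup>+(x, y). h x \<partial>edges k) \<le> ennreal (real (card ?B)) * (\<integral>\<^sup>+x. h x \<partial>\<nu>)" .
qed

lemma edges_mono:
  assumes "k \<le> k'" "E \<in> sets (\<nu> \<Otimes>\<^sub>M \<nu>)"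
  shows "measure (edges k) E \<le> measure (edges k') E"
proof -
  interpret k: symmetric_edges \<nu> "edges k" "real (card (length_ball G l k))" by (rule symmetric_edges_edges)
  interpret k': symmetric_edges \<nu> "edges k'" "real (card (length_ball G l k'))" by (rule symmetric_edges_edges)
  have eq: "emeasure (edges j) E = (\<Sum>g\<in>length_ball G l j. \<integral>\<^sup>+x. ennreal (weight g x) * indicator E (x, \<rho> g x) \<partial>\<nu>)" for j
    using nn_integral_edges[of "indicator E" j] assms(2) by (simp add: edges_def)
  have "emeasure (edges k) E \<le> emeasure (edges k') E"
    unfolding eq using assms(1) by (intro sum_mono2 finite_ball) (auto simp: length_ball_def)
  then show ?thesis by (simp add: k.m.emeasure_eq_measure k'.m.emeasure_eq_measure)
qed

lemma jacobian_tail: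
  assumes g: "g \<in> carrier G" and \<eta>: "0 < \<eta>"
  obtains \<Theta> :: nat where "1 \<le> \<Theta>"
    "(\<integral>\<^sup>+x. jacobian g x * indicator {x. of_nat \<Theta> < jacobian g x} x \<partial>\<nu>) < ennreal \<eta>"
proof -
  have [measurable]: "{x. of_nat n < jacobian g x} \<in> sets \<nu>" for n :: nat
  proof -
    have "{x \<in> space \<nu>. of_nat n < jacobian g x} \<in> sets \<nu>" by measurable
    then show ?thesis by simp
  qed
  have fin: "AE x in \<nu>. jacobian g x \<noteq> \<infinity>"
    using nn_integral_jacobian[OF g] by (intro nn_integral_PInf_AE) auto
  have "(\<lambda>n. \<integral>\<^sup>+x. jacobian g x * indicator {x. of_nat n < jacobian g x} x \<partial>\<nu>) \<longlonglongrightarrow> (\<integral>\<^sup>+x. 0 \<partial>\<nu>)"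
  proof (rule nn_integral_dominated_convergence[where w = "jacobian g"])
    show "AE x in \<nu>. (\<lambda>n. jacobian g x * indicator {x. of_nat n < jacobian g x} x) \<longlonglongrightarrow> 0"
      using fin
    proof eventually_elim
      fix x assume "jacobian g x \<noteq> \<infinity>"
      then obtain N :: nat where N: "jacobian g x < of_nat N"
        using ennreal_Ex_less_of_nat[of "jacobian g x"] by (auto simp: less_top)
      have "jacobian g x * indicator {x. of_nat n < jacobian g x} x = 0" if "N \<le> n" for n
      proof -
        have "(of_nat N :: ennreal) \<le> of_nat n" using that by simp
        then have "\<not> of_nat n < jacobian g x" using less_le_trans[OF N] by (meson less_asym)
        then show ?thesis by simp
      qed
      then have "eventually (\<lambda>n. jacobian g x * indicator {x. of_nat n < jacobian g x} x = 0) sequentially"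
        by (rule eventually_sequentiallyI)
      then show "(\<lambda>n. jacobian g x * indicator {x. of_nat n < jacobian g x} x) \<longlonglongrightarrow> 0"
        by (rule tendsto_eventually)
    qed
    show "AE x in \<nu>. jacobian g x * indicator {x. of_nat j < jacobian g x} x \<le> jacobian g x" for j
      by (auto simp: indicator_def)
    show "(\<integral>\<^sup>+x. jacobian g x \<partial>\<nu>) < \<infinity>" using nn_integral_jacobian[OF g] by simp
  qed simp_all
  then have "eventually (\<lambda>n. (\<integral>\<^sup>+x. jacobian g x * indicator {x. of_nat n < jacobian g x} x \<partial>\<nu>) < ennreal \<eta>) sequentially"
    using \<eta> by (intro order_tendstoD(2)[of _ 0]) auto
  then have "eventually (\<lambda>n. (\<integral>\<^sup>+x. jacobian g x * indicator {x. of_nat n < jacobian g x} x \<partial>\<nu>) < ennreal \<eta> \<and> 1 \<le> n) sequentially"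
    using eventually_ge_at_top[of 1] by (rule eventually_conj)
  then show ?thesis using that by (auto dest: eventually_happens)
qed

text \<open>If \<open>B\<^sub>k \<cdot> A\<close> is larger than \<open>A\<close> by a fixed factor, some \<open>g\<close> in the ball moves a part \<open>D\<close> of \<open>A\<close> onto a set of
  definite measure outside \<open>A\<close>. The integral of the Jacobian over \<open>D\<close> is the measure of that set, and it is
  controlled by the integral of \<open>min 1 J\<close>: below a level \<open>\<Theta>\<close> because \<open>J \<le> \<Theta> min 1 J\<close>, and above it
  because the Jacobian is integrable. The balls being finite, one bound serves all \<open>g\<close>.\<close>

lemma edge_expansion:
  assumes ae: "asymptotically_expanding G l \<nu> \<rho>" and \<alpha>: "0 < \<alpha>" "\<alpha> \<le> 1/2"
  obtains k h where "0 < h"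
    "\<And>A. A \<in> sets \<nu> \<Longrightarrow> \<alpha> \<le> measure \<nu> A \<Longrightarrow> measure \<nu> A \<le> 1/2 \<Longrightarrow>
      h \<le> measure (edges k) (A \<times> (space \<nu> - A))"
proof -
  obtain c k where c: "0 < c" and ck: "\<And>A. A \<in> sets \<nu> \<Longrightarrow> \<alpha> \<le> measure \<nu> A \<Longrightarrow> measure \<nu> A \<le> 1/2 \<Longrightarrow>
      measure \<nu> (act_on_set \<rho> (length_ball G l k) A) > (1 + c) * measure \<nu> A"
    using ae \<alpha> unfolding asymptotically_expanding_def by meson
  let ?B = "length_ball G l k"
  interpret k: symmetric_edges \<nu> "edges k" "real (card ?B)" by (rule symmetric_edges_edges)
  define \<eta> where "\<eta> = c * \<alpha> / real (card ?B)"
  have \<eta>: "0 < \<eta>" using c \<alpha> card_ball_pos by (simp add: \<eta>_def)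
  have "\<forall>g\<in>?B. \<exists>\<Theta>::nat. 1 \<le> \<Theta> \<and>
      (\<integral>\<^sup>+x. jacobian g x * indicator {x. of_nat \<Theta> < jacobian g x} x \<partial>\<nu>) < ennreal (\<eta> / 2)"
  proof
    fix g assume "g \<in> ?B"
    then have g: "g \<in> carrier G" by (rule ball_carrier)
    show "\<exists>\<Theta>::nat. 1 \<le> \<Theta> \<and> (\<integral>\<^sup>+x. jacobian g x * indicator {x. of_nat \<Theta> < jacobian g x} x \<partial>\<nu>) < ennreal (\<eta> / 2)"
      using jacobian_tail[OF g, of "\<eta> / 2"] \<eta> by auto
  qed
  then obtain \<Theta> :: "'g \<Rightarrow> nat" where \<Theta>: "\<And>g. g \<in> ?B \<Longrightarrow> 1 \<le> \<Theta> g"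
    "\<And>g. g \<in> ?B \<Longrightarrow> (\<integral>\<^sup>+x. jacobian g x * indicator {x. of_nat (\<Theta> g) < jacobian g x} x \<partial>\<nu>) < ennreal (\<eta> / 2)"
    by metis
  define h where "h = Min ((\<lambda>g. \<eta> / 2 / real (\<Theta> g)) ` ?B)"
  have ne: "?B \<noteq> {}" using one_in_ball by blast
  have \<Theta>pos: "0 < \<Theta> g" if "g \<in> ?B" for g using \<Theta>(1)[OF that] by simp
  have "0 < h" unfolding h_def using \<eta> \<Theta>pos ne by auto
  moreover have "h \<le> measure (edges k) (A \<times> (space \<nu> - A))"
    if A [measurable]: "A \<in> sets \<nu>" and \<alpha>A: "\<alpha> \<le> measure \<nu> A" and A2: "measure \<nu> A \<le> 1/2" for A
  proof -
    have "\<exists>g\<in>?B. \<eta> \<le> measure \<nu> (\<rho> g ` A - A)"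
    proof (rule ccontr)
      assume "\<not> ?thesis"
      then have small: "measure \<nu> (\<rho> g ` A - A) < \<eta>" if "g \<in> ?B" for g using that by force
      have gA: "\<rho> g ` A - A \<in> sets \<nu>" if "g \<in> ?B" for g using ball_carrier[OF that] by measurable
      let ?BA = "act_on_set \<rho> ?B A"
      have "measure \<nu> ?BA \<le> measure \<nu> (A \<union> (\<Union>g\<in>?B. \<rho> g ` A - A))"
        using gA by (intro finite_measure_mono sets.Un sets.finite_UN finite_ball A)
          (auto simp: act_on_set_def)
      also have "\<dots> \<le> measure \<nu> A + measure \<nu> (\<Union>g\<in>?B. \<rho> g ` A - A)"
        using gA by (intro measure_Un_le sets.finite_UN finite_ball A) auto
      also have "measure \<nu> (\<Union>g\<in>?B. \<rho> g ` A - A) \<le> (\<Sum>g\<in>?B. measure \<nu> (\<rho> g ` A - A))"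
        using gA by (intro finite_measure_subadditive_finite) auto
      also have "\<dots> \<le> (\<Sum>g\<in>?B. \<eta>)" using small by (intro sum_mono less_imp_le)
      also have "\<dots> = c * \<alpha>" using ne by (simp add: \<eta>_def)
      also have "\<dots> \<le> c * measure \<nu> A" using c \<alpha>A by simp
      finally show False using ck[OF A \<alpha>A A2] by (simp add: distrib_right)
    qed
    then obtain g where g: "g \<in> ?B" and \<eta>g: "\<eta> \<le> measure \<nu> (\<rho> g ` A - A)" by blast
    have gG: "g \<in> carrier G" by (rule ball_carrier[OF g])
    have [measurable]: "\<rho> g \<in> measurable \<nu> \<nu>" using gG by simp
    define D where "D = {x \<in> space \<nu>. x \<in> A \<and> \<rho> g x \<notin> A}"
    have D [measurable]: "D \<in> sets \<nu>" unfolding D_def by measurable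
    have "\<rho> g ` D = \<rho> g ` A - A" by (auto simp: D_def)
    then have "ennreal \<eta> \<le> emeasure \<nu> (\<rho> g ` D)" using \<eta>g by (simp add: emeasure_eq_measure ennreal_leI)
    also have "\<dots> = (\<integral>\<^sup>+x. jacobian g x * indicator D x \<partial>\<nu>)" by (rule emeasure_image_eq[OF gG D])
    also have "\<dots> \<le> (\<integral>\<^sup>+x. of_nat (\<Theta> g) * (ennreal (weight g x) * indicator D x) +
        jacobian g x * indicator {x. of_nat (\<Theta> g) < jacobian g x} x \<partial>\<nu>)"
    proof (rule nn_integral_mono)
      fix x
      have one: "(1::ennreal) \<le> of_nat (\<Theta> g)" using \<Theta>(1)[OF g] by (metis of_nat_1 of_nat_mono)
      have "jacobian g x \<le> of_nat (\<Theta> g) * min 1 (jacobian g x)" if "\<not> of_nat (\<Theta> g) < jacobian g x"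
      proof (cases "jacobian g x \<le> 1")
        case True
        then show ?thesis using mult_right_mono[OF one, of "jacobian g x"] by (simp add: min_absorb2)
      next
        case False
        then show ?thesis using that by (simp add: min_absorb1 not_less)
      qed
      then show "jacobian g x * indicator D x \<le> of_nat (\<Theta> g) * (ennreal (weight g x) * indicator D x) +
          jacobian g x * indicator {x. of_nat (\<Theta> g) < jacobian g x} x"
        by (auto simp: ennreal_weight indicator_def)
    qed
    also have "\<dots> = of_nat (\<Theta> g) * (\<integral>\<^sup>+x. ennreal (weight g x) * indicator D x \<partial>\<nu>) +
        (\<integral>\<^sup>+x. jacobian g x * indicator {x. of_nat (\<Theta> g) < jacobian g x} x \<partial>\<nu>)"
      by (subst nn_integral_add) (auto simp: nn_integral_cmult)
    also have "\<dots> \<le> of_nat (\<Theta> g) * (\<integral>\<^sup>+x. ennreal (weight g x) * indicator D x \<partial>\<nu>) + ennreal (\<eta> / 2)"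
      by (intro add_left_mono less_imp_le \<Theta>(2) g)
    also have "(\<integral>\<^sup>+x. ennreal (weight g x) * indicator D x \<partial>\<nu>) \<le> emeasure (edges k) (A \<times> (space \<nu> - A))"
    proof -
      have E: "A \<times> (space \<nu> - A) \<in> sets (\<nu> \<Otimes>\<^sub>M \<nu>)" by measurable
      have "(\<integral>\<^sup>+x. ennreal (weight g x) * indicator D x \<partial>\<nu>)
          = (\<integral>\<^sup>+x. ennreal (weight g x) * indicator (A \<times> (space \<nu> - A)) (x, \<rho> g x) \<partial>\<nu>)"
        by (intro nn_integral_cong) (auto simp: D_def indicator_def)
      also have "\<dots> \<le> (\<Sum>g\<in>?B. \<integral>\<^sup>+x. ennreal (weight g x) * indicator (A \<times> (space \<nu> - A)) (x, \<rho> g x) \<partial>\<nu>)"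
        using g by (intro member_le_sum finite_ball) auto
      also have "\<dots> = (\<integral>\<^sup>+z. indicator (A \<times> (space \<nu> - A)) z \<partial>edges k)"
        using E by (intro nn_integral_edges[symmetric]) simp
      finally show ?thesis using E by (simp add: k.sets_m)
    qed
    finally have "ennreal \<eta> \<le> of_nat (\<Theta> g) * emeasure (edges k) (A \<times> (space \<nu> - A)) + ennreal (\<eta> / 2)"
      by (simp add: mult_left_mono)
    then have "ennreal \<eta> \<le> ennreal (real (\<Theta> g) * measure (edges k) (A \<times> (space \<nu> - A)) + \<eta> / 2)"
      using \<eta> by (simp add: k.m.emeasure_eq_measure ennreal_of_nat_eq_real_of_nat ennreal_mult ennreal_plus)
    then have "\<eta> \<le> real (\<Theta> g) * measure (edges k) (A \<times> (space \<nu> - A)) + \<eta> / 2"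
      using \<eta> by (subst (asm) ennreal_le_iff) auto
    then have "\<eta> / 2 / real (\<Theta> g) \<le> measure (edges k) (A \<times> (space \<nu> - A))"
      using \<Theta>pos[OF g] by (simp add: field_simps)
    moreover have "h \<le> \<eta> / 2 / real (\<Theta> g)" unfolding h_def using g by (intro Min_le) auto
    ultimately show ?thesis by simp
  qed
  ultimately show ?thesis using that by blast
qed

end

section \<open>Restriction of edge measures and integrals over edges\<close>

context symmetric_edges
begin

text \<open>Keeping only the measure on \<open>Y\<close> and the edges inside \<open>Y\<close> makes Cheeger's inequality applicable to
  a domain of expansion.\<close>

lemma restrict_edges:
  assumes Y [measurable]: "Y \<in> sets N"
  shows "symmetric_edges (density N (indicator Y)) (density m (indicator (Y \<times> Y))) C"
proof (intro symmetric_edges.intro symmetric_edges_axioms.intro)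
  have YY [measurable]: "Y \<times> Y \<in> sets m" using Y by (intro Times_in_sets_m)
  have sets_eq: "sets (density N (indicator Y) \<Otimes>\<^sub>M density N (indicator Y)) = sets (N \<Otimes>\<^sub>M N)"
    by (rule sets_pair_measure_cong) auto
  have "emeasure (density N (indicator Y)) (space N) = emeasure N Y"
    using sets.sets_into_space[OF Y] by (subst emeasure_density) (auto simp: Int_absorb1 simp flip: nn_integral_indicator
      intro!: nn_integral_cong split: split_indicator)
  then show "finite_measure (density N (indicator Y))" by (intro finite_measureI) simp
  show "sets (density m (indicator (Y \<times> Y))) = sets (density N (indicator Y) \<Otimes>\<^sub>M density N (indicator Y))"
    unfolding sets_eq by (simp add: sets_m)
  show "0 < C" by (rule C_pos)
  {
    fix h :: "'a \<times> 'a \<Rightarrow> ennreal"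
    assume "h \<in> borel_measurable (density N (indicator Y) \<Otimes>\<^sub>M density N (indicator Y))"
    then have h [measurable]: "h \<in> borel_measurable (N \<Otimes>\<^sub>M N)"
      by (simp add: measurable_cong_sets[OF sets_eq refl])
    have "(\<integral>\<^sup>+(x, y). h (x, y) \<partial>density m (indicator (Y \<times> Y)))
        = (\<integral>\<^sup>+(x, y). indicator (Y \<times> Y) (x, y) * h (x, y) \<partial>m)"
      by (subst nn_integral_density) (auto simp: case_prod_unfold)
    also have "\<dots> = (\<integral>\<^sup>+(x, y). indicator (Y \<times> Y) (y, x) * h (y, x) \<partial>m)"
      by (rule swap) measurable
    also have "\<dots> = (\<integral>\<^sup>+(x, y). h (y, x) \<partial>density m (indicator (Y \<times> Y)))"
      by (subst nn_integral_density) (auto simp: case_prod_unfold indicator_def intro!: nn_integral_cong)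
    finally show "(\<integral>\<^sup>+(x, y). h (x, y) \<partial>density m (indicator (Y \<times> Y)))
        = (\<integral>\<^sup>+(x, y). h (y, x) \<partial>density m (indicator (Y \<times> Y)))" .
  }
  fix h :: "'a \<Rightarrow> ennreal"
  assume "h \<in> borel_measurable (density N (indicator Y))"
  then have h [measurable]: "h \<in> borel_measurable N" by simp
  have "(\<integral>\<^sup>+(x, y). h x \<partial>density m (indicator (Y \<times> Y))) = (\<integral>\<^sup>+z. indicator (Y \<times> Y) z * h (fst z) \<partial>m)"
    by (subst nn_integral_density) (auto simp: case_prod_unfold)
  also have "\<dots> \<le> (\<integral>\<^sup>+(x, y). indicator Y x * h x \<partial>m)"
    by (intro nn_integral_mono) (auto simp: indicator_def)
  also have "\<dots> \<le> ennreal C * (\<integral>\<^sup>+x. indicator Y x * h x \<partial>N)" by (rule marginal) measurable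
  also have "(\<integral>\<^sup>+x. indicator Y x * h x \<partial>N) = (\<integral>\<^sup>+x. h x \<partial>density N (indicator Y))"
    by (subst nn_integral_density) auto
  finally show "(\<integral>\<^sup>+(x, y). h x \<partial>density m (indicator (Y \<times> Y))) \<le> ennreal C * (\<integral>\<^sup>+x. h x \<partial>density N (indicator Y))" .
qed

lemma distr_swap: "distr m m (\<lambda>z. (snd z, fst z)) = m"
proof (rule measure_eqI)
  have sw: "(\<lambda>z. (snd z, fst z)) \<in> measurable m m"
    unfolding measurable_cong_sets[OF sets_m sets_m] by measurable
  fix E assume "E \<in> sets (distr m m (\<lambda>z. (snd z, fst z)))"
  then have E: "E \<in> sets m" by simp
  then have E' [measurable]: "E \<in> sets (N \<Otimes>\<^sub>M N)" by (simp add: sets_m)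
  have "emeasure (distr m m (\<lambda>z. (snd z, fst z))) E = (\<integral>\<^sup>+z. indicator E z \<partial>distr m m (\<lambda>z. (snd z, fst z)))"
    using E by simp
  also have "\<dots> = (\<integral>\<^sup>+(x, y). indicator E (y, x) \<partial>m)"
    using E by (subst nn_integral_distr[OF sw]) (auto simp: case_prod_unfold)
  also have "\<dots> = (\<integral>\<^sup>+(x, y). indicator E (x, y) \<partial>m)"
    by (rule swap[symmetric]) measurable
  finally show "emeasure (distr m m (\<lambda>z. (snd z, fst z))) E = emeasure m E"
    using E by (simp add: case_prod_unfold)
qed simp

lemma integral_swap:
  fixes h :: "'a \<times> 'a \<Rightarrow> real"
  assumes [measurable]: "h \<in> borel_measurable (N \<Otimes>\<^sub>M N)"
  shows "(LINT z|m. h (snd z, fst z)) = (LINT z|m. h z)"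
    and "integrable m h \<Longrightarrow> integrable m (\<lambda>z. h (snd z, fst z))"
proof -
  have sw: "(\<lambda>z. (snd z, fst z)) \<in> measurable m m"
    unfolding measurable_cong_sets[OF sets_m sets_m] by measurable
  have h: "h \<in> borel_measurable m" by measurable
  show "(LINT z|m. h (snd z, fst z)) = (LINT z|m. h z)"
    using integral_distr[OF sw h] by (simp add: distr_swap)
  show "integrable m (\<lambda>z. h (snd z, fst z))" if "integrable m h"
    using integrable_distr_eq[OF sw h] that by (simp add: distr_swap)
qed

lemma integrable_marginals:
  fixes f :: "'a \<Rightarrow> real"
  assumes [measurable]: "f \<in> borel_measurable N" and f: "integrable N (\<lambda>x. (f x)\<^sup>2)"
  shows "integrable m (\<lambda>z. (f (fst z))\<^sup>2)" "integrable m (\<lambda>z. (f (snd z))\<^sup>2)"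
    "integrable m (\<lambda>z. f (fst z) * f (snd z))"
proof -
  have "(\<integral>\<^sup>+x. ennreal ((f x)\<^sup>2) \<partial>N) < \<infinity>"
    using f by (simp add: integrable_iff_bounded)
  then have fin: "ennreal C * (\<integral>\<^sup>+x. ennreal ((f x)\<^sup>2) \<partial>N) < \<infinity>" by (simp add: ennreal_mult_less_top)
  show 1: "integrable m (\<lambda>z. (f (fst z))\<^sup>2)"
    using order.strict_trans1[OF marginal[of "\<lambda>x. ennreal ((f x)\<^sup>2)"] fin]
    by (intro integrableI_bounded) (measurable, simp add: case_prod_unfold)
  show 2: "integrable m (\<lambda>z. (f (snd z))\<^sup>2)"
    using order.strict_trans1[OF marginal2[of "\<lambda>x. ennreal ((f x)\<^sup>2)"] fin]
    by (intro integrableI_bounded) (measurable, simp add: case_prod_unfold)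
  show "integrable m (\<lambda>z. f (fst z) * f (snd z))"
  proof (rule Bochner_Integration.integrable_bound[OF Bochner_Integration.integrable_add[OF 1 2]])
    show "(\<lambda>z. f (fst z) * f (snd z)) \<in> borel_measurable m" by measurable
    show "AE z in m. norm (f (fst z) * f (snd z)) \<le> norm ((f (fst z))\<^sup>2 + (f (snd z))\<^sup>2)"
    proof (rule AE_I2)
      fix z
      have "2 * (\<bar>f (fst z)\<bar> * \<bar>f (snd z)\<bar>) \<le> (f (fst z))\<^sup>2 + (f (snd z))\<^sup>2"
        using sum_squares_bound[of "\<bar>f (fst z)\<bar>" "\<bar>f (snd z)\<bar>"] by simp
      moreover have "0 \<le> \<bar>f (fst z)\<bar> * \<bar>f (snd z)\<bar>" by simp
      ultimately have "\<bar>f (fst z)\<bar> * \<bar>f (snd z)\<bar> \<le> (f (fst z))\<^sup>2 + (f (snd z))\<^sup>2" by linarith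
      then show "norm (f (fst z) * f (snd z)) \<le> norm ((f (fst z))\<^sup>2 + (f (snd z))\<^sup>2)"
        by (simp add: abs_mult)
    qed
  qed
qed

end

section \<open>The random walk on a domain of expansion\<close>

context measured_action
begin

definition sq_integrable :: "('x \<Rightarrow> real) \<Rightarrow> bool" where
  "sq_integrable f \<longleftrightarrow> f \<in> borel_measurable \<nu> \<and> integrable \<nu> (\<lambda>x. (f x)\<^sup>2)"

lemma sq_integrable_measurable: "sq_integrable f \<Longrightarrow> f \<in> borel_measurable \<nu>"
  by (simp add: sq_integrable_def)

lemma sq_integrable_integrable: "sq_integrable f \<Longrightarrow> integrable \<nu> f"
  unfolding sq_integrable_def using square_integrable_imp_integrable by blast

lemma sq_integrable_add:
  assumes "sq_integrable f" "sq_integrable g"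
  shows "sq_integrable (\<lambda>x. f x + g x)"
proof -
  have [measurable]: "f \<in> borel_measurable \<nu>" "g \<in> borel_measurable \<nu>"
    using assms by (auto simp: sq_integrable_def)
  have "integrable \<nu> (\<lambda>x. 2 * (f x)\<^sup>2 + 2 * (g x)\<^sup>2)" using assms by (auto simp: sq_integrable_def)
  then have "integrable \<nu> (\<lambda>x. (f x + g x)\<^sup>2)"
    by (rule Bochner_Integration.integrable_bound)
      (use norm_add_sq_le[of "f _" "g _"] in \<open>auto intro!: AE_I2\<close>)
  then show ?thesis by (simp add: sq_integrable_def)
qed

lemma sq_integrable_cmult: "sq_integrable f \<Longrightarrow> sq_integrable (\<lambda>x. c * f x)"
  by (auto simp: sq_integrable_def power_mult_distrib)

lemma sq_integrable_diff:
  assumes "sq_integrable f" "sq_integrable g"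
  shows "sq_integrable (\<lambda>x. f x - g x)"
  using sq_integrable_add[OF assms(1) sq_integrable_cmult[OF assms(2), of "-1"]] by simp

lemma sq_integrable_const: "sq_integrable (\<lambda>x. c)"
  by (simp add: sq_integrable_def)

lemma sq_integrable_mult:
  assumes "sq_integrable f" "sq_integrable g"
  shows "integrable \<nu> (\<lambda>x. f x * g x)"
proof -
  have "integrable \<nu> (\<lambda>x. ((f x + g x)\<^sup>2 - (f x)\<^sup>2 - (g x)\<^sup>2) / 2)"
    using sq_integrable_add[OF assms] assms by (auto simp: sq_integrable_def)
  then show ?thesis by (simp add: power2_sum)
qed

lemma sq_integrable_indicator:
  assumes "sq_integrable f" "Y \<in> sets \<nu>"
  shows "sq_integrable (\<lambda>x. indicator Y x * f x)"
proof -
  have [measurable]: "f \<in> borel_measurable \<nu>" "Y \<in> sets \<nu>" using assms by (auto simp: sq_integrable_def)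
  have "integrable \<nu> (\<lambda>x. indicator Y x *\<^sub>R (f x)\<^sup>2)"
    using assms by (intro integrable_mult_indicator) (auto simp: sq_integrable_def)
  moreover have "indicator Y x *\<^sub>R (f x)\<^sup>2 = (indicator Y x * f x)\<^sup>2" for x by (auto simp: indicator_def)
  ultimately show ?thesis by (simp add: sq_integrable_def)
qed

lemma integral_edges:
  fixes h :: "'x \<times> 'x \<Rightarrow> real"
  assumes [measurable]: "h \<in> borel_measurable (\<nu> \<Otimes>\<^sub>M \<nu>)" and h: "integrable (edges k) h"
  shows "g \<in> length_ball G l k \<Longrightarrow> integrable \<nu> (\<lambda>x. weight g x * h (x, \<rho> g x))"
    and "(LINT z|edges k. h z) = (\<Sum>g\<in>length_ball G l k. LINT x|\<nu>. weight g x * h (x, \<rho> g x))"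
proof -
  let ?B = "length_ball G l k"
  have act: "\<rho> g \<in> measurable \<nu> \<nu>" if "g \<in> ?B" for g using that ball_carrier by auto
  have m: "(\<lambda>x. weight g x * h (x, \<rho> g x)) \<in> borel_measurable \<nu>" if "g \<in> ?B" for g
    using act[OF that] by measurable
  have nn: "(\<integral>\<^sup>+z. ennreal (u z) \<partial>edges k) = (\<Sum>g\<in>?B. \<integral>\<^sup>+x. ennreal (weight g x * u (x, \<rho> g x)) \<partial>\<nu>)"
    if [measurable]: "u \<in> borel_measurable (\<nu> \<Otimes>\<^sub>M \<nu>)" for u :: "'x \<times> 'x \<Rightarrow> real"
    by (subst nn_integral_edges) (auto simp: ennreal_mult' weight_bounds)
  have "(\<integral>\<^sup>+z. ennreal (norm (h z)) \<partial>edges k) < \<infinity>" using h by (simp add: integrable_iff_bounded)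
  then have "(\<Sum>g\<in>?B. \<integral>\<^sup>+x. ennreal (weight g x * norm (h (x, \<rho> g x))) \<partial>\<nu>) < \<infinity>" by (subst nn[symmetric]) auto
  then have fin: "(\<integral>\<^sup>+x. ennreal (weight g x * norm (h (x, \<rho> g x))) \<partial>\<nu>) < \<infinity>" if "g \<in> ?B" for g
    using that by (simp add: less_top[symmetric])
  show int: "integrable \<nu> (\<lambda>x. weight g x * h (x, \<rho> g x))" if "g \<in> ?B" for g
    using m[OF that] fin[OF that] weight_bounds(1)
    by (intro integrableI_bounded) (simp_all add: abs_mult)
  have "(LINT z|edges k. h z) = enn2real (\<Sum>g\<in>?B. \<integral>\<^sup>+x. ennreal (weight g x * h (x, \<rho> g x)) \<partial>\<nu>)
      - enn2real (\<Sum>g\<in>?B. \<integral>\<^sup>+x. ennreal (- (weight g x * h (x, \<rho> g x))) \<partial>\<nu>)"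
    using nn[of h] nn[of "\<lambda>z. - h z"] by (simp add: real_lebesgue_integral_def[OF h])
  also have "\<dots> = (\<Sum>g\<in>?B. enn2real (\<integral>\<^sup>+x. ennreal (weight g x * h (x, \<rho> g x)) \<partial>\<nu>))
      - (\<Sum>g\<in>?B. enn2real (\<integral>\<^sup>+x. ennreal (- (weight g x * h (x, \<rho> g x))) \<partial>\<nu>))"
    using integrableD(2,3)[OF int] by (subst (1 2) enn2real_sum) (auto simp: less_top)
  also have "\<dots> = (\<Sum>g\<in>?B. LINT x|\<nu>. weight g x * h (x, \<rho> g x))"
    unfolding sum_subtractf[symmetric] by (intro sum.cong refl) (simp add: real_lebesgue_integral_def[OF int])
  finally show "(LINT z|edges k. h z) = (\<Sum>g\<in>?B. LINT x|\<nu>. weight g x * h (x, \<rho> g x))" .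
qed

text \<open>The walker stays put when a step would leave \<open>Y\<close>.\<close>

definition cut_weight :: "'x set \<Rightarrow> 'g \<Rightarrow> 'x \<Rightarrow> real" where
  "cut_weight Y g x = indicator Y x * indicator Y (\<rho> g x) * weight g x"

definition laplacian :: "nat \<Rightarrow> 'x set \<Rightarrow> ('x \<Rightarrow> real) \<Rightarrow> 'x \<Rightarrow> real" where
  "laplacian k Y f x = (\<Sum>g\<in>length_ball G l k. cut_weight Y g x * (f x - f (\<rho> g x)))"

definition walk :: "nat \<Rightarrow> 'x set \<Rightarrow> ('x \<Rightarrow> real) \<Rightarrow> 'x \<Rightarrow> real" where
  "walk k Y f x = f x - laplacian k Y f x / (2 * real (card (length_ball G l k)))"

definition dirichlet :: "nat \<Rightarrow> 'x set \<Rightarrow> ('x \<Rightarrow> real) \<Rightarrow> real" where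
  "dirichlet k Y f = (LINT z|edges k. indicator (Y \<times> Y) z * (f (fst z) - f (snd z))\<^sup>2)"

text \<open>The symmetry of the edge measure turns \<open>f (f - f \<circ> g)\<close> into half of the squared increment, and makes
  the integral of the increment vanish. The bound on the square is the Cauchy-Schwarz inequality for
  the sum over the ball, with weights at most \<open>1\<close>.\<close>

lemma laplacian_identities:
  assumes Y [measurable]: "Y \<in> sets \<nu>" and f: "sq_integrable f"
  shows "sq_integrable (laplacian k Y f)"
    and "(LINT x|\<nu>. f x * laplacian k Y f x) = dirichlet k Y f / 2"
    and "(LINT x|\<nu>. laplacian k Y f x) = 0"
    and "(LINT x|\<nu>. (laplacian k Y f x)\<^sup>2) \<le> real (card (length_ball G l k)) * dirichlet k Y f"
    and "integrable (edges k) (\<lambda>z. indicator (Y \<times> Y) z * (f (fst z) - f (snd z))\<^sup>2)"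
proof -
  let ?B = "length_ball G l k"
  interpret k: symmetric_edges \<nu> "edges k" "real (card ?B)" by (rule symmetric_edges_edges)
  have [measurable]: "f \<in> borel_measurable \<nu>" using f by (rule sq_integrable_measurable)
  have act: "\<rho> g \<in> measurable \<nu> \<nu>" if "g \<in> ?B" for g using that ball_carrier by auto
  have YY [measurable]: "Y \<times> Y \<in> sets (edges k)" by (intro k.Times_in_sets_m Y)
  have cw: "cut_weight Y g \<in> borel_measurable \<nu>" if "g \<in> ?B" for g
    unfolding cut_weight_def[abs_def] using act[OF that] by measurable
  have f_act: "(\<lambda>x. f (\<rho> g x)) \<in> borel_measurable \<nu>" if "g \<in> ?B" for g
    using act[OF that] by measurable
  have lap_m [measurable]: "laplacian k Y f \<in> borel_measurable \<nu>"
    unfolding laplacian_def[abs_def] using cw f_act by measurable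
  have sq: "integrable (edges k) (\<lambda>z. (f (fst z))\<^sup>2)" "integrable (edges k) (\<lambda>z. (f (snd z))\<^sup>2)"
    "integrable (edges k) (\<lambda>z. f (fst z) * f (snd z))"
    using f by (auto simp: sq_integrable_def intro!: k.integrable_marginals)
  have ind: "integrable (edges k) (\<lambda>z. indicator (Y \<times> Y) z * u z)" if "integrable (edges k) u" for u :: "_ \<Rightarrow> real"
    using integrable_mult_indicator[OF YY that] by simp
  let ?e = "\<lambda>z. indicator (Y \<times> Y) z * (f (fst z) - f (snd z))\<^sup>2"
  let ?p = "\<lambda>z. indicator (Y \<times> Y) z * (f (fst z) * (f (fst z) - f (snd z)))"
  let ?d = "\<lambda>z. indicator (Y \<times> Y) z * (f (fst z) - f (snd z))"
  have em: "?e \<in> borel_measurable (\<nu> \<Otimes>\<^sub>M \<nu>)" and pm: "?p \<in> borel_measurable (\<nu> \<Otimes>\<^sub>M \<nu>)"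
    and dm: "?d \<in> borel_measurable (\<nu> \<Otimes>\<^sub>M \<nu>)"
    by measurable
  have "integrable (edges k) (\<lambda>z. (f (fst z))\<^sup>2 + (f (snd z))\<^sup>2 - 2 * (f (fst z) * f (snd z)))"
    using sq by auto
  then have "integrable (edges k) (\<lambda>z. (f (fst z) - f (snd z))\<^sup>2)"
    by (simp add: power2_diff mult.assoc)
  then show e: "integrable (edges k) ?e" by (rule ind)
  have "integrable (edges k) (\<lambda>z. (f (fst z))\<^sup>2 - f (fst z) * f (snd z))" using sq by auto
  then have p: "integrable (edges k) ?p"
    by (intro ind) (simp add: power2_eq_square right_diff_distrib)
  have d1: "integrable (edges k) (\<lambda>z. f (fst z))" "integrable (edges k) (\<lambda>z. f (snd z))"
    using sq by (auto intro!: k.m.square_integrable_imp_integrable)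
  then have d: "integrable (edges k) ?d" by (intro ind) auto
  have termwise: "weight g x * (indicator (Y \<times> Y) (x, \<rho> g x) * r) = cut_weight Y g x * r" for g x r
    by (auto simp: cut_weight_def indicator_def)
  have sum_p: "(\<Sum>g\<in>?B. weight g x * ?p (x, \<rho> g x)) = f x * laplacian k Y f x" for x
    unfolding laplacian_def sum_distrib_left by (intro sum.cong refl) (simp only: termwise fst_conv snd_conv, simp)
  have sum_d: "(\<Sum>g\<in>?B. weight g x * ?d (x, \<rho> g x)) = laplacian k Y f x" for x
    unfolding laplacian_def by (intro sum.cong refl) (simp only: termwise fst_conv snd_conv)
  have "(LINT z|edges k. ?p z) = (LINT x|\<nu>. f x * laplacian k Y f x)"
    unfolding integral_edges(2)[OF pm p] sum_p[symmetric]
    by (rule Bochner_Integration.integral_sum[symmetric]) (rule integral_edges(1)[OF pm p])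
  moreover have "(LINT z|edges k. ?p z) = dirichlet k Y f / 2"
  proof -
    have "2 * (LINT z|edges k. ?p z) = (LINT z|edges k. ?p z) + (LINT z|edges k. ?p (snd z, fst z))"
      using k.integral_swap(1)[OF pm] by simp
    also have "\<dots> = (LINT z|edges k. ?p z + ?p (snd z, fst z))"
      by (rule Bochner_Integration.integral_add[symmetric, OF p k.integral_swap(2)[OF pm p]])
    also have "\<dots> = dirichlet k Y f"
      unfolding dirichlet_def
      by (intro Bochner_Integration.integral_cong refl)
        (auto simp: indicator_def power2_eq_square algebra_simps)
    finally show ?thesis by simp
  qed
  ultimately show "(LINT x|\<nu>. f x * laplacian k Y f x) = dirichlet k Y f / 2" by simp
  have "(LINT z|edges k. ?d z) = (LINT x|\<nu>. laplacian k Y f x)"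
    unfolding integral_edges(2)[OF dm d] sum_d[symmetric]
    by (rule Bochner_Integration.integral_sum[symmetric]) (rule integral_edges(1)[OF dm d])
  moreover have "(LINT z|edges k. ?d z) = 0"
  proof -
    have "(LINT z|edges k. ?d z) = (LINT z|edges k. ?d (snd z, fst z))"
      by (rule k.integral_swap(1)[OF dm, symmetric])
    also have "\<dots> = (LINT z|edges k. - ?d z)"
      by (intro Bochner_Integration.integral_cong refl) (auto simp: indicator_def)
    finally show ?thesis by simp
  qed
  ultimately show "(LINT x|\<nu>. laplacian k Y f x) = 0" by simp
  let ?s = "\<lambda>x. real (card ?B) * (\<Sum>g\<in>?B. weight g x * ?e (x, \<rho> g x))"
  have s: "integrable \<nu> ?s"
    by (intro integrable_mult_right Bochner_Integration.integrable_sum integral_edges(1)[OF em e])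
  have le: "(laplacian k Y f x)\<^sup>2 \<le> ?s x" for x
  proof -
    have "(laplacian k Y f x)\<^sup>2 \<le> (\<Sum>g\<in>?B. (cut_weight Y g x * (f x - f (\<rho> g x)))\<^sup>2) * real (card ?B)"
      unfolding laplacian_def by (rule sum_squared_le_sum_of_squares)
    also have "\<dots> \<le> (\<Sum>g\<in>?B. weight g x * ?e (x, \<rho> g x)) * real (card ?B)"
    proof (intro mult_right_mono sum_mono)
      fix g
      have "(cut_weight Y g x)\<^sup>2 \<le> cut_weight Y g x"
        using weight_bounds[of g x]
        by (auto simp: cut_weight_def indicator_def power2_eq_square mult_left_le)
      then show "(cut_weight Y g x * (f x - f (\<rho> g x)))\<^sup>2 \<le> weight g x * ?e (x, \<rho> g x)"
        unfolding termwise fst_conv snd_conv power_mult_distrib by (intro mult_right_mono) auto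
    qed simp
    finally show ?thesis by (simp only: mult.commute)
  qed
  have lap2: "integrable \<nu> (\<lambda>x. (laplacian k Y f x)\<^sup>2)"
    by (rule Bochner_Integration.integrable_bound[OF s])
      (measurable, auto intro!: AE_I2 order_trans[OF le])
  then show "sq_integrable (laplacian k Y f)" by (simp add: sq_integrable_def)
  have "(LINT x|\<nu>. (laplacian k Y f x)\<^sup>2) \<le> (LINT x|\<nu>. ?s x)"
    by (rule integral_mono[OF lap2 s le])
  also have "\<dots> = real (card ?B) * dirichlet k Y f"
    unfolding dirichlet_def integral_edges(2)[OF em e]
    unfolding integral_mult_right_zero
    by (rule arg_cong[where f = "\<lambda>r. _ * r"], rule Bochner_Integration.integral_sum)
      (rule integral_edges(1)[OF em e])
  finally show "(LINT x|\<nu>. (laplacian k Y f x)\<^sup>2) \<le> real (card ?B) * dirichlet k Y f" .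
qed

lemma laplacian_vanishes: "x \<notin> Y \<Longrightarrow> laplacian k Y f x = 0"
  by (simp add: laplacian_def cut_weight_def)

lemma walk_diff_const: "walk k Y (\<lambda>x. f x - a) x = walk k Y f x - a"
  by (simp add: walk_def laplacian_def)

text \<open>With step size \<open>1 / (2 |B|)\<close> the quadratic term of the step is at most half of the linear
  one, so that a step dissipates a fixed fraction of the Dirichlet energy.\<close>

lemma walk_step:
  assumes Y [measurable]: "Y \<in> sets \<nu>" and f: "sq_integrable f"
  shows "sq_integrable (walk k Y f)"
    and "(LINT x|\<nu>. indicator Y x * walk k Y f x) = (LINT x|\<nu>. indicator Y x * f x)"
    and "(LINT x|\<nu>. indicator Y x * (walk k Y f x)\<^sup>2)
      \<le> (LINT x|\<nu>. indicator Y x * (f x)\<^sup>2) - dirichlet k Y f / (4 * real (card (length_ball G l k)))"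
proof -
  let ?b = "real (card (length_ball G l k))" and ?L = "laplacian k Y f"
  have b: "0 < ?b" using card_ball_pos by simp
  note L = laplacian_identities[OF Y f, of k]
  have Lc: "sq_integrable (\<lambda>x. 1 / (2 * ?b) * ?L x)" by (rule sq_integrable_cmult[OF L(1)])
  have walk_eq: "walk k Y f = (\<lambda>x. f x - 1 / (2 * ?b) * ?L x)" by (simp add: walk_def fun_eq_iff)
  show "sq_integrable (walk k Y f)" unfolding walk_eq by (rule sq_integrable_diff[OF f Lc])
  have Y1: "indicator Y x * ?L x = ?L x" for x using laplacian_vanishes[of x Y k f] by (auto simp: indicator_def)
  have int: "integrable \<nu> (\<lambda>x. indicator Y x * f x)"
    using sq_integrable_integrable[OF sq_integrable_indicator[OF f Y]] .
  have "(LINT x|\<nu>. indicator Y x * walk k Y f x) = (LINT x|\<nu>. indicator Y x * f x - 1 / (2 * ?b) * ?L x)"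
    using Y1 by (intro Bochner_Integration.integral_cong refl) (auto simp: walk_eq right_diff_distrib indicator_def)
  also have "\<dots> = (LINT x|\<nu>. indicator Y x * f x) - 1 / (2 * ?b) * (LINT x|\<nu>. ?L x)"
    using int sq_integrable_integrable[OF L(1)] by simp
  finally show "(LINT x|\<nu>. indicator Y x * walk k Y f x) = (LINT x|\<nu>. indicator Y x * f x)" using L(3) by simp
  have int2: "integrable \<nu> (\<lambda>x. indicator Y x * (f x)\<^sup>2)"
    using integrable_mult_indicator[OF Y, of "\<lambda>x. (f x)\<^sup>2"] f by (simp add: sq_integrable_def)
  have intfL: "integrable \<nu> (\<lambda>x. f x * ?L x)" by (rule sq_integrable_mult[OF f L(1)])
  have intL: "integrable \<nu> (\<lambda>x. (?L x)\<^sup>2)" using L(1) by (simp add: sq_integrable_def)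
  have square: "(p - 1 / (2 * r) * q)\<^sup>2 = p\<^sup>2 - 1 / r * (p * q) + 1 / (4 * r\<^sup>2) * q\<^sup>2"
    if "0 < r" for p q r :: real
    using that by (simp add: power2_eq_square field_simps)
  have "(LINT x|\<nu>. indicator Y x * (walk k Y f x)\<^sup>2)
      = (LINT x|\<nu>. indicator Y x * (f x)\<^sup>2 - 1 / ?b * (f x * ?L x) + 1 / (4 * ?b\<^sup>2) * (?L x)\<^sup>2)"
  proof (intro Bochner_Integration.integral_cong refl)
    fix x
    show "indicator Y x * (walk k Y f x)\<^sup>2
        = indicator Y x * (f x)\<^sup>2 - 1 / ?b * (f x * ?L x) + 1 / (4 * ?b\<^sup>2) * (?L x)\<^sup>2"
      using laplacian_vanishes[of x Y k f] square[OF b]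
      by (cases "x \<in> Y") (auto simp: walk_eq)
  qed
  also have "\<dots> = (LINT x|\<nu>. indicator Y x * (f x)\<^sup>2) - 1 / ?b * (LINT x|\<nu>. f x * ?L x)
      + 1 / (4 * ?b\<^sup>2) * (LINT x|\<nu>. (?L x)\<^sup>2)"
    using int2 intfL intL by simp
  also have "\<dots> \<le> (LINT x|\<nu>. indicator Y x * (f x)\<^sup>2) - 1 / ?b * (dirichlet k Y f / 2)
      + 1 / (4 * ?b\<^sup>2) * (?b * dirichlet k Y f)"
    unfolding L(2) by (intro add_left_mono mult_left_mono L(4)) auto
  also have "\<dots> = (LINT x|\<nu>. indicator Y x * (f x)\<^sup>2) - dirichlet k Y f / (4 * ?b)"
    using b by (simp add: field_simps power2_eq_square)
  finally show "(LINT x|\<nu>. indicator Y x * (walk k Y f x)\<^sup>2)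
      \<le> (LINT x|\<nu>. indicator Y x * (f x)\<^sup>2) - dirichlet k Y f / (4 * ?b)" .
qed

text \<open>Cheeger's inequality on \<open>Y\<close> bounds the dissipated energy from below by the norm: a spectral gap.\<close>

lemma walk_contracts:
  assumes dom: "expansion_domain \<nu> (edges k) Y c"
    and f: "sq_integrable f" and mean: "(LINT x|\<nu>. indicator Y x * f x) = 0"
  shows "(LINT x|\<nu>. indicator Y x * (walk k Y f x)\<^sup>2)
    \<le> (1 - c\<^sup>2 / (16 * (real (card (length_ball G l k)))\<^sup>2)) * (LINT x|\<nu>. indicator Y x * (f x)\<^sup>2)"
proof -
  let ?b = "real (card (length_ball G l k))"
  have Y [measurable]: "Y \<in> sets \<nu>" and c: "0 < c"
    and expand: "\<And>A. A \<in> sets \<nu> \<Longrightarrow> A \<subseteq> Y \<Longrightarrow> 2 * measure \<nu> A \<le> measure \<nu> Y \<Longrightarrow>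
      c * measure \<nu> A \<le> measure (edges k) (A \<times> (Y - A))"
    using dom unfolding expansion_domain_def by blast+
  let ?N = "density \<nu> (indicator Y)" and ?m = "density (edges k) (indicator (Y \<times> Y))"
  have b: "0 < ?b" using card_ball_pos by simp
  interpret k: symmetric_edges \<nu> "edges k" ?b by (rule symmetric_edges_edges)
  interpret Y: symmetric_edges ?N ?m ?b by (rule k.restrict_edges[OF Y])
  have [measurable]: "f \<in> borel_measurable \<nu>" using f by (rule sq_integrable_measurable)
  have YY [measurable]: "Y \<times> Y \<in> sets (edges k)" by (intro k.Times_in_sets_m Y)
  have N: "measure ?N A = measure \<nu> (A \<inter> Y)" if "A \<in> sets \<nu>" for A
  proof -
    have "emeasure ?N A = emeasure \<nu> (A \<inter> Y)"
      using that by (subst emeasure_density) (auto simp flip: nn_integral_indicator intro!: nn_integral_cong split: split_indicator)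
    then show ?thesis by (simp add: measure_def)
  qed
  have m: "measure ?m E = measure (edges k) (E \<inter> Y \<times> Y)" if "E \<in> sets (edges k)" for E
  proof -
    have "emeasure ?m E = emeasure (edges k) (E \<inter> Y \<times> Y)"
      using that by (subst emeasure_density) (auto simp flip: nn_integral_indicator intro!: nn_integral_cong split: split_indicator)
    then show ?thesis by (simp add: measure_def)
  qed
  have sqY: "integrable \<nu> (\<lambda>x. indicator Y x * (f x)\<^sup>2)"
    using integrable_mult_indicator[OF Y, of "\<lambda>x. (f x)\<^sup>2"] f by (simp add: sq_integrable_def)
  have sqN: "sq_integral ?N f = ennreal (LINT x|\<nu>. indicator Y x * (f x)\<^sup>2)"
  proof -
    have "sq_integral ?N f = (\<integral>\<^sup>+x. ennreal (indicator Y x * (f x)\<^sup>2) \<partial>\<nu>)"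
      unfolding sq_integral_def
      by (subst nn_integral_density) (auto intro!: nn_integral_cong split: split_indicator)
    then show ?thesis using sqY by (simp add: nn_integral_eq_integral)
  qed
  have "Y.energy f = (\<integral>\<^sup>+z. ennreal (indicator (Y \<times> Y) z * (f (fst z) - f (snd z))\<^sup>2) \<partial>edges k)"
    unfolding Y.energy_def
    by (subst nn_integral_density) (auto simp: case_prod_unfold intro!: nn_integral_cong split: split_indicator)
  also have "\<dots> = ennreal (dirichlet k Y f)"
    unfolding dirichlet_def
    by (rule nn_integral_eq_integral[OF laplacian_identities(5)[OF Y f]]) (auto split: split_indicator)
  finally have en: "Y.energy f = ennreal (dirichlet k Y f)" .
  have "ennreal (c\<^sup>2 / (4 * ?b)) * sq_integral ?N f \<le> Y.energy f"
  proof (rule Y.cheeger)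
    show "f \<in> borel_measurable ?N" by simp
    show "sq_integral ?N f < \<infinity>" by (simp add: sqN)
    have "density \<nu> (indicator Y) = density \<nu> (\<lambda>x. ennreal (indicator Y x))"
      by (simp add: ennreal_indicator)
    then have "(LINT x|?N. f x) = (LINT x|\<nu>. indicator Y x *\<^sub>R f x)"
      by (simp only:) (rule integral_density, auto)
    then show "(LINT x|?N. f x) = 0" using mean by simp
    have "c * measure ?N A \<le> measure ?m (A \<times> (space ?N - A))"
      if A: "A \<in> sets \<nu>" and A2: "2 * measure ?N A \<le> measure ?N (space ?N)" for A
    proof -
      have "c * measure \<nu> (A \<inter> Y) \<le> measure (edges k) ((A \<inter> Y) \<times> (Y - (A \<inter> Y)))"
        using A A2 N[OF sets.top] by (intro expand) (auto simp: N)
      also have "(A \<inter> Y) \<times> (Y - (A \<inter> Y)) = A \<times> (space ?N - A) \<inter> Y \<times> Y" by auto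
      also have "measure (edges k) \<dots> = measure ?m (A \<times> (space ?N - A))"
      proof (intro m[symmetric] k.Times_in_sets_m A)
        have "space \<nu> - A \<in> sets \<nu>" using A by (rule sets.compl_sets)
        then show "space ?N - A \<in> sets \<nu>" by (simp only: space_density)
      qed
      finally show ?thesis using A by (simp add: N)
    qed
    then show "expansion_domain ?N ?m (space ?N) c"
      unfolding expansion_domain_def using c sets.top[of ?N] by simp
  qed
  then have "ennreal (c\<^sup>2 / (4 * ?b) * (LINT x|\<nu>. indicator Y x * (f x)\<^sup>2)) \<le> ennreal (dirichlet k Y f)"
    unfolding sqN en by (subst ennreal_mult') simp
  moreover have "0 \<le> dirichlet k Y f"
    unfolding dirichlet_def by (intro Bochner_Integration.integral_nonneg) (auto split: split_indicator)
  ultimately have "c\<^sup>2 / (4 * ?b) * (LINT x|\<nu>. indicator Y x * (f x)\<^sup>2) \<le> dirichlet k Y f"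
    by (subst (asm) ennreal_le_iff) auto
  then have le: "c\<^sup>2 / (4 * ?b) * (LINT x|\<nu>. indicator Y x * (f x)\<^sup>2) / (4 * ?b) \<le> dirichlet k Y f / (4 * ?b)"
    using b by (intro divide_right_mono) auto
  have "c\<^sup>2 / (16 * ?b\<^sup>2) * (LINT x|\<nu>. indicator Y x * (f x)\<^sup>2)
      = c\<^sup>2 / (4 * ?b) * (LINT x|\<nu>. indicator Y x * (f x)\<^sup>2) / (4 * ?b)"
    using b by (simp add: field_simps power2_eq_square)
  also note le
  finally show ?thesis using walk_step(3)[OF Y f, of k] unfolding left_diff_distrib mult_1 by linarith
qed

end

section \<open>Weighted translations\<close>

text \<open>Elements of the algebra generated by multiplications and translations, as lists of coefficients.
  The values of \<open>f\<close> range over an arbitrary vector space, so that one list acts on real functions on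
  \<open>X\<close> as well as on the complex slices of functions on the cone.\<close>

definition translation_sum ::
  "('g \<Rightarrow> 'x \<Rightarrow> 'x) \<Rightarrow> (('x \<Rightarrow> real) \<times> 'g) list \<Rightarrow> ('x \<Rightarrow> 'v::real_vector) \<Rightarrow> 'x \<Rightarrow> 'v" where
  "translation_sum \<rho> xs f x = (\<Sum>(a, g)\<leftarrow>xs. a x *\<^sub>R f (\<rho> g x))"

lemma translation_sum_simps [simp]:
  "translation_sum \<rho> [] f x = 0"
  "translation_sum \<rho> ((a, g) # xs) f x = a x *\<^sub>R f (\<rho> g x) + translation_sum \<rho> xs f x"
  "translation_sum \<rho> (xs @ ys) f x = translation_sum \<rho> xs f x + translation_sum \<rho> ys f x"
  by (simp_all add: translation_sum_def)

lemma translation_sum_add: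
  "translation_sum \<rho> xs (\<lambda>y. f y + h y) x = translation_sum \<rho> xs f x + translation_sum \<rho> xs h x"
  by (induction xs) (auto simp: algebra_simps)

lemma translation_sum_cmult:
  fixes f :: "'x \<Rightarrow> 'v::real_algebra"
  shows "translation_sum \<rho> xs (\<lambda>y. c * f y) x = c * translation_sum \<rho> xs f x"
  by (induction xs) (auto simp: algebra_simps)

lemma Re_translation_sum: "Re (translation_sum \<rho> xs f x) = translation_sum \<rho> xs (\<lambda>y. Re (f y)) x"
  and Im_translation_sum: "Im (translation_sum \<rho> xs f x) = translation_sum \<rho> xs (\<lambda>y. Im (f y)) x"
  by (induction xs) auto

lemma translation_sum_eq_0:
  "(\<And>ag. ag \<in> set xs \<Longrightarrow> f (\<rho> (snd ag) x) = 0) \<Longrightarrow> translation_sum \<rho> xs f x = 0"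
proof (induction xs)
  case (Cons ag xs)
  obtain a g where ag: "ag = (a, g)" by (cases ag)
  have "f (\<rho> g x) = 0" using Cons.prems[of ag] by (simp add: ag)
  moreover have "translation_sum \<rho> xs f x = 0" by (rule Cons.IH) (rule Cons.prems, simp)
  ultimately show ?case by (simp add: ag)
qed simp

context measured_action
begin

definition admissible :: "(('x \<Rightarrow> real) \<times> 'g) list \<Rightarrow> bool" where
  "admissible xs \<longleftrightarrow> (\<forall>(a, g)\<in>set xs. a \<in> borel_measurable \<nu> \<and> g \<in> carrier G)"

lemma admissible_simps [simp]:
  "admissible []"
  "admissible ((a, g) # xs) \<longleftrightarrow> a \<in> borel_measurable \<nu> \<and> g \<in> carrier G \<and> admissible xs"
  "admissible (xs @ ys) \<longleftrightarrow> admissible xs \<and> admissible ys"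
  by (auto simp: admissible_def)

lemma translation_sum_compose:
  assumes "admissible xs" "admissible ys"
  obtains zs where "admissible zs"
    "\<And>f :: 'x \<Rightarrow> real. translation_sum \<rho> zs f = translation_sum \<rho> xs (translation_sum \<rho> ys f)"
proof -
  have "\<exists>zs. admissible zs \<and> (\<forall>f :: 'x \<Rightarrow> real. \<forall>x.
      translation_sum \<rho> zs f x = translation_sum \<rho> xs (translation_sum \<rho> ys f) x)"
    using assms(1)
  proof (induction xs)
    case Nil
    show ?case by (intro exI[of _ "[]"]) simp
  next
    case (Cons ag xs)
    obtain a g where ag: "ag = (a, g)" by (cases ag)
    have a [measurable]: "a \<in> borel_measurable \<nu>" and g: "g \<in> carrier G" and xs: "admissible xs"
      using Cons.prems by (auto simp: ag)
    obtain zs where zs: "admissible zs"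
      "\<And>f :: 'x \<Rightarrow> real. \<And>x. translation_sum \<rho> zs f x = translation_sum \<rho> xs (translation_sum \<rho> ys f) x"
      using Cons.IH[OF xs] by blast
    have [measurable]: "\<rho> g \<in> measurable \<nu> \<nu>" using g by simp
    let ?ws = "map (\<lambda>(b, h). (\<lambda>x. a x * b (\<rho> g x), h \<otimes> g)) ys"
    have ws: "admissible ?ws \<and> translation_sum \<rho> ?ws f x = a x * translation_sum \<rho> ys f (\<rho> g x)"
      for f :: "'x \<Rightarrow> real" and x
      using assms(2)
    proof (induction ys)
      case (Cons bh ys)
      obtain b h where bh: "bh = (b, h)" by (cases bh)
      have [measurable]: "b \<in> borel_measurable \<nu>" and h: "h \<in> carrier G" and ys: "admissible ys"
        using Cons.prems by (auto simp: bh)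
      have "(\<lambda>x. a x * b (\<rho> g x)) \<in> borel_measurable \<nu>" by measurable
      then show ?case using Cons.IH[OF ys] g h
        by (simp add: bh act_mult distrib_left mult.assoc)
    qed simp
    show ?case
      by (rule exI[of _ "?ws @ zs"]) (use ws zs in \<open>simp add: ag\<close>)
  qed
  then obtain zs where "admissible zs" "\<forall>f :: 'x \<Rightarrow> real. \<forall>x.
      translation_sum \<rho> zs f x = translation_sum \<rho> xs (translation_sum \<rho> ys f) x" by blast
  then show ?thesis by (intro that[of zs]) auto
qed

lemma walk_translation_sum:
  assumes Y [measurable]: "Y \<in> sets \<nu>"
  obtains xs where "admissible xs" "\<And>f. translation_sum \<rho> xs f = walk k Y f"
proof -
  let ?B = "length_ball G l k"
  let ?b = "2 * real (card ?B)"
  obtain gs where gs: "set gs = ?B" "distinct gs" using finite_distinct_list[OF finite_ball] by blast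
  let ?ys = "map (\<lambda>g. (\<lambda>x. cut_weight Y g x / ?b, g)) gs"
  let ?a = "\<lambda>x. 1 - (\<Sum>g\<in>?B. cut_weight Y g x) / ?b"
  have cw: "cut_weight Y g \<in> borel_measurable \<nu>" if "g \<in> ?B" for g
  proof -
    have [measurable]: "\<rho> g \<in> measurable \<nu> \<nu>" using ball_carrier[OF that] by simp
    show ?thesis unfolding cut_weight_def[abs_def] by measurable
  qed
  have "admissible ?ys"
    unfolding admissible_def using cw ball_carrier by (auto simp: gs(1))
  moreover have "?a \<in> borel_measurable \<nu>" using cw by measurable
  ultimately have adm: "admissible ((?a, \<one>) # ?ys)" by simp
  have "translation_sum \<rho> ((?a, \<one>) # ?ys) f x = walk k Y f x" for f x
  proof -
    have "translation_sum \<rho> ?ys f x = (\<Sum>g\<leftarrow>gs. cut_weight Y g x / ?b * f (\<rho> g x))"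
      by (simp add: translation_sum_def o_def)
    also have "\<dots> = (\<Sum>g\<in>?B. cut_weight Y g x / ?b * f (\<rho> g x))"
      using gs by (simp add: sum_list_distinct_conv_sum_set)
    finally have "translation_sum \<rho> ((?a, \<one>) # ?ys) f x
        = (1 - (\<Sum>g\<in>?B. cut_weight Y g x) / ?b) * f x + (\<Sum>g\<in>?B. cut_weight Y g x / ?b * f (\<rho> g x))"
      by simp
    also have "\<dots> = walk k Y f x"
      by (simp add: walk_def laplacian_def algebra_simps sum_subtractf sum_distrib_left sum_divide_distrib
          diff_divide_distrib)
    finally show ?thesis .
  qed
  then show ?thesis using that[OF adm] by blast
qed

lemma walk_power_translation_sum:
  assumes Y [measurable]: "Y \<in> sets \<nu>"
  shows "\<exists>xs. admissible xs \<and>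
    (\<forall>f :: 'x \<Rightarrow> real. \<forall>x. translation_sum \<rho> xs f x = indicator Y x * (walk k Y ^^ n) f x)"
proof (induction n)
  case 0
  show ?case by (intro exI[of _ "[(indicator Y, \<one>)]"]) simp
next
  case (Suc n)
  then obtain xs where xs: "admissible xs"
    "\<And>f :: 'x \<Rightarrow> real. \<And>x. translation_sum \<rho> xs f x = indicator Y x * (walk k Y ^^ n) f x" by blast
  obtain ys where ys: "admissible ys" "\<And>f. translation_sum \<rho> ys f = walk k Y f"
    using walk_translation_sum[OF Y] by blast
  obtain zs where zs: "admissible zs"
    "\<And>f :: 'x \<Rightarrow> real. translation_sum \<rho> zs f = translation_sum \<rho> xs (translation_sum \<rho> ys f)"
    using translation_sum_compose[OF xs(1) ys(1)] by blast
  show ?case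
    by (rule exI[of _ zs]) (simp add: zs xs(2) ys(2) funpow_Suc_right del: funpow.simps)
qed

section \<open>Approximation of the projection onto the constants\<close>

lemma sq_integrable_iff: "sq_integrable f \<longleftrightarrow> f \<in> borel_measurable \<nu> \<and> sq_integral \<nu> f < \<infinity>"
  unfolding sq_integrable_def sq_integral_def integrable_iff_bounded by auto

lemma sq_integral_eq: "sq_integrable f \<Longrightarrow> sq_integral \<nu> f = ennreal (LINT x|\<nu>. (f x)\<^sup>2)"
  unfolding sq_integrable_def sq_integral_def by (simp add: nn_integral_eq_integral)

definition approximates_mean :: "real \<Rightarrow> (('x \<Rightarrow> real) \<times> 'g) list \<Rightarrow> bool" where
  "approximates_mean \<epsilon> xs \<longleftrightarrow> admissible xs \<and> (\<forall>f :: 'x \<Rightarrow> real. sq_integrable f \<longrightarrow>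
     sq_integral \<nu> (\<lambda>x. translation_sum \<rho> xs f x - (LINT y|\<nu>. f y)) \<le> ennreal \<epsilon> * sq_integral \<nu> f)"

lemma walk_power_contracts:
  assumes dom: "expansion_domain \<nu> (edges k) Y c"
    and q: "1 - c\<^sup>2 / (16 * (real (card (length_ball G l k)))\<^sup>2) \<le> q" "0 \<le> q"
    and f: "sq_integrable f" and mean: "(LINT x|\<nu>. indicator Y x * f x) = 0"
  shows "sq_integrable ((walk k Y ^^ n) f) \<and> (LINT x|\<nu>. indicator Y x * (walk k Y ^^ n) f x) = 0 \<and>
    (LINT x|\<nu>. indicator Y x * ((walk k Y ^^ n) f x)\<^sup>2) \<le> q ^ n * (LINT x|\<nu>. indicator Y x * (f x)\<^sup>2)"
proof (induction n)
  case 0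
  then show ?case using f mean by simp
next
  case (Suc n)
  let ?u = "(walk k Y ^^ n) f"
  have u: "sq_integrable ?u" "(LINT x|\<nu>. indicator Y x * ?u x) = 0"
    "(LINT x|\<nu>. indicator Y x * (?u x)\<^sup>2) \<le> q ^ n * (LINT x|\<nu>. indicator Y x * (f x)\<^sup>2)"
    using Suc by auto
  have "(LINT x|\<nu>. indicator Y x * (walk k Y ?u x)\<^sup>2)
      \<le> (1 - c\<^sup>2 / (16 * (real (card (length_ball G l k)))\<^sup>2)) * (LINT x|\<nu>. indicator Y x * (?u x)\<^sup>2)"
    by (rule walk_contracts[OF dom u(1,2)])
  also have "\<dots> \<le> q * (LINT x|\<nu>. indicator Y x * (?u x)\<^sup>2)"
    by (intro mult_right_mono q(1) Bochner_Integration.integral_nonneg) (auto split: split_indicator)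
  also have "\<dots> \<le> q * (q ^ n * (LINT x|\<nu>. indicator Y x * (f x)\<^sup>2))"
    by (intro mult_left_mono u(3) q(2))
  finally show ?case using walk_step[OF _ u(1), of Y k] u(2) dom by (simp add: expansion_domain_def)
qed

text \<open>The left-hand side without the square is the integral of \<open>f\<close> against \<open>1\<^sub>Y - \<nu>(Y)\<close>, a function of
  squared norm at most \<open>\<alpha>\<close>; expand the square of \<open>f - s (1\<^sub>Y - \<nu>(Y))\<close> for a suitable \<open>s\<close>.\<close>

lemma mean_on_subset_close:
  assumes Y [measurable]: "Y \<in> sets \<nu>" and \<alpha>: "0 < \<alpha>" "1 - \<alpha> \<le> measure \<nu> Y"
    and f: "sq_integrable f" and a: "(LINT x|\<nu>. indicator Y x * f x) = measure \<nu> Y * a"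
  shows "measure \<nu> Y * (a - (LINT x|\<nu>. f x))\<^sup>2 \<le> \<alpha> * (LINT x|\<nu>. (f x)\<^sup>2)"
proof -
  let ?p = "measure \<nu> Y" and ?\<mu> = "LINT x|\<nu>. f x"
  define s where "s = (a - ?\<mu>) / \<alpha>"
  have [measurable]: "f \<in> borel_measurable \<nu>" using f by (rule sq_integrable_measurable)
  have if1: "integrable \<nu> f" by (rule sq_integrable_integrable[OF f])
  have if2: "integrable \<nu> (\<lambda>x. (f x)\<^sup>2)" using f by (simp add: sq_integrable_def)
  have iY: "integrable \<nu> (\<lambda>x. indicator Y x * f x)"
    by (rule sq_integrable_integrable[OF sq_integrable_indicator[OF f Y]])
  have i1: "integrable \<nu> (indicator Y :: _ \<Rightarrow> real)" by (intro integrable_real_indicator) (auto simp: emeasure_eq_measure)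
  have "0 \<le> (LINT x|\<nu>. (f x - s * (indicator Y x - ?p))\<^sup>2)" by simp
  also have "\<dots> = (LINT x|\<nu>. (f x)\<^sup>2 - 2 * s * (indicator Y x * f x) + 2 * s * ?p * f x
      + s\<^sup>2 * ((1 - 2 * ?p) * indicator Y x + ?p\<^sup>2))"
    by (intro Bochner_Integration.integral_cong refl)
      (auto simp: power2_eq_square algebra_simps split: split_indicator)
  also have "\<dots> = (LINT x|\<nu>. (f x)\<^sup>2) - 2 * s * (?p * a) + 2 * s * ?p * ?\<mu> + s\<^sup>2 * ((1 - 2 * ?p) * ?p + ?p\<^sup>2)"
    using if1 if2 iY i1 prob_space by (simp add: a)
  also have "\<dots> = (LINT x|\<nu>. (f x)\<^sup>2) - 2 * s * ?p * (a - ?\<mu>) + s\<^sup>2 * ?p * (1 - ?p)"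
    by (simp add: power2_eq_square algebra_simps)
  also have "s\<^sup>2 * ?p * (1 - ?p) \<le> s\<^sup>2 * ?p * \<alpha>" using \<alpha> by (intro mult_left_mono) auto
  also have "(LINT x|\<nu>. (f x)\<^sup>2) - 2 * s * ?p * (a - ?\<mu>) + s\<^sup>2 * ?p * \<alpha>
      = (LINT x|\<nu>. (f x)\<^sup>2) - ?p * (a - ?\<mu>)\<^sup>2 / \<alpha>"
    using \<alpha>(1) by (simp add: s_def field_simps power2_eq_square)
  finally show ?thesis using \<alpha>(1) by (simp add: field_simps)
qed

text \<open>Cut to a domain of expansion \<open>Y\<close> of nearly full measure, iterate the random walk on \<open>Y\<close>: the
  result is close to the mean over \<open>Y\<close>, which is close to the mean over the whole space.\<close>

lemma mean_approximation:
  assumes ae: "asymptotically_expanding G l \<nu> \<rho>" and \<epsilon>: "0 < \<epsilon>"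
  obtains xs where "approximates_mean \<epsilon> xs"
proof -
  obtain k1 h1 where h1: "0 < h1" "\<And>A. A \<in> sets \<nu> \<Longrightarrow> 1/4 \<le> measure \<nu> A \<Longrightarrow> measure \<nu> A \<le> 1/2 \<Longrightarrow>
      h1 \<le> measure (edges k1) (A \<times> (space \<nu> - A))"
    by (rule edge_expansion[OF ae, of "1/4"]) (simp, simp, blast)
  define C1 where "C1 = real (card (length_ball G l k1))"
  have C1: "0 < C1" using card_ball_pos by (simp add: C1_def)
  (* the sets of measure at least 1/4 fix the degree bound C1 that restricts the choice of \<alpha> *)
  define \<alpha> where "\<alpha> = min (1/8) (min (h1 / (2 * C1)) (\<epsilon> / 6))"
  have \<alpha>: "0 < \<alpha>" "\<alpha> \<le> 1/8" "\<alpha> \<le> \<epsilon> / 6" "\<alpha> \<le> h1 / (2 * C1)" using h1 C1 \<epsilon> by (auto simp: \<alpha>_def)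
  have \<alpha>C: "C1 * \<alpha> \<le> h1 / 2" using \<alpha>(4) C1 by (simp add: field_simps)
  obtain k0 h where h: "0 < h" "\<And>A. A \<in> sets \<nu> \<Longrightarrow> \<alpha> \<le> measure \<nu> A \<Longrightarrow> measure \<nu> A \<le> 1/2 \<Longrightarrow>
      h \<le> measure (edges k0) (A \<times> (space \<nu> - A))"
    by (rule edge_expansion[OF ae \<alpha>(1)]) (use \<alpha>(2) in simp, blast)
  define k where "k = max k0 k1"
  let ?b = "real (card (length_ball G l k))"
  have b: "0 < ?b" using card_ball_pos by simp
  obtain Y c where Y\<alpha>: "1 - \<alpha> \<le> measure \<nu> Y" and dom: "expansion_domain \<nu> (edges k) Y c"
  proof (rule domain_of_expansion[OF prob_space_axioms symmetric_edges_edges[of k] symmetric_edges_edges[of k1]])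
    show "measure (edges k1) E \<le> measure (edges k) E" if "E \<in> sets (edges k)" for E
      using that by (intro edges_mono) (auto simp: k_def edges_def)
    show "real (card (length_ball G l k1)) * \<alpha> \<le> h1 / 2" using \<alpha>C by (simp add: C1_def)
    show "h \<le> measure (edges k) (A \<times> (space \<nu> - A))"
      if A [measurable]: "A \<in> sets \<nu>" and "\<alpha> \<le> measure \<nu> A" "measure \<nu> A \<le> 1/2" for A
    proof -
      have "A \<times> (space \<nu> - A) \<in> sets (\<nu> \<Otimes>\<^sub>M \<nu>)" by measurable
      then have "measure (edges k0) (A \<times> (space \<nu> - A)) \<le> measure (edges k) (A \<times> (space \<nu> - A))"
        by (intro edges_mono) (auto simp: k_def)
      then show ?thesis using h(2)[OF that] by linarith
    qed
  qed (use \<alpha> h h1 in blast)+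
  then have Y [measurable]: "Y \<in> sets \<nu>" and c: "0 < c" by (auto simp: expansion_domain_def)
  define q where "q = max 0 (1 - c\<^sup>2 / (16 * ?b\<^sup>2))"
  have "0 < c\<^sup>2 / (16 * ?b\<^sup>2)" by (intro divide_pos_pos mult_pos_pos zero_less_power b c) simp
  then have q: "1 - c\<^sup>2 / (16 * ?b\<^sup>2) \<le> q" "0 \<le> q" "q < 1" unfolding q_def by linarith+
  obtain n where n: "q ^ n < \<epsilon> / 4" using real_arch_pow_inv[of "\<epsilon> / 4" q] \<epsilon> q by auto
  obtain xs where xs: "admissible xs"
    "\<And>f :: 'x \<Rightarrow> real. \<And>x. translation_sum \<rho> xs f x = indicator Y x * (walk k Y ^^ n) f x"
    using walk_power_translation_sum[OF Y, where k = k and n = n] by blast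
  let ?p = "measure \<nu> Y"
  have p: "0 < ?p" using Y\<alpha> \<alpha>(2) by linarith
  have "sq_integral \<nu> (\<lambda>x. translation_sum \<rho> xs f x - (LINT y|\<nu>. f y)) \<le> ennreal \<epsilon> * sq_integral \<nu> f"
    if f: "sq_integrable f" for f :: "'x \<Rightarrow> real"
  proof -
    let ?\<mu> = "LINT y|\<nu>. f y" and ?F = "LINT x|\<nu>. (f x)\<^sup>2"
    define a where "a = (LINT x|\<nu>. indicator Y x * f x) / ?p"
    have a: "(LINT x|\<nu>. indicator Y x * f x) = ?p * a" using p by (simp add: a_def)
    let ?g = "\<lambda>x. f x - a"
    have g: "sq_integrable ?g" by (rule sq_integrable_diff[OF f sq_integrable_const])
    have i1: "integrable \<nu> (indicator Y :: _ \<Rightarrow> real)"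
      by (intro integrable_real_indicator) (auto simp: emeasure_eq_measure)
    have iY: "integrable \<nu> (\<lambda>x. indicator Y x * f x)"
      by (rule sq_integrable_integrable[OF sq_integrable_indicator[OF f Y]])
    have sqY: "integrable \<nu> (\<lambda>x. indicator Y x * (u x)\<^sup>2)" if "sq_integrable u" for u
      using integrable_mult_indicator[OF Y, of "\<lambda>x. (u x)\<^sup>2"] that by (simp add: sq_integrable_def)
    have "(LINT x|\<nu>. indicator Y x * ?g x) = (LINT x|\<nu>. indicator Y x * f x - a * indicator Y x)"
      by (intro Bochner_Integration.integral_cong) (auto simp: algebra_simps)
    also have "\<dots> = 0" using iY i1 by (simp add: a)
    finally have g0: "(LINT x|\<nu>. indicator Y x * ?g x) = 0" .
    define u where "u = (walk k Y ^^ n) ?g"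
    have "sq_integrable u \<and> (LINT x|\<nu>. indicator Y x * u x) = 0 \<and>
        (LINT x|\<nu>. indicator Y x * (u x)\<^sup>2) \<le> q ^ n * (LINT x|\<nu>. indicator Y x * (?g x)\<^sup>2)"
      unfolding u_def by (rule walk_power_contracts[OF dom q(1,2) g g0])
    then have u: "sq_integrable u"
      "(LINT x|\<nu>. indicator Y x * (u x)\<^sup>2) \<le> q ^ n * (LINT x|\<nu>. indicator Y x * (?g x)\<^sup>2)"
      by simp_all
    have ueq: "(walk k Y ^^ n) f x = u x + a" for x
    proof -
      have "(walk k Y ^^ n) (\<lambda>x. f x - a) = (\<lambda>x. (walk k Y ^^ n) f x - a)"
      proof (induction n)
        case (Suc n)
        show ?case unfolding funpow.simps o_apply Suc by (rule ext) (rule walk_diff_const)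
      qed simp
      then show ?thesis by (simp add: u_def)
    qed
    have "(LINT x|\<nu>. indicator Y x * (?g x)\<^sup>2)
        = (LINT x|\<nu>. indicator Y x * (f x)\<^sup>2 - 2 * a * (indicator Y x * f x) + a\<^sup>2 * indicator Y x)"
      by (intro Bochner_Integration.integral_cong refl) (auto simp: power2_diff algebra_simps split: split_indicator)
    also have "\<dots> = (LINT x|\<nu>. indicator Y x * (f x)\<^sup>2) - ?p * a\<^sup>2"
      using sqY[OF f] iY i1 by (simp add: a power2_eq_square)
    also have "\<dots> \<le> (LINT x|\<nu>. indicator Y x * (f x)\<^sup>2)" by simp
    also have "\<dots> \<le> ?F"
      using f by (intro integral_mono sqY) (auto simp: sq_integrable_def split: split_indicator)
    finally have gF: "(LINT x|\<nu>. indicator Y x * (?g x)\<^sup>2) \<le> ?F" .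
    have F0: "0 \<le> ?F" by simp
    have \<mu>F: "?\<mu>\<^sup>2 \<le> ?F"
    proof -
      have "(LINT x|\<nu>. (f x - ?\<mu>)\<^sup>2) = ?F - ?\<mu>\<^sup>2"
        using variance_eq[OF sq_integrable_integrable[OF f]] f by (simp add: sq_integrable_def)
      moreover have "0 \<le> (LINT x|\<nu>. (f x - ?\<mu>)\<^sup>2)" by simp
      ultimately show ?thesis by linarith
    qed
    let ?D = "\<lambda>x. (translation_sum \<rho> xs f x - ?\<mu>)\<^sup>2"
    let ?U = "\<lambda>x. 2 * (indicator Y x * (u x)\<^sup>2) + 2 * (a - ?\<mu>)\<^sup>2 * indicator Y x + ?\<mu>\<^sup>2 * (1 - indicator Y x)"
    have D_le: "?D x \<le> ?U x" for x
    proof (cases "x \<in> Y")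
      case True
      have "(u x + (a - ?\<mu>))\<^sup>2 \<le> 2 * (u x)\<^sup>2 + 2 * (a - ?\<mu>)\<^sup>2"
        using norm_add_sq_le[of "u x" "a - ?\<mu>"] by simp
      then show ?thesis using True by (simp add: xs(2) ueq algebra_simps)
    qed (simp add: xs(2))
    have U: "integrable \<nu> ?U" using sqY[OF u(1)] i1 by auto
    have [measurable]: "u \<in> borel_measurable \<nu>" using u(1) by (rule sq_integrable_measurable)
    have "?D \<in> borel_measurable \<nu>" unfolding xs(2) ueq by measurable
    then have D: "integrable \<nu> ?D"
      by (rule Bochner_Integration.integrable_bound[OF U]) (auto intro!: AE_I2 order_trans[OF D_le])
    have "(LINT x|\<nu>. ?D x) \<le> (LINT x|\<nu>. ?U x)" by (rule integral_mono[OF D U D_le])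
    also have "\<dots> = 2 * (LINT x|\<nu>. indicator Y x * (u x)\<^sup>2) + 2 * (?p * (a - ?\<mu>)\<^sup>2) + ?\<mu>\<^sup>2 * (1 - ?p)"
      using sqY[OF u(1)] i1 prob_space by simp
    also have "\<dots> \<le> 2 * (\<epsilon> / 4 * ?F) + 2 * (\<alpha> * ?F) + ?F * \<alpha>"
    proof (intro add_mono mult_left_mono)
      have "q ^ n * (LINT x|\<nu>. indicator Y x * (?g x)\<^sup>2) \<le> q ^ n * ?F"
        using gF q(2) by (intro mult_left_mono) auto
      also have "\<dots> \<le> \<epsilon> / 4 * ?F" using n by (intro mult_right_mono F0) simp
      finally show "(LINT x|\<nu>. indicator Y x * (u x)\<^sup>2) \<le> \<epsilon> / 4 * ?F" using u(2) by linarith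
      show "?p * (a - ?\<mu>)\<^sup>2 \<le> \<alpha> * ?F" by (rule mean_on_subset_close[OF Y \<alpha>(1) Y\<alpha> f a])
      show "?\<mu>\<^sup>2 * (1 - ?p) \<le> ?F * \<alpha>"
        using \<mu>F Y\<alpha> prob_le_1[of Y] F0 by (intro mult_mono) auto
    qed simp_all
    also have "\<dots> = (\<epsilon> / 2 + 3 * \<alpha>) * ?F" by (simp add: algebra_simps)
    also have "\<dots> \<le> \<epsilon> * ?F" using \<alpha>(3) by (intro mult_right_mono F0) simp
    finally have "ennreal (LINT x|\<nu>. ?D x) \<le> ennreal (\<epsilon> * ?F)" by (rule ennreal_leI)
    then show ?thesis
      unfolding sq_integral_eq[OF f] using D \<epsilon>
      by (simp add: ennreal_mult' sq_integral_def nn_integral_eq_integral)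
  qed
  then show ?thesis using that[of xs] xs(1) by (simp add: approximates_mean_def)
qed

section \<open>Transport to the warped cone\<close>

definition cone_translation :: "(('x \<Rightarrow> real) \<times> 'g) list \<Rightarrow> ('x \<times> real \<Rightarrow> complex) \<Rightarrow> 'x \<times> real \<Rightarrow> complex" where
  "cone_translation xs f = (\<lambda>z. translation_sum \<rho> xs (\<lambda>x. f (x, snd z)) (fst z))"

lemma cone_translation_measurable:
  assumes "admissible xs" and [measurable]: "f \<in> borel_measurable (\<nu> \<Otimes>\<^sub>M N)"
  shows "cone_translation xs f \<in> borel_measurable (\<nu> \<Otimes>\<^sub>M N)"
  using assms(1)
proof (induction xs)
  case Nil
  show ?case by (simp add: cone_translation_def)
next
  case (Cons ag xs)
  obtain a g where ag: "ag = (a, g)" by (cases ag)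
  have [measurable]: "a \<in> borel_measurable \<nu>" "\<rho> g \<in> measurable \<nu> \<nu>"
    and [measurable]: "cone_translation xs f \<in> borel_measurable (\<nu> \<Otimes>\<^sub>M N)"
    using Cons by (auto simp: ag)
  have "(\<lambda>z. a (fst z) *\<^sub>R f (\<rho> g (fst z), snd z) + cone_translation xs f z) \<in> borel_measurable (\<nu> \<Otimes>\<^sub>M N)"
    by measurable
  then show ?case by (simp add: cone_translation_def ag)
qed

lemma sq_integral_complex:
  fixes f :: "'a \<Rightarrow> complex"
  assumes [measurable]: "f \<in> borel_measurable M"
  shows "sq_integral M f = sq_integral M (\<lambda>x. Re (f x)) + sq_integral M (\<lambda>x. Im (f x))"
  unfolding sq_integral_def
  by (subst nn_integral_add[symmetric]) (auto simp: cmod_power2 ennreal_plus)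

text \<open>Real and imaginary parts are approximated separately; a function that is not square-integrable
  makes the right-hand side infinite.\<close>

lemma complex_mean_approximation:
  fixes f :: "'x \<Rightarrow> complex"
  assumes \<epsilon>: "0 < \<epsilon>" and xs: "approximates_mean \<epsilon> xs"
    and f [measurable]: "f \<in> borel_measurable \<nu>"
  shows "sq_integral \<nu> (\<lambda>x. translation_sum \<rho> xs f x - (LINT y|\<nu>. f y)) \<le> ennreal \<epsilon> * sq_integral \<nu> f"
proof (cases "sq_integral \<nu> f < \<infinity>")
  case True
  have split: "sq_integral \<nu> f = sq_integral \<nu> (\<lambda>x. Re (f x)) + sq_integral \<nu> (\<lambda>x. Im (f x))"
    by (rule sq_integral_complex[OF f])
  have Re: "sq_integrable (\<lambda>x. Re (f x))" and Im: "sq_integrable (\<lambda>x. Im (f x))"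
    using True split by (auto simp: sq_integrable_iff)
  have int: "integrable \<nu> f" using True f by (intro L2_integrable) (simp add: L2_iff_sq_integral)
  have "admissible xs" using xs by (simp add: approximates_mean_def)
  then have ts: "translation_sum \<rho> xs f \<in> borel_measurable \<nu>"
  proof (induction xs)
    case (Cons ag xs)
    obtain a g where ag: "ag = (a, g)" by (cases ag)
    have [measurable]: "a \<in> borel_measurable \<nu>" "\<rho> g \<in> measurable \<nu> \<nu>"
      and [measurable]: "translation_sum \<rho> xs f \<in> borel_measurable \<nu>"
      using Cons by (auto simp: ag)
    have "(\<lambda>x. a x *\<^sub>R f (\<rho> g x) + translation_sum \<rho> xs f x) \<in> borel_measurable \<nu>" by measurable
    then show ?case by (simp add: ag translation_sum_def[abs_def])
  qed (simp add: translation_sum_def[abs_def])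
  have real: "sq_integral \<nu> (\<lambda>x. translation_sum \<rho> xs h x - (LINT y|\<nu>. h y)) \<le> ennreal \<epsilon> * sq_integral \<nu> h"
    if "sq_integrable h" for h :: "'x \<Rightarrow> real"
    using xs that by (simp add: approximates_mean_def)
  have "sq_integral \<nu> (\<lambda>x. translation_sum \<rho> xs f x - (LINT y|\<nu>. f y))
      = sq_integral \<nu> (\<lambda>x. translation_sum \<rho> xs (\<lambda>y. Re (f y)) x - (LINT y|\<nu>. Re (f y)))
      + sq_integral \<nu> (\<lambda>x. translation_sum \<rho> xs (\<lambda>y. Im (f y)) x - (LINT y|\<nu>. Im (f y)))"
    using ts int by (subst sq_integral_complex) (simp_all add: Re_translation_sum Im_translation_sum)
  also have "\<dots> \<le> ennreal \<epsilon> * sq_integral \<nu> (\<lambda>x. Re (f x)) + ennreal \<epsilon> * sq_integral \<nu> (\<lambda>x. Im (f x))"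
    by (intro add_mono real Re Im)
  also have "\<dots> = ennreal \<epsilon> * sq_integral \<nu> f" by (simp add: split distrib_left)
  finally show ?thesis .
next
  case False
  then show ?thesis using \<epsilon> by (simp add: ennreal_mult_top less_top[symmetric])
qed

text \<open>A translation by \<open>g\<close> preserves the slices and moves points by at most \<open>l g\<close> in each of them, so one
  bound serves all \<open>t\<close>.\<close>

lemma cone_translation_finite_propagation:
  assumes xs: "admissible xs"
  shows "finite_propagation (cone_measure \<nu>) (cone_metric G l \<rho>) (cone_translation xs)"
  unfolding finite_propagation_def
proof (intro exI[of _ "real (\<Sum>(a, g)\<leftarrow>xs. l g) + 1"] conjI ballI impI)
  let ?R = "real (\<Sum>(a, g)\<leftarrow>xs. l g) + 1"
  show "0 < ?R" by simp
  fix A C f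
  assume A: "A \<in> sets (cone_measure \<nu>)" and far: "ereal ?R < set_distance (cone_metric G l \<rho>) A C"
  show "AE z in cone_measure \<nu>. cut_op A (cone_translation xs) C f z = 0"
  proof (rule AE_I2)
    fix z assume "z \<in> space (cone_measure \<nu>)"
    then obtain x t where z: "z = (x, t)" and t: "1 \<le> t"
      by (auto simp: cone_measure_def space_pair_measure ray_measure_def space_restrict_space)
    show "cut_op A (cone_translation xs) C f z = 0"
    proof (cases "z \<in> A")
      case True
      have "cone_translation xs (mult_indicator C f) z = 0"
        unfolding cone_translation_def
      proof (rule translation_sum_eq_0)
        fix ag assume ag': "ag \<in> set xs"
        obtain a g where ag_eq: "ag = (a, g)" by (cases ag)
        have ag: "(a, g) \<in> set xs" using ag' by (simp add: ag_eq)
        then have g: "g \<in> carrier G" using xs by (auto simp: admissible_def)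
        have "l g \<le> (\<Sum>(a, g)\<leftarrow>xs. l g)"
          using member_le_sum_list[of "l g" "map (\<lambda>(a, g). l g) xs"] ag by force
        then have lg: "real (l g) \<le> ?R" by linarith
        have "(\<rho> g x, t) \<notin> C"
        proof
          assume C: "(\<rho> g x, t) \<in> C"
          have "set_distance (cone_metric G l \<rho>) A C \<le> ereal (cone_metric G l \<rho> (x, t) (\<rho> g x, t))"
            unfolding set_distance_def using True C z by (auto intro!: INF_lower2)
          also have "cone_metric G l \<rho> (x, t) (\<rho> g x, t) \<le> real (l g)"
            using warped_metric_act_le[of t g x] t g by (simp add: cone_metric_def)
          finally show False using far lg by (meson ereal_less_eq(3) leD order_trans)
        qed
        then show "mult_indicator C f (\<rho> (snd ag) (fst z), snd z) = 0"
          by (simp add: z ag_eq mult_indicator_def)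
      qed
      then show ?thesis by (simp add: cut_op_def mult_indicator_def[of A])
    qed (simp add: cut_op_def mult_indicator_def[of A])
  qed
qed

lemma finite_propagation_limit_if_expanding:
  assumes ae: "asymptotically_expanding G l \<nu> \<rho>"
  shows "opnorm_limit_of_finite_propagation (cone_measure \<nu>) (cone_metric G l \<rho>) (drutu_nowak_projection \<nu>)"
proof -
  let ?M = "cone_measure \<nu>" and ?T = "drutu_nowak_projection \<nu>"
  interpret sl: slices \<nu> ray_measure by (rule slices_ray) unfold_locales
  have M: "?M = \<nu> \<Otimes>\<^sub>M ray_measure" by (simp add: cone_measure_def)
  have "\<exists>xs. admissible xs \<and> (\<forall>f\<in>borel_measurable ?M.
      sq_integral ?M (\<lambda>z. cone_translation xs f z - slice_mean \<nu> f z) \<le> ennreal ((1 / real (Suc n))\<^sup>2) * sq_integral ?M f)" for n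
  proof -
    have \<epsilon>: "0 < (1 / real (Suc n))\<^sup>2" by simp
    obtain xs where app: "approximates_mean ((1 / real (Suc n))\<^sup>2) xs"
      using mean_approximation[OF ae \<epsilon>] by blast
    then have xs: "admissible xs" by (simp add: approximates_mean_def)
    have "sq_integral ?M (\<lambda>z. cone_translation xs f z - slice_mean \<nu> f z) \<le> ennreal ((1 / real (Suc n))\<^sup>2) * sq_integral ?M f"
      if "f \<in> borel_measurable ?M" for f
    proof -
      have f: "f \<in> borel_measurable (\<nu> \<Otimes>\<^sub>M ray_measure)" using that by (simp add: M)
      show ?thesis
        unfolding M
      proof (rule sl.pair.sq_integral_slices_le)
        show "(\<lambda>z. cone_translation xs f z - slice_mean \<nu> f z) \<in> borel_measurable (\<nu> \<Otimes>\<^sub>M ray_measure)"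
          by (intro borel_measurable_diff cone_translation_measurable sl.slice_mean_measurable xs f)
        fix t assume "t \<in> space ray_measure"
        then have "(\<lambda>x. f (x, t)) \<in> borel_measurable \<nu>" by (rule slice_measurable[OF f])
        from complex_mean_approximation[OF \<epsilon> app this]
        show "sq_integral \<nu> (\<lambda>x. cone_translation xs f (x, t) - slice_mean \<nu> f (x, t))
            \<le> ennreal ((1 / real (Suc n))\<^sup>2) * sq_integral \<nu> (\<lambda>x. f (x, t))"
          by (simp add: cone_translation_def slice_mean_def)
      qed (rule f)
    qed
    with xs show ?thesis by blast
  qed
  then obtain xs where xs: "\<And>n. admissible (xs n)"
    "\<And>n f. f \<in> borel_measurable ?M \<Longrightarrow> sq_integral ?M (\<lambda>z. cone_translation (xs n) f z - slice_mean \<nu> f z)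
      \<le> ennreal ((1 / real (Suc n))\<^sup>2) * sq_integral ?M f"
    by metis
  define S where "S n = cone_translation (xs n)" for n
  have Sm: "S n f \<in> borel_measurable ?M" if "f \<in> borel_measurable ?M" for n f
    using that cone_translation_measurable[OF xs(1)] by (simp add: M S_def)
  have mean: "slice_mean \<nu> \<in> L2_bounded_ops ?M" unfolding M by (rule sl.slice_mean_bounded_op)
  have S: "S n \<in> L2_bounded_ops ?M" for n
  proof -
    obtain K where K: "0 \<le> K" "\<And>f. f \<in> L2 ?M \<Longrightarrow> sq_integral ?M (slice_mean \<nu> f) \<le> ennreal K * sq_integral ?M f"
      using L2_bounded_ops_bound[OF mean] by blast
    let ?e = "(1 / real (Suc n))\<^sup>2"
    show ?thesis
    proof (rule L2_bounded_opsI[where K = "2 * ?e + 2 * K"])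
      fix f assume f: "f \<in> L2 ?M"
      have fm: "f \<in> borel_measurable ?M" using f by (rule L2D)
      show "S n f \<in> borel_measurable ?M" by (rule Sm[OF fm])
      have mm: "slice_mean \<nu> f \<in> borel_measurable ?M" using L2_bounded_opsD(1)[OF mean f] by (rule L2D)
      have "sq_integral ?M (\<lambda>z. (S n f z - slice_mean \<nu> f z) + slice_mean \<nu> f z)
          \<le> 2 * sq_integral ?M (\<lambda>z. S n f z - slice_mean \<nu> f z) + 2 * sq_integral ?M (slice_mean \<nu> f)"
        by (intro sq_integral_add_le borel_measurable_diff Sm fm mm)
      also have "\<dots> \<le> 2 * (ennreal ?e * sq_integral ?M f) + 2 * (ennreal K * sq_integral ?M f)"
        unfolding S_def by (intro add_mono mult_left_mono xs(2) K(2) f fm) auto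
      also have "\<dots> = ennreal (2 * ?e + 2 * K) * sq_integral ?M f"
        using K(1) by (simp add: ennreal_plus ennreal_mult distrib_right mult.assoc)
      finally show "sq_integral ?M (S n f) \<le> ennreal (2 * ?e + 2 * K) * sq_integral ?M f" by simp
      show "AE z in ?M. S n (\<lambda>y. c * f y) z = c * S n f z" for c
        by (simp add: S_def cone_translation_def translation_sum_cmult)
      fix g
      show "AE z in ?M. S n (\<lambda>y. f y + g y) z = S n f z + S n g z"
        by (simp add: S_def cone_translation_def translation_sum_add)
    qed
  qed
  have T: "?T \<in> L2_bounded_ops ?M" by (rule drutu_nowak_projection(1)) unfold_locales
  have ball: "L2_norm ?M (\<lambda>z. S n f z - ?T f z) \<le> 1 / real (Suc n)" if f: "f \<in> L2 ?M" and f1: "L2_norm ?M f \<le> 1" for n f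
  proof -
    have d: "(\<lambda>z. S n f z - ?T f z) \<in> L2 ?M"
      by (rule L2_diff[OF L2_bounded_opsD(1)[OF S f] L2_bounded_opsD(1)[OF T f]])
    have "sq_integral ?M (\<lambda>z. S n f z - ?T f z) = sq_integral ?M (\<lambda>z. S n f z - slice_mean \<nu> f z)"
      using drutu_nowak_projection(2)[OF prob_space_axioms f]
      by (intro sq_integral_cong_AE) (auto elim!: eventually_mono)
    also have "\<dots> \<le> ennreal ((1 / real (Suc n))\<^sup>2) * sq_integral ?M f"
      unfolding S_def by (intro xs(2) L2D(1)[OF f])
    also have "\<dots> \<le> ennreal ((1 / real (Suc n))\<^sup>2) * 1"
      using f1 L2_norm_le_iff[OF f, of 1] by (intro mult_left_mono) auto
    finally show ?thesis by (subst L2_norm_le_iff[OF d]) auto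
  qed
  have lim: "(\<lambda>n. L2_opnorm ?M (\<lambda>f z. S n f z - ?T f z)) \<longlonglongrightarrow> 0"
  proof (rule tendsto_sandwich[OF _ _ tendsto_const])
    show "\<forall>\<^sub>F n in sequentially. 0 \<le> L2_opnorm ?M (\<lambda>f z. S n f z - ?T f z)"
      using L2_opnorm_nonneg[where T = "\<lambda>f z. S _ f z - ?T f z", OF ball] by simp
    show "\<forall>\<^sub>F n in sequentially. L2_opnorm ?M (\<lambda>f z. S n f z - ?T f z) \<le> 1 / real (Suc n)"
      using L2_opnorm_le[where T = "\<lambda>f z. S _ f z - ?T f z", OF ball] by simp
    show "(\<lambda>n. 1 / real (Suc n)) \<longlonglongrightarrow> 0"
      using LIMSEQ_inverse_real_of_nat by (simp add: inverse_eq_divide)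
  qed
  have "finite_propagation ?M (cone_metric G l \<rho>) (S n)" for n
    unfolding S_def by (rule cone_translation_finite_propagation[OF xs(1)])
  with S lim show ?thesis unfolding opnorm_limit_of_finite_propagation_def by blast
qed

end

theorem theoremE:
  fixes G :: "('g, 'm) monoid_scheme"
    and l :: "'g \<Rightarrow> nat"
    and \<nu> :: "'x::metric_space measure"
    and \<rho> :: "'g \<Rightarrow> 'x \<Rightarrow> 'x"
  assumes "\<And>x y :: 'x. dist x y \<le> 2"
    and "prob_space \<nu>"
    and "radon_measure \<nu>"
    and "group G"
    and "countable (carrier G)"
    and "proper_length_function G l"
    and "continuous_action G \<rho>"
    and "measure_class_preserving G \<nu> \<rho>"
  shows "(asymptotically_expanding G l \<nu> \<rho> \<longleftrightarrow>
            quasi_local (cone_measure \<nu>) (cone_metric G l \<rho>) (drutu_nowak_projection \<nu>)) \<and>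
         (quasi_local (cone_measure \<nu>) (cone_metric G l \<rho>) (drutu_nowak_projection \<nu>) \<longleftrightarrow>
            opnorm_limit_of_finite_propagation (cone_measure \<nu>) (cone_metric G l \<rho>)
              (drutu_nowak_projection \<nu>))"
proof -
  interpret prob_space \<nu> by fact
  interpret group_action G "UNIV :: 'x set" \<rho>
    using assms(7) by (simp add: continuous_action_def)
  interpret measured_action G \<rho> l \<nu>
    using assms(3,6-8)
    by unfold_locales (auto simp: continuous_action_def radon_measure_def)
  let ?M = "cone_measure \<nu>" and ?d = "cone_metric G l \<rho>" and ?T = "drutu_nowak_projection \<nu>"
  have "asymptotically_expanding G l \<nu> \<rho> \<Longrightarrow> opnorm_limit_of_finite_propagation ?M ?d ?T"
    by (rule finite_propagation_limit_if_expanding)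
  moreover have "opnorm_limit_of_finite_propagation ?M ?d ?T \<Longrightarrow> quasi_local ?M ?d ?T"
    by (rule quasi_local_of_finite_propagation_limit[OF drutu_nowak_projection(1)[OF assms(2)]])
  moreover have "quasi_local ?M ?d ?T \<Longrightarrow> asymptotically_expanding G l \<nu> \<rho>"
    by (rule expanding_if_quasi_local[OF assms(3)])
  ultimately show ?thesis by blast
qed

end
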